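(* Let $N\ge 3$, let $\Omega\subset\mathbb{R}^N$ be a bounded domain, let $\rho^\ast\in P(\partial\Omega)$ be an equilibrium measure for $\mathcal{E}$, and set $\lambda^\ast:=\langle\rho^\ast,\phi_{\rho^\ast}\rangle$. Then for every $\mu\in P(\partial\Omega)$ $$\lambda^\ast=\langle\rho^\ast,\phi_{\rho^\ast}\rangle=\langle\mu,\phi_{\rho^\ast}\rangle.$$ Moreover, the value $\lambda^\ast$ and the potential $\phi_{\rho^\ast}$ are unique in the following sense: whenever $\rho^\ast,\rho^{\ast\ast}\in P(\partial\Omega)$ are equilibrium measures for $\mathcal{E}$, then $\phi_{\rho^\ast}=\phi_{\rho^{\ast\ast}}$ and $\lambda^\ast=\lambda^{\ast\ast}$, where $\lambda^{\ast\ast}:=\langle\rho^{\ast\ast},\phi_{\rho^{\ast\ast}}\rangle$.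
   Context: $P(\partial\Omega)$ is the set of positive Borel measures $\rho$ on $\mathbb{R}^N$ supported on $\partial\Omega$ with $\rho(\partial\Omega)=1$. $D^{1,2}(\mathbb{R}^N)$ is the completion of $C_c^\infty(\mathbb{R}^N)$ with respect to $\|\nabla\cdot\|_{L^2}$. Set $\mathcal{X}=D^{1,2}(\mathbb{R}^N)\cap\{\phi\in C^{0,1}(\mathbb{R}^N):\|\nabla\phi\|_\infty\le 1\}$; functions in $\mathcal X$ are bounded, continuous and tend to $0$ at infinity. For $\rho\in P(\partial\Omega)$ let $$\mathcal{I}_\rho(\phi)=\int_{\mathbb{R}^N}\left(1-\sqrt{1-|\nabla\phi|^2}\right)dx-\langle\rho,\phi\rangle,\quad \phi\in\mathcal{X},\qquad \langle\rho,\phi\rangle=\int_{\partial\Omega}\phi\,d\rho .$$ It is known that $\mathcal{I}_\rho$ has a unique minimizer on $\mathcal{X}$, denoted $\phi_\rho$. The electrostatic energy is $\mathcal{E}(\phi_\rho):=-\mathcal{I}_\rho(\phi_\rho)$. A measure $\rho^\ast\in P(\partial\Omega)$ is an equilibrium measure for $\mathcal{E}$ if $\mathcal{E}(\phi_{\rho^\ast})=\inf_{\rho\in P(\partial\Omega)}\mathcal{E}(\phi_\rho)$. *)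

theory Defs
  imports "HOL-Analysis.Analysis"
begin

text \<open>\<open>\<real>\<^sup>N\<close> is rendered as an arbitrary type \<open>'a\<close> of class \<open>euclidean_space\<close>, with \<open>N = DIM('a)\<close>.\<close>

primrec C_diff :: "nat \<Rightarrow> ('a::euclidean_space \<Rightarrow> real) \<Rightarrow> bool" where
  "C_diff 0 f \<longleftrightarrow> continuous_on UNIV f"
| "C_diff (Suc k) f \<longleftrightarrow>
     (\<forall>x. f differentiable (at x)) \<and>
     (\<forall>b\<in>Basis. C_diff k (\<lambda>x. frechet_derivative f (at x) b))"

definition Cc_infty :: "('a::euclidean_space \<Rightarrow> real) set" where
  "Cc_infty = {f. (\<forall>k. C_diff k f) \<and> compact (closure {x. f x \<noteq> 0})}"

definition grad :: "('a::euclidean_space \<Rightarrow> real) \<Rightarrow> 'a \<Rightarrow> 'a" where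
  "grad f x = (THE D. GDERIV f x :> D)"

definition has_weak_grad ::
    "('a::euclidean_space \<Rightarrow> real) \<Rightarrow> ('a \<Rightarrow> 'a) \<Rightarrow> bool" where
  "has_weak_grad f g \<longleftrightarrow>
     (\<forall>K. compact K \<longrightarrow> set_integrable lborel K f \<and> set_integrable lborel K g) \<and>
     (\<forall>\<psi>\<in>Cc_infty.
        (\<integral>x. f x *\<^sub>R grad \<psi> x \<partial>lborel) = - (\<integral>x. \<psi> x *\<^sub>R g x \<partial>lborel))"

text \<open>An arbitrary representative of the weak gradient, which is unique up to null sets.
  It is used only under integrals and almost-everywhere quantifiers.\<close>

definition weak_grad :: "('a::euclidean_space \<Rightarrow> real) \<Rightarrow> 'a \<Rightarrow> 'a" where
  "weak_grad f = (SOME g. has_weak_grad f g)"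

definition grad_norm :: "('a::euclidean_space \<Rightarrow> real) \<Rightarrow> real" where
  "grad_norm u = sqrt (\<integral>x. (norm (grad u x))\<^sup>2 \<partial>lborel)"

text \<open>The completion of \<open>Cc_infty\<close> with respect to \<open>grad_norm\<close>, realised as a space of functions.
  For \<open>N \<ge> 3\<close>, a Cauchy sequence for \<open>grad_norm\<close> converges in \<open>L\<^sup>p\<close> with
  \<open>p = 2N/(N-2)\<close> by the Sobolev inequality, and the element of the completion that it represents
  is identified with its limit. Elements are functions rather than classes modulo null sets.\<close>

definition D12 :: "('a::euclidean_space \<Rightarrow> real) set" where
  "D12 = {f. f \<in> borel_measurable lborel \<and>
     (\<exists>u :: nat \<Rightarrow> 'a \<Rightarrow> real.
        (\<forall>n. u n \<in> Cc_infty) \<and>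
        (\<forall>e>0. \<exists>M. \<forall>m\<ge>M. \<forall>n\<ge>M. grad_norm (\<lambda>x. u m x - u n x) < e) \<and>
        (\<lambda>n. \<integral>\<^sup>+x. ennreal (\<bar>u n x - f x\<bar> powr
               (2 * real DIM('a) / (real DIM('a) - 2))) \<partial>lborel) \<longlonglongrightarrow> 0)}"

text \<open>The Lipschitz condition selects the continuous representative, so equality of elements
  of \<open>XX\<close> is pointwise equality.\<close>

definition XX :: "('a::euclidean_space \<Rightarrow> real) set" where
  "XX = D12 \<inter> {\<phi>. (\<exists>L. L-lipschitz_on UNIV \<phi>) \<and> (AE x in lborel. norm (weak_grad \<phi> x) \<le> 1)}"

definition prob_boundary :: "'a::euclidean_space set \<Rightarrow> 'a measure set" where
  "prob_boundary \<Omega> =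
     {\<rho>. sets \<rho> = sets borel \<and> emeasure \<rho> (- frontier \<Omega>) = 0 \<and> emeasure \<rho> (frontier \<Omega>) = 1}"

definition pairing ::
    "'a::euclidean_space set \<Rightarrow> 'a measure \<Rightarrow> ('a \<Rightarrow> real) \<Rightarrow> real" where
  "pairing \<Omega> \<rho> \<phi> = (LINT x:frontier \<Omega>|\<rho>. \<phi> x)"

definition BI_functional ::
    "'a::euclidean_space set \<Rightarrow> 'a measure \<Rightarrow> ('a \<Rightarrow> real) \<Rightarrow> real" where
  "BI_functional \<Omega> \<rho> \<phi> =
     (\<integral>x. 1 - sqrt (1 - (norm (weak_grad \<phi> x))\<^sup>2) \<partial>lborel) - pairing \<Omega> \<rho> \<phi>"

definition is_minimizer ::
    "'a::euclidean_space set \<Rightarrow> 'a measure \<Rightarrow> ('a \<Rightarrow> real) \<Rightarrow> bool" where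
  "is_minimizer \<Omega> \<rho> \<phi> \<longleftrightarrow>
     \<phi> \<in> XX \<and> (\<forall>\<psi>\<in>XX. BI_functional \<Omega> \<rho> \<phi> \<le> BI_functional \<Omega> \<rho> \<psi>)"

definition potential :: "'a::euclidean_space set \<Rightarrow> 'a measure \<Rightarrow> 'a \<Rightarrow> real" where
  "potential \<Omega> \<rho> = (THE \<phi>. is_minimizer \<Omega> \<rho> \<phi>)"

definition energy :: "'a::euclidean_space set \<Rightarrow> 'a measure \<Rightarrow> real" where
  "energy \<Omega> \<rho> = - BI_functional \<Omega> \<rho> (potential \<Omega> \<rho>)"

text \<open>The infimum is over a nonempty set bounded below: \<open>energy \<Omega> \<rho> \<ge> 0\<close>, by comparing the minimizer
  with \<open>0 \<in> XX\<close>.\<close>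

definition equilibrium_measure :: "'a::euclidean_space set \<Rightarrow> 'a measure \<Rightarrow> bool" where
  "equilibrium_measure \<Omega> \<rho> \<longleftrightarrow>
     \<rho> \<in> prob_boundary \<Omega> \<and> energy \<Omega> \<rho> = (INF \<mu>\<in>prob_boundary \<Omega>. energy \<Omega> \<mu>)"

end

theory Submission
  imports Defs "HOL-Computational_Algebra.Polynomial"
begin

text \<open>Write \<open>F \<phi>\<close> for the integral of \<open>1 - sqrt (1 - \<bar>\<nabla>\<phi>\<bar>\<^sup>2)\<close>. The energy of \<open>\<rho>\<close> is the maximum over \<open>\<phi>\<close> of
  \<open>\<langle>\<rho>, \<phi>\<rangle> - F \<phi>\<close>, hence convex in \<open>\<rho>\<close>. Since \<open>F\<close> is uniformly convex with respect to the Dirichlet norm, and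
  since for 1-Lipschitz functions the Sobolev inequality bounds the uniform norm by a power of the Dirichlet norm,
  minimizing sequences converge uniformly: this gives existence, uniqueness and stability of the potential, without
  weak compactness.

  Moving an equilibrium measure \<open>\<rho>\<close> with potential \<open>\<phi>\<close> towards another measure \<open>\<mu>\<close> shows \<open>\<langle>\<mu>, \<phi>\<rangle> \<ge> \<lambda>\<close>, so (taking
  point masses) \<open>\<phi> \<ge> \<lambda>\<close> on the boundary, with equality \<open>\<rho>\<close>-almost everywhere. Then smooth versions of
  \<open>min \<phi> \<lambda>\<close> are almost optimal competitors, so they converge to \<open>\<phi>\<close> and \<open>\<phi> \<le> \<lambda>\<close>. Uniqueness follows by applying
  convexity of the energy at the midpoint of two equilibrium measures.\<close>

text \<open>The density 1 - sqrt (1 - |v|^2) has infinite slope at |v| = 1, which makes first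
  variations delicate. Every step therefore compares values of the functional at admissible
  functions. The tool is the midpoint inequality F((phi + psi)/2) <= (F phi + F psi)/2 - L/8, with L
  the squared L2 distance of the gradients: the gain L/8 turns almost-minimality into closeness. The
  variation of the measure has the same form: testing with the potential of the mixture produces a
  factor t that cancels before the limit t -> 0 is taken. Elements of \<open>D12\<close> are only
  limits of test functions and \<open>weak_grad\<close> is a choice. So the Sobolev inequality, the
  chain rule and the passage from an almost-everywhere gradient bound to the Lipschitz constant 1
  are proved by approximation, with the gradient carried along explicitly in
  \<open>D12_grad\<close>. The chain rule is proved for smooth functions that vanish at 0, because
  composition must preserve test functions; hence the truncation is smooth, and stability absorbs
  its error.\<close>

section \<open>The grid-lines inequality\<close>

text \<open>The real power has \<open>0 powr 0 = 0\<close>. Here the zeroth power is 1 even at 0 and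
  infinity, so that nonnegative exponents always add and a factor with exponent zero drops out of a
  product, as happens at the end of the grid-lines inequality.\<close>

definition epow :: "ennreal \<Rightarrow> real \<Rightarrow> ennreal" where
  "epow a p = (if p = 0 then 1 else if a = \<infinity> then \<infinity> else ennreal (enn2real a powr p))"

lemma epow_0 [simp]: "epow a 0 = 1"
  by (simp add: epow_def)

lemma epow_top [simp]: "p \<noteq> 0 \<Longrightarrow> epow \<infinity> p = \<infinity>"
  by (simp add: epow_def)

lemma epow_zero [simp]: "p \<noteq> 0 \<Longrightarrow> epow 0 p = 0"
  by (simp add: epow_def)

lemma epow_ennreal: "r \<ge> 0 \<Longrightarrow> p \<noteq> 0 \<Longrightarrow> epow (ennreal r) p = ennreal (r powr p)"
  by (simp add: epow_def)

lemma epow_add: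
  assumes "p \<ge> 0" "q \<ge> 0"
  shows "epow a (p + q) = epow a p * epow a q"
proof (cases "p = 0 \<or> q = 0")
  case False
  with assms have "p > 0" "q > 0" by auto
  then show ?thesis
    by (cases a) (auto simp: epow_def powr_add ennreal_mult' ennreal_top_mult)
qed auto

lemma epow_mono:
  assumes "a \<le> b" "p \<ge> 0"
  shows "epow a p \<le> epow b p"
proof (cases "p = 0 \<or> b = \<infinity>")
  case False
  then obtain s where s: "b = ennreal s" "s \<ge> 0" by (cases b) auto
  with assms(1) obtain r where r: "a = ennreal r" "r \<ge> 0" by (cases a) (auto simp: top_unique)
  have "r \<le> s" using assms(1) r s by simp
  then show ?thesis using False r s assms(2)
    by (simp add: epow_ennreal ennreal_leI powr_mono2)
qed (use assms in \<open>auto simp: epow_def\<close>)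

lemma epow_pos: "a \<noteq> 0 \<Longrightarrow> epow a p \<noteq> 0"
  by (cases a) (auto simp: epow_def)

lemma measurable_epow [measurable]:
  "f \<in> borel_measurable M \<Longrightarrow> (\<lambda>x. epow (f x) p) \<in> borel_measurable M"
  unfolding epow_def infinity_ennreal_def by (cases "p = 0") auto

text \<open>Jensen's inequality for the concave logarithm, exponentiated; a vanishing
  \<open>x i\<close> makes the product zero and is treated apart.\<close>

lemma weighted_arith_geom_mean:
  fixes x p :: "'i \<Rightarrow> real"
  assumes "finite I" and p: "\<And>i. i \<in> I \<Longrightarrow> p i > 0" and "sum p I = 1"
    and x: "\<And>i. i \<in> I \<Longrightarrow> x i \<ge> 0"
  shows "(\<Prod>i\<in>I. x i powr p i) \<le> (\<Sum>i\<in>I. p i * x i)"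
proof (cases "\<exists>i\<in>I. x i = 0")
  case True
  then have "(\<Prod>i\<in>I. x i powr p i) = 0" using assms(1) by auto
  moreover have "(\<Sum>i\<in>I. p i * x i) \<ge> 0" using p x by (intro sum_nonneg mult_nonneg_nonneg) (auto simp: less_imp_le)
  ultimately show ?thesis by simp
next
  case False
  then have xp: "\<And>i. i \<in> I \<Longrightarrow> x i > 0" using x by force
  have ne: "I \<noteq> {}" using assms(3) by auto
  have "(\<Sum>i\<in>I. p i * ln (x i)) \<le> ln (\<Sum>i\<in>I. p i *\<^sub>R x i)"
    using p xp assms ne by (intro concave_on_sum[where C="{0<..}"] ln_concave) (auto simp: less_imp_le)
  moreover have "(\<Sum>i\<in>I. p i *\<^sub>R x i) > 0"
    using p xp assms(1) ne by (intro sum_pos) auto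
  ultimately have "exp (\<Sum>i\<in>I. p i * ln (x i)) \<le> (\<Sum>i\<in>I. p i *\<^sub>R x i)"
    using ln_ge_iff by blast
  moreover have "exp (\<Sum>i\<in>I. p i * ln (x i)) = (\<Prod>i\<in>I. x i powr p i)"
    using xp by (subst exp_sum[OF assms(1)]) (intro prod.cong, auto simp: powr_def, (use False in blast)+)
  ultimately show ?thesis by simp
qed

text \<open>This is the mean inequality for the ratios a_i / c_i. The scales \<open>c i\<close> are
  free; Hoelder's inequality takes them to be the integrals of the factors, so that the sum on the
  right integrates to 1.\<close>

lemma epow_arith_geom_mean:
  fixes a :: "'i \<Rightarrow> ennreal" and p :: "'i \<Rightarrow> real"
  assumes fin: "finite I" and p: "\<And>i. i \<in> I \<Longrightarrow> p i > 0" and s: "sum p I = 1"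
    and c: "\<And>i. i \<in> I \<Longrightarrow> c i > 0"
  shows "(\<Prod>i\<in>I. epow (a i) (p i))
    \<le> (\<Prod>i\<in>I. ennreal (c i powr p i)) * (\<Sum>i\<in>I. ennreal (p i / c i) * a i)"
proof (cases "\<exists>i\<in>I. a i = \<infinity>")
  case True
  then obtain i where i: "i \<in> I" "a i = \<infinity>" by auto
  have "ennreal (p i / c i) * a i = \<infinity>"
    using p[OF i(1)] c[OF i(1)] i(2) by (simp add: ennreal_mult_top)
  then have "(\<Sum>i\<in>I. ennreal (p i / c i) * a i) = \<infinity>" using i fin
    by (auto simp: infinity_ennreal_def intro!: bexI[of _ i])
  moreover have "(\<Prod>i\<in>I. ennreal (c i powr p i)) \<noteq> 0"
    by simp (metis c less_irrefl)
  then have "(\<Prod>i\<in>I. ennreal (c i powr p i)) * (\<Sum>i\<in>I. ennreal (p i / c i) * a i) = \<infinity>"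
    using calculation by (simp add: ennreal_mult_top del: ennreal_prod_eq_0)
  then show ?thesis by simp
next
  case False
  define r where "r i = enn2real (a i)" for i
  have a: "a i = ennreal (r i)" "r i \<ge> 0" if "i \<in> I" for i
    using False that unfolding r_def by (auto simp: less_top[symmetric])
  have "(\<Prod>i\<in>I. epow (a i) (p i)) = (\<Prod>i\<in>I. ennreal (r i powr p i))"
    using a p by (intro prod.cong refl) (simp add: epow_ennreal less_imp_neq[symmetric])
  also have "\<dots> = ennreal (\<Prod>i\<in>I. r i powr p i)" by (simp add: prod_ennreal)
  also have "(\<Prod>i\<in>I. r i powr p i) = (\<Prod>i\<in>I. c i powr p i) * (\<Prod>i\<in>I. (r i / c i) powr p i)"
    unfolding prod.distrib[symmetric]
    using a c by (intro prod.cong refl) (simp add: powr_divide less_imp_le less_imp_neq[symmetric])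
  also have "\<dots> \<le> (\<Prod>i\<in>I. c i powr p i) * (\<Sum>i\<in>I. p i * (r i / c i))"
    using a c by (intro mult_left_mono weighted_arith_geom_mean fin p s prod_nonneg) (auto simp: less_imp_le)
  finally have "(\<Prod>i\<in>I. epow (a i) (p i)) \<le> ennreal ((\<Prod>i\<in>I. c i powr p i) * (\<Sum>i\<in>I. p i * (r i / c i)))"
    by (simp add: ennreal_leI)
  also have "\<dots> = (\<Prod>i\<in>I. ennreal (c i powr p i)) * (\<Sum>i\<in>I. ennreal (p i * (r i / c i)))"
    using a p c by (subst ennreal_mult) (auto intro!: prod_nonneg sum_nonneg simp: prod_ennreal sum_ennreal less_imp_le)
  also have "(\<Sum>i\<in>I. ennreal (p i * (r i / c i))) = (\<Sum>i\<in>I. ennreal (p i / c i) * a i)"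
    using a p c by (intro sum.cong refl) (simp add: ennreal_mult[symmetric] less_imp_le)
  finally show ?thesis .
qed

text \<open>With every integral normalized to 1 this is the integrated mean inequality. Zero
  exponents are removed first; zero or infinite integrals cannot be normalized and are separate
  cases.\<close>

lemma nn_integral_Holder_prod:
  fixes f :: "'i \<Rightarrow> 'b \<Rightarrow> ennreal" and p :: "'i \<Rightarrow> real"
  assumes fin: "finite I" and p: "\<And>i. i \<in> I \<Longrightarrow> p i \<ge> 0" and s: "sum p I = 1"
    and [measurable]: "\<And>i. i \<in> I \<Longrightarrow> f i \<in> borel_measurable M"
  shows "(\<integral>\<^sup>+x. (\<Prod>i\<in>I. epow (f i x) (p i)) \<partial>M) \<le> (\<Prod>i\<in>I. epow (\<integral>\<^sup>+x. f i x \<partial>M) (p i))"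
proof -
  define J where "J = {i\<in>I. p i > 0}"
  have J: "finite J" "\<And>i. i \<in> J \<Longrightarrow> p i > 0" "\<And>i. i \<in> J \<Longrightarrow> i \<in> I"
    using fin by (auto simp: J_def)
  have pz: "p i = 0" if "i \<in> I - J" for i using p that by (force simp: J_def)
  have sJ: "sum p J = 1"
    using s sum.mono_neutral_right[OF fin, of J p] J pz by auto
  have red: "(\<Prod>i\<in>I. epow (g i) (p i)) = (\<Prod>i\<in>J. epow (g i) (p i))" for g
    using fin J pz by (intro prod.mono_neutral_right) auto
  have [measurable]: "\<And>i. i \<in> J \<Longrightarrow> f i \<in> borel_measurable M" using J assms by auto
  let ?F = "\<lambda>i. \<integral>\<^sup>+x. f i x \<partial>M"
  have "(\<integral>\<^sup>+x. (\<Prod>i\<in>J. epow (f i x) (p i)) \<partial>M) \<le> (\<Prod>i\<in>J. epow (?F i) (p i))"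
  proof (cases "\<exists>i\<in>J. ?F i = 0")
    case True
    then obtain i where i: "i \<in> J" "?F i = 0" by auto
    then have "AE x in M. f i x = 0" by (subst (asm) nn_integral_0_iff_AE) auto
    then have "AE x in M. (\<Prod>i\<in>J. epow (f i x) (p i)) = 0"
    proof eventually_elim
      case (elim x)
      then show ?case using i J(1) J(2)[OF i(1)] by (intro prod_zero) (auto intro!: bexI[of _ i])
    qed
    then have "(\<integral>\<^sup>+x. (\<Prod>i\<in>J. epow (f i x) (p i)) \<partial>M) = 0"
      using J by (subst nn_integral_0_iff_AE) auto
    then show ?thesis by simp
  next
    case nz: False
    show ?thesis
    proof (cases "\<exists>i\<in>J. ?F i = \<infinity>")
      case True
      \<comment> \<open>In \<open>ennreal\<close>, 0 * infinity = 0, so an infinite factor makes the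
        product infinite only because \<open>nz\<close> excludes vanishing factors.\<close>
      then have "(\<Prod>i\<in>J. epow (?F i) (p i)) = \<infinity>"
        using J nz epow_pos
        unfolding infinity_ennreal_def ennreal_prod_eq_top
        by (auto intro: epow_pos) (metis J(2) epow_top infinity_ennreal_def less_irrefl)
      then show ?thesis by simp
    next
      case False
      define c where "c i = enn2real (?F i)" for i
      have c: "?F i = ennreal (c i)" "c i > 0" if "i \<in> J" for i
        using False nz that unfolding c_def
        by (auto simp: less_top[symmetric] enn2real_positive_iff zero_less_iff_neq_zero)
      have "(\<integral>\<^sup>+x. (\<Prod>i\<in>J. epow (f i x) (p i)) \<partial>M)
        \<le> (\<integral>\<^sup>+x. (\<Prod>i\<in>J. ennreal (c i powr p i)) * (\<Sum>i\<in>J. ennreal (p i / c i) * f i x) \<partial>M)"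
        by (intro nn_integral_mono epow_arith_geom_mean J sJ c)
      also have "\<dots> = (\<Prod>i\<in>J. ennreal (c i powr p i)) * (\<Sum>i\<in>J. ennreal (p i / c i) * ?F i)"
        by (simp add: nn_integral_cmult nn_integral_sum)
      also have "(\<Sum>i\<in>J. ennreal (p i / c i) * ?F i) = (\<Sum>i\<in>J. ennreal (p i))"
        using c J by (intro sum.cong refl) (simp add: ennreal_mult[symmetric] less_imp_le less_imp_neq[symmetric])
      also have "\<dots> = 1" using sJ J by (subst sum_ennreal) (auto simp: less_imp_le)
      also have "(\<Prod>i\<in>J. ennreal (c i powr p i)) = (\<Prod>i\<in>J. epow (?F i) (p i))"
        using c J by (intro prod.cong refl) (simp add: epow_ennreal less_imp_le less_imp_neq[symmetric])
      finally show ?thesis by simp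
    qed
  qed
  then show ?thesis by (simp add: red)
qed

text \<open>The leading factor carries the induction. Let n be the number of old coordinates and A
  the integral of f over the new one. In the integral over the new coordinate the factor A^p is
  constant. Hoelder with exponents 1 - n p for f and p for each of the n other line integrals (total
  1) bounds the rest by A^(1 - n p) times powers of line integrals of A. Together this is the
  integrand of the same statement for A.\<close>

lemma (in product_sigma_finite) grid_lines_PiM:
  assumes "finite I" "p \<ge> 0" "(real (card I) - 1) * p \<le> 1"
    and "f \<in> borel_measurable (Pi\<^sub>M I M)"
  shows "(\<integral>\<^sup>+x. epow (f x) (1 - (real (card I) - 1) * p) *
      (\<Prod>i\<in>I. epow (\<integral>\<^sup>+t. f (x(i := t)) \<partial>M i) p) \<partial>Pi\<^sub>M I M)
    \<le> epow (\<integral>\<^sup>+x. f x \<partial>Pi\<^sub>M I M) (1 + p)"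
  using assms
proof (induction I arbitrary: f rule: finite_induct)
  case empty
  then show ?case by (simp add: nn_integral_empty)
next
  case (insert i I)
  note f [measurable] = insert.prems(3)
  have n: "real (card (insert i I)) - 1 = real (card I)" using insert.hyps by simp
  have np: "real (card I) * p \<le> 1" using insert.prems n by simp
  define A where "A x = (\<integral>\<^sup>+t. f (x(i := t)) \<partial>M i)" for x
  have upd: "(\<lambda>(x, t). x(i := t)) \<in> measurable (Pi\<^sub>M I M \<Otimes>\<^sub>M M i) (Pi\<^sub>M (insert i I) M)"
    by (rule measurable_add_dim)
  have [measurable]: "(\<lambda>z. f ((fst z)(i := snd z))) \<in> borel_measurable (Pi\<^sub>M I M \<Otimes>\<^sub>M M i)"
    using measurable_compose[OF upd f] by (simp add: case_prod_unfold)
  have A [measurable]: "A \<in> borel_measurable (Pi\<^sub>M I M)"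
    unfolding A_def by (intro M.borel_measurable_nn_integral) (simp add: case_prod_unfold)
  have upd2: "(\<lambda>z. x(j := snd z, i := fst z)) \<in> measurable (M i \<Otimes>\<^sub>M M j) (Pi\<^sub>M (insert i I) M)"
    if "x \<in> space (Pi\<^sub>M I M)" "j \<in> I" for x j
    using that by (intro measurable_fun_upd[where J=I] measurable_fun_upd[where J=I and I=I]) auto
  have "(\<integral>\<^sup>+x. epow (f x) (1 - (real (card (insert i I)) - 1) * p) *
      (\<Prod>j\<in>insert i I. epow (\<integral>\<^sup>+t. f (x(j := t)) \<partial>M j) p) \<partial>Pi\<^sub>M (insert i I) M)
    = (\<integral>\<^sup>+x. \<integral>\<^sup>+t. epow (f (x(i := t))) (1 - real (card I) * p) *
      (\<Prod>j\<in>insert i I. epow (\<integral>\<^sup>+s. f (x(i := t, j := s)) \<partial>M j) p) \<partial>M i \<partial>Pi\<^sub>M I M)"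
    unfolding n
  proof (rule product_nn_integral_insert[OF insert.hyps(1,2)])
    have "(\<lambda>x. (\<integral>\<^sup>+t. f (x(j := t)) \<partial>M j)) \<in> borel_measurable (Pi\<^sub>M (insert i I) M)"
      if "j \<in> insert i I" for j
    proof -
      have "(\<lambda>z. (fst z)(j := snd z)) \<in> measurable (Pi\<^sub>M (insert i I) M \<Otimes>\<^sub>M M j) (Pi\<^sub>M (insert i I) M)"
        using that by (intro measurable_fun_upd[where J="insert i I"]) auto
      from measurable_compose[OF this f] show ?thesis
        by (intro M.borel_measurable_nn_integral) (simp only: case_prod_unfold)
    qed
    then show "(\<lambda>x. epow (f x) (1 - real (card I) * p) *
      (\<Prod>j\<in>insert i I. epow (\<integral>\<^sup>+t. f (x(j := t)) \<partial>M j) p)) \<in> borel_measurable (Pi\<^sub>M (insert i I) M)"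
      by measurable
  qed
  also have "\<dots> \<le> (\<integral>\<^sup>+x. epow (A x) (1 - (real (card I) - 1) * p) *
      (\<Prod>j\<in>I. epow (\<integral>\<^sup>+s. A (x(j := s)) \<partial>M j) p) \<partial>Pi\<^sub>M I M)"
  proof (intro nn_integral_mono)
    fix x assume x: "x \<in> space (Pi\<^sub>M I M)"
    define h where "h j t = (if j = i then f (x(i := t)) else \<integral>\<^sup>+s. f (x(i := t, j := s)) \<partial>M j)" for j t
    define q where "q j = (if j = i then 1 - real (card I) * p else p)" for j
    have hi [measurable]: "h i \<in> borel_measurable (M i)"
    proof -
      have "(\<lambda>t. x(i := t)) \<in> measurable (M i) (Pi\<^sub>M (insert i I) M)"
        using x by (intro measurable_fun_upd[where J=I]) auto
      then show ?thesis unfolding h_def by simp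
    qed
    have fj: "(\<lambda>z. f (x(j := snd z, i := fst z))) \<in> borel_measurable (M i \<Otimes>\<^sub>M M j)" if "j \<in> I" for j
      by (rule measurable_compose[OF upd2[OF x that] f])
    have hj: "h j t = (\<integral>\<^sup>+s. f (x(j := s, i := t)) \<partial>M j)" if "j \<in> I" for j t
      using that insert.hyps(2) unfolding h_def by (auto simp: fun_upd_twist)
    have hm [measurable]: "h j \<in> borel_measurable (M i)" if "j \<in> I" for j
    proof -
      have "(\<lambda>t. \<integral>\<^sup>+s. f (x(j := s, i := t)) \<partial>M j) \<in> borel_measurable (M i)"
        using fj[OF that] by (intro M.borel_measurable_nn_integral) (simp add: case_prod_unfold)
      then show ?thesis using hj[OF that] by (simp add: fun_eq_iff cong: measurable_cong)
    qed
    have hm' [measurable]: "h j \<in> borel_measurable (M i)" if "j \<in> insert i I" for j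
      using that hi hm by auto
    have "(\<integral>\<^sup>+t. epow (f (x(i := t))) (1 - real (card I) * p) *
        (\<Prod>j\<in>insert i I. epow (\<integral>\<^sup>+s. f (x(i := t, j := s)) \<partial>M j) p) \<partial>M i)
      = (\<integral>\<^sup>+t. epow (A x) p * (\<Prod>j\<in>insert i I. epow (h j t) (q j)) \<partial>M i)"
    proof (intro nn_integral_cong)
      fix t
      have "(\<Prod>j\<in>I. epow (h j t) (q j)) = (\<Prod>j\<in>I. epow (\<integral>\<^sup>+s. f (x(i := t, j := s)) \<partial>M j) p)"
        using insert.hyps(2) by (intro prod.cong refl) (auto simp: h_def q_def)
      then show "epow (f (x(i := t))) (1 - real (card I) * p) *
          (\<Prod>j\<in>insert i I. epow (\<integral>\<^sup>+s. f (x(i := t, j := s)) \<partial>M j) p)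
        = epow (A x) p * (\<Prod>j\<in>insert i I. epow (h j t) (q j))"
        using insert.hyps by (simp add: A_def h_def q_def ac_simps)
    qed
    also have "\<dots> = epow (A x) p * (\<integral>\<^sup>+t. (\<Prod>j\<in>insert i I. epow (h j t) (q j)) \<partial>M i)"
      by (rule nn_integral_cmult) measurable
    also have "\<dots> \<le> epow (A x) p * (\<Prod>j\<in>insert i I. epow (\<integral>\<^sup>+t. h j t \<partial>M i) (q j))"
    proof (intro mult_left_mono nn_integral_Holder_prod)
      have "sum q I = real (card I) * p" using insert.hyps(2)
        by (subst sum.cong[of I I q "\<lambda>_. p"]) (auto simp: q_def)
      then show "sum q (insert i I) = 1" using insert.hyps by (simp add: q_def)
    qed (use insert.hyps insert.prems np in \<open>auto simp: q_def\<close>)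
    also have "\<dots> = epow (A x) p * (epow (A x) (1 - real (card I) * p) * (\<Prod>j\<in>I. epow (\<integral>\<^sup>+s. A (x(j := s)) \<partial>M j) p))"
    proof -
      have "(\<integral>\<^sup>+t. h j t \<partial>M i) = (\<integral>\<^sup>+s. A (x(j := s)) \<partial>M j)" if "j \<in> I" for j
      proof -
        interpret pair_sigma_finite "M i" "M j"
          by (simp add: pair_sigma_finite_def sigma_finite_measures)
        have "(\<integral>\<^sup>+t. h j t \<partial>M i) = (\<integral>\<^sup>+t. \<integral>\<^sup>+s. f (x(j := s, i := t)) \<partial>M j \<partial>M i)"
          using hj[OF that] by simp
        also have "\<dots> = (\<integral>\<^sup>+s. \<integral>\<^sup>+t. f (x(j := s, i := t)) \<partial>M i \<partial>M j)"
          using fj[OF that] by (intro Fubini'[symmetric]) (simp add: case_prod_unfold)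
        finally show ?thesis by (simp add: A_def)
      qed
      then have "(\<Prod>j\<in>I. epow (\<integral>\<^sup>+t. h j t \<partial>M i) (q j)) = (\<Prod>j\<in>I. epow (\<integral>\<^sup>+s. A (x(j := s)) \<partial>M j) p)"
        using insert.hyps(2) by (intro prod.cong refl) (auto simp: q_def)
      then show ?thesis using insert.hyps by (simp add: q_def h_def A_def)
    qed
    also have "\<dots> = epow (A x) (1 - (real (card I) - 1) * p) * (\<Prod>j\<in>I. epow (\<integral>\<^sup>+s. A (x(j := s)) \<partial>M j) p)"
    proof -
      have "epow (A x) (1 - (real (card I) - 1) * p) = epow (A x) (p + (1 - real (card I) * p))"
        by (simp add: algebra_simps)
      then show ?thesis using np insert.prems(1) by (simp add: epow_add mult.assoc)
    qed
    finally show "(\<integral>\<^sup>+t. epow (f (x(i := t))) (1 - real (card I) * p) *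
        (\<Prod>j\<in>insert i I. epow (\<integral>\<^sup>+s. f (x(i := t, j := s)) \<partial>M j) p) \<partial>M i)
      \<le> epow (A x) (1 - (real (card I) - 1) * p) * (\<Prod>j\<in>I. epow (\<integral>\<^sup>+s. A (x(j := s)) \<partial>M j) p)" .
  qed
  also have "\<dots> \<le> epow (\<integral>\<^sup>+x. A x \<partial>Pi\<^sub>M I M) (1 + p)"
    using insert.prems(1) np by (intro insert.IH A) (auto simp: algebra_simps)
  also have "(\<integral>\<^sup>+x. A x \<partial>Pi\<^sub>M I M) = (\<integral>\<^sup>+x. f x \<partial>Pi\<^sub>M (insert i I) M)"
    unfolding A_def by (rule product_nn_integral_insert[symmetric, OF insert.hyps(1,2) f])
  finally show ?case .
qed

text \<open>For p = 1/(N - 1) the exponent 1 - (N - 1) p vanishes, so g itself disappears and only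
  its line integrals remain.\<close>

lemma grid_lines_lborel:
  fixes g :: "'a::euclidean_space \<Rightarrow> ennreal"
  assumes [measurable]: "g \<in> borel_measurable borel" and N: "DIM('a) \<ge> 2"
  defines "p \<equiv> 1 / (real DIM('a) - 1)"
  shows "(\<integral>\<^sup>+x. (\<Prod>b\<in>Basis. epow (\<integral>\<^sup>+t. g (x + t *\<^sub>R b) \<partial>lborel) p) \<partial>lborel)
    \<le> epow (\<integral>\<^sup>+x. g x \<partial>lborel) (1 + p)"
proof -
  interpret P: product_sigma_finite "\<lambda>_::'a. lborel :: real measure" ..
  let ?P = "\<Pi>\<^sub>M b\<in>(Basis::'a set). (lborel :: real measure)"
  define X where "X f = (\<Sum>b\<in>(Basis::'a set). f b *\<^sub>R b)" for f :: "'a \<Rightarrow> real"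
  have X [measurable]: "X \<in> measurable ?P borel" unfolding X_def by measurable
  have lb: "lborel = distr ?P borel X" unfolding X_def by (rule lborel_eq)
  have p: "p \<ge> 0" "(real DIM('a) - 1) * p = 1" using N by (auto simp: p_def)
  \<comment> \<open>Replacing coordinate b by t moves the base point by t - x b along b; the shift
    of the integration variable by x b leaves the integral unchanged.\<close>
  have line: "(\<integral>\<^sup>+t. g (X (x(b := t))) \<partial>lborel) = (\<integral>\<^sup>+t. g (X x + t *\<^sub>R b) \<partial>lborel)" if "b \<in> Basis" for x b
  proof -
    have "X (x(b := t)) = X x + (- x b + 1 * t) *\<^sub>R b" for t
    proof -
      have "X (x(b := t)) = t *\<^sub>R b + (\<Sum>c\<in>Basis - {b}. x c *\<^sub>R c)"
        unfolding X_def using that by (subst sum.remove[of _ b]) (auto intro!: sum.cong)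
      moreover have "X x = x b *\<^sub>R b + (\<Sum>c\<in>Basis - {b}. x c *\<^sub>R c)"
        unfolding X_def using that by (subst sum.remove[of _ b]) auto
      ultimately show ?thesis by (simp add: algebra_simps)
    qed
    then show ?thesis
      using nn_integral_real_affine[of "\<lambda>t. g (X x + t *\<^sub>R b)" 1 "- x b"] by simp
  qed
  have m: "(\<lambda>x. \<integral>\<^sup>+t. g (x + t *\<^sub>R b) \<partial>lborel) \<in> borel_measurable borel" for b
    by measurable
  have "(\<integral>\<^sup>+x. (\<Prod>b\<in>Basis. epow (\<integral>\<^sup>+t. g (x + t *\<^sub>R b) \<partial>lborel) p) \<partial>lborel)
    = (\<integral>\<^sup>+x. (\<Prod>b\<in>Basis. epow (\<integral>\<^sup>+t. g (X x + t *\<^sub>R b) \<partial>lborel) p) \<partial>?P)"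
    unfolding lb using m by (subst nn_integral_distr) auto
  also have "\<dots> = (\<integral>\<^sup>+x. epow (g (X x)) (1 - (real DIM('a) - 1) * p) *
      (\<Prod>b\<in>Basis. epow (\<integral>\<^sup>+t. g (X (x(b := t))) \<partial>lborel) p) \<partial>?P)"
    by (simp add: p line)
  also have "\<dots> \<le> epow (\<integral>\<^sup>+x. g (X x) \<partial>?P) (1 + p)"
    using p by (intro P.grid_lines_PiM) auto
  also have "(\<integral>\<^sup>+x. g (X x) \<partial>?P) = (\<integral>\<^sup>+x. g x \<partial>lborel)"
    unfolding lb by (subst nn_integral_distr) auto
  finally show ?thesis .
qed

section \<open>Smooth functions\<close>

lemma C_diff_Suc_imp: "C_diff (Suc k) f \<Longrightarrow> C_diff k f"
proof (induction k arbitrary: f)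
  case 0
  then show ?case by (auto simp: continuous_on_eq_continuous_at differentiable_imp_continuous_within)
next
  case (Suc k)
  show ?case
    unfolding C_diff.simps(2)[of k]
  proof (intro conjI ballI allI)
    show "f differentiable at x" for x using Suc.prems by simp
    fix b :: 'a assume "b \<in> Basis"
    then have "C_diff (Suc k) (\<lambda>x. frechet_derivative f (at x) b)"
      using Suc.prems unfolding C_diff.simps(2)[of "Suc k"] by blast
    then show "C_diff k (\<lambda>x. frechet_derivative f (at x) b)" by (rule Suc.IH)
  qed
qed

lemma C_diff_differentiable: "C_diff (Suc k) f \<Longrightarrow> f differentiable (at x)"
  by simp

lemma C_diff_const: "C_diff k (\<lambda>x. c)"
proof (induction k arbitrary: c)
  case (Suc k)
  have "frechet_derivative (\<lambda>x. c) (at x) = (\<lambda>v. 0)" for x :: 'a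
    by (rule frechet_derivative_at[symmetric]) (rule has_derivative_const)
  then show ?case using Suc by simp
qed simp

lemma frechet_works: "f differentiable (at x) \<Longrightarrow> (f has_derivative frechet_derivative f (at x)) (at x)"
  by (simp add: frechet_derivative_works)

lemma C_diff_add: "C_diff k f \<Longrightarrow> C_diff k g \<Longrightarrow> C_diff k (\<lambda>x. f x + g x)"
proof (induction k arbitrary: f g)
  case 0
  then show ?case by (auto intro: continuous_intros)
next
  case (Suc k)
  have d: "f differentiable at x" "g differentiable at x" for x using Suc.prems by auto
  have "frechet_derivative (\<lambda>x. f x + g x) (at x) = (\<lambda>v. frechet_derivative f (at x) v + frechet_derivative g (at x) v)" for x
    using d by (intro frechet_derivative_at[symmetric] has_derivative_add frechet_works)
  then show ?case using Suc d by (auto intro!: derivative_intros Suc.IH)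
qed

lemma C_diff_mult: "C_diff k f \<Longrightarrow> C_diff k g \<Longrightarrow> C_diff k (\<lambda>x. f x * g x)"
proof (induction k arbitrary: f g)
  case 0
  then show ?case by (auto intro: continuous_intros)
next
  case (Suc k)
  have d: "f differentiable at x" "g differentiable at x" for x using Suc.prems by auto
  have "frechet_derivative (\<lambda>x. f x * g x) (at x) = (\<lambda>v. f x * frechet_derivative g (at x) v + frechet_derivative f (at x) v * g x)" for x
    using d by (intro frechet_derivative_at[symmetric] has_derivative_mult frechet_works)
  moreover have "C_diff k f" "C_diff k g" using Suc.prems C_diff_Suc_imp by blast+
  ultimately show ?case using Suc d by (auto intro!: derivative_intros Suc.IH C_diff_add)
qed

lemma C_diff_prod: "finite I \<Longrightarrow> (\<And>i. i \<in> I \<Longrightarrow> C_diff k (f i)) \<Longrightarrow> C_diff k (\<lambda>x. \<Prod>i\<in>I. f i x)"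
  by (induction I rule: finite_induct) (auto intro: C_diff_const C_diff_mult)

lemma C_diff_inner: "C_diff k (\<lambda>x. x \<bullet> b + c)"
proof (cases k)
  case 0
  then show ?thesis by (auto intro!: continuous_intros)
next
  case (Suc n)
  have h: "((\<lambda>x. x \<bullet> b + c) has_derivative (\<lambda>v. v \<bullet> b)) (at x)" for x
    by (auto intro!: derivative_eq_intros)
  have "frechet_derivative (\<lambda>x. x \<bullet> b + c) (at x) = (\<lambda>v. v \<bullet> b)" for x
    by (rule frechet_derivative_at[symmetric, OF h])
  then show ?thesis using Suc h by (auto simp: differentiable_def intro: C_diff_const)
qed

text \<open>Infinite differentiability on the real line, witnessed by a set of functions that is closed under
  differentiation.\<close>

definition real_smooth :: "(real \<Rightarrow> real) \<Rightarrow> bool" where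
  "real_smooth h \<longleftrightarrow>
     (\<exists>S. h \<in> S \<and> (\<forall>g\<in>S. \<exists>g'\<in>S. \<forall>t. (g has_real_derivative g' t) (at t)))"

lemma real_smoothD:
  assumes "real_smooth h"
  obtains h' where "real_smooth h'" "\<And>t. (h has_real_derivative h' t) (at t)"
  using assms unfolding real_smooth_def by metis

lemma real_smooth_deriv:
  assumes "real_smooth h" "\<And>t. (h has_real_derivative h' t) (at t)"
  shows "real_smooth h'"
proof -
  obtain k where k: "real_smooth k" "\<And>t. (h has_real_derivative k t) (at t)"
    using real_smoothD[OF assms(1)] by blast
  have "k = h'" using DERIV_unique[OF k(2) assms(2)] by auto
  with k show ?thesis by simp
qed

lemma C_diff_compose: "real_smooth h \<Longrightarrow> C_diff k f \<Longrightarrow> C_diff k (\<lambda>x. h (f x))"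
proof (induction k arbitrary: f h)
  case 0
  obtain h' where h': "\<And>t. (h has_real_derivative h' t) (at t)" using 0 real_smoothD by blast
  then have "continuous_on UNIV h" by (auto simp: continuous_on_eq_continuous_at intro: DERIV_isCont)
  then show ?case using 0 by (auto intro: continuous_on_compose2)
next
  case (Suc k)
  obtain h' where h': "real_smooth h'" "\<And>t. (h has_real_derivative h' t) (at t)"
    using Suc real_smoothD by blast
  have d: "f differentiable at x" for x using Suc.prems by auto
  have hd: "((\<lambda>x. h (f x)) has_derivative (\<lambda>v. h' (f x) * frechet_derivative f (at x) v)) (at x)" for x
    using has_derivative_compose[OF frechet_works[OF d] h'(2)[unfolded has_field_derivative_def]]
    by (simp add: mult.commute)
  have "frechet_derivative (\<lambda>x. h (f x)) (at x) = (\<lambda>v. h' (f x) * frechet_derivative f (at x) v)" for x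
    by (rule frechet_derivative_at[symmetric, OF hd])
  moreover have "C_diff k f" using Suc.prems C_diff_Suc_imp by blast
  then have "C_diff k (\<lambda>x. h' (f x))" by (rule Suc.IH[OF h'(1)])
  moreover have "C_diff k (\<lambda>x. frechet_derivative f (at x) b)" if "b \<in> Basis" for b
    using Suc.prems(2) that by simp
  moreover have "(\<lambda>x. h (f x)) differentiable at x" for x
    using hd unfolding differentiable_def by blast
  ultimately show ?case by (simp add: C_diff_mult)
qed

lemma compact_support_subset:
  fixes f :: "'a::heine_borel \<Rightarrow> real" and u :: "'a \<Rightarrow> real"
  assumes "compact (closure {x. u x \<noteq> 0})" "\<And>x. u x = 0 \<Longrightarrow> f x = 0"
  shows "compact (closure {x. f x \<noteq> 0})"
proof -
  have "{x. f x \<noteq> 0} \<subseteq> {x. u x \<noteq> 0}" using assms(2) by auto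
  then have "bounded {x. f x \<noteq> 0}"
    using assms(1) by (meson bounded_closure bounded_subset closure_subset compact_imp_bounded)
  then show ?thesis by (simp add: compact_closure)
qed

section \<open>Closure properties of test functions\<close>

lemma Cc_infty_zero: "(\<lambda>x. 0) \<in> Cc_infty"
  by (simp add: Cc_infty_def C_diff_const)

lemma Cc_infty_mult: "u \<in> Cc_infty \<Longrightarrow> (\<And>k. C_diff k v) \<Longrightarrow> (\<lambda>x. u x * v x) \<in> Cc_infty"
  unfolding Cc_infty_def using compact_support_subset[of u "\<lambda>x. u x * v x"] by (auto intro: C_diff_mult)

lemma Cc_infty_cmult: "u \<in> Cc_infty \<Longrightarrow> (\<lambda>x. c * u x) \<in> Cc_infty"
  using Cc_infty_mult[of u "\<lambda>x. c"] by (simp add: C_diff_const mult.commute)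

lemma Cc_infty_compose: "real_smooth h \<Longrightarrow> h 0 = 0 \<Longrightarrow> u \<in> Cc_infty \<Longrightarrow> (\<lambda>x. h (u x)) \<in> Cc_infty"
  unfolding Cc_infty_def using compact_support_subset[of u "\<lambda>x. h (u x)"] by (auto intro: C_diff_compose)

lemma Cc_infty_add:
  assumes u: "u \<in> Cc_infty" and v: "v \<in> Cc_infty" shows "(\<lambda>x. u x + v x) \<in> Cc_infty"
proof -
  have "{x. u x + v x \<noteq> 0} \<subseteq> {x. u x \<noteq> 0} \<union> {x. v x \<noteq> 0}" by auto
  moreover have "bounded ({x. u x \<noteq> 0} \<union> {x. v x \<noteq> 0})"
    using u v unfolding Cc_infty_def bounded_Un
    by (auto intro: bounded_subset[OF compact_imp_bounded closure_subset])
  ultimately have "bounded {x. u x + v x \<noteq> 0}" by (rule bounded_subset[rotated])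
  then show ?thesis using u v by (auto simp: Cc_infty_def compact_closure intro: C_diff_add)
qed

lemma Cc_infty_diff:
  assumes "u \<in> Cc_infty" "v \<in> Cc_infty" shows "(\<lambda>x. u x - v x) \<in> Cc_infty"
  using Cc_infty_add[OF assms(1) Cc_infty_cmult[OF assms(2), of "-1"]] by simp

section \<open>Gradients, supports and bounds of test functions\<close>

lemma gderiv_unique: "GDERIV f x :> D \<Longrightarrow> GDERIV f x :> E \<Longrightarrow> D = E"
  unfolding gderiv_def
  by (drule (1) has_derivative_unique) (metis (no_types) vector_eq_ldot fun_cong inner_commute)

lemma grad_eqI: "GDERIV f x :> D \<Longrightarrow> grad f x = D"
  unfolding grad_def by (rule the_equality) (auto intro: gderiv_unique)

lemma GDERIV_grad:
  fixes f :: "'a::euclidean_space \<Rightarrow> real"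
  assumes "f differentiable at x" shows "GDERIV f x :> grad f x"
proof -
  have h: "(f has_derivative frechet_derivative f (at x)) (at x)" using assms by (rule frechet_works)
  have lin: "linear (frechet_derivative f (at x))" using has_derivative_linear[OF h] .
  have "frechet_derivative f (at x) = (\<lambda>v. v \<bullet> (\<Sum>b\<in>Basis. frechet_derivative f (at x) b *\<^sub>R b))"
  proof
    fix v :: 'a
    have "frechet_derivative f (at x) v = frechet_derivative f (at x) (\<Sum>b\<in>Basis. (v \<bullet> b) *\<^sub>R b)"
      by (simp add: euclidean_representation)
    also have "\<dots> = (\<Sum>b\<in>Basis. (v \<bullet> b) *\<^sub>R frechet_derivative f (at x) b)"
      using lin by (simp add: linear_sum linear_scale)
    finally show "frechet_derivative f (at x) v = v \<bullet> (\<Sum>b\<in>Basis. frechet_derivative f (at x) b *\<^sub>R b)"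
      by (simp add: inner_sum_right mult.commute)
  qed
  with h have "GDERIV f x :> (\<Sum>b\<in>Basis. frechet_derivative f (at x) b *\<^sub>R b)"
    unfolding gderiv_def by simp
  with grad_eqI[OF this] show ?thesis by simp
qed

lemma grad_inner_Basis:
  fixes f :: "'a::euclidean_space \<Rightarrow> real"
  assumes "f differentiable at x" shows "grad f x \<bullet> b = frechet_derivative f (at x) b"
  using GDERIV_grad[OF assms] frechet_derivative_at[of f "\<lambda>v. v \<bullet> grad f x" x]
  unfolding gderiv_def by (metis inner_commute)

lemma Cc_infty_differentiable: "u \<in> Cc_infty \<Longrightarrow> u differentiable at x"
  unfolding Cc_infty_def using C_diff_differentiable[of 0 u x] by blast

lemma Cc_infty_GDERIV: "u \<in> Cc_infty \<Longrightarrow> GDERIV u x :> grad u x"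
  by (intro GDERIV_grad Cc_infty_differentiable)

lemma Cc_infty_has_derivative: "u \<in> Cc_infty \<Longrightarrow> (u has_derivative (\<lambda>v. v \<bullet> grad u x)) (at x)"
  using Cc_infty_GDERIV unfolding gderiv_def .

lemma Cc_infty_continuous: "u \<in> Cc_infty \<Longrightarrow> continuous_on S u"
  using continuous_on_subset[of UNIV u S] unfolding Cc_infty_def by (metis (mono_tags) C_diff.simps(1) mem_Collect_eq subset_UNIV)

lemma Cc_infty_grad_continuous:
  fixes u :: "'a::euclidean_space \<Rightarrow> real"
  assumes "u \<in> Cc_infty" shows "continuous_on S (grad u)"
proof -
  have "C_diff (Suc 0) u" using assms by (auto simp: Cc_infty_def simp del: C_diff.simps)
  then have "continuous_on UNIV (\<lambda>x. grad u x \<bullet> b)" if "b \<in> Basis" for b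
    using that by (simp add: grad_inner_Basis)
  then have "continuous_on UNIV (grad u)" by (subst continuous_on_componentwise) auto
  then show ?thesis using continuous_on_subset by blast
qed

lemma Cc_infty_borel [measurable (raw)]:
  assumes "u \<in> Cc_infty" shows "u \<in> borel_measurable borel" "grad u \<in> borel_measurable borel"
  using assms Cc_infty_continuous Cc_infty_grad_continuous by (auto intro!: borel_measurable_continuous_onI)

lemma Cc_infty_support:
  fixes u :: "'a::euclidean_space \<Rightarrow> real"
  assumes "u \<in> Cc_infty"
  obtains R where "R > 0" "\<And>x. norm x > R \<Longrightarrow> u x = 0" "\<And>x. norm x > R \<Longrightarrow> grad u x = 0"
proof -
  have "bounded {x. u x \<noteq> 0}" using assms unfolding Cc_infty_def
    by (auto intro: bounded_subset[OF compact_imp_bounded closure_subset])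
  then obtain R where R: "R > 0" "\<And>x. u x \<noteq> 0 \<Longrightarrow> norm x \<le> R"
    by (auto simp: bounded_pos)
  have "grad u x = 0" if "norm x > R" for x
  proof (rule grad_eqI)
    have o: "open {y::'a. R < norm y}" by (intro open_Collect_less continuous_intros)
    have z: "((\<lambda>x. 0) has_derivative (\<lambda>v. v \<bullet> 0)) (at x)" by simp
    show "GDERIV u x :> 0" unfolding gderiv_def
      by (rule has_derivative_transform_within_open[OF z o]) (use that R in force)+
  qed
  with R that[of R] show thesis by force
qed

lemma bounded_compact_support:
  fixes f :: "'a::euclidean_space \<Rightarrow> 'b::real_normed_vector"
  assumes "continuous_on UNIV f" "\<And>x. norm x > R \<Longrightarrow> f x = 0"
  obtains B where "B > 0" "\<And>x. norm (f x) \<le> B"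
proof -
  have "compact (f ` cball 0 R)" using assms(1)
    by (intro compact_continuous_image continuous_on_subset[OF assms(1)]) auto
  then obtain B where B: "B > 0" "\<And>x. x \<in> cball 0 R \<Longrightarrow> norm (f x) \<le> B"
    using compact_imp_bounded bounded_pos by (metis imageI)
  have "norm (f x) \<le> B" for x using B assms(2)[of x] by (cases "norm x > R") (auto simp: less_imp_le)
  with B(1) that show thesis by blast
qed

lemma Cc_infty_bounded:
  fixes u :: "'a::euclidean_space \<Rightarrow> real"
  assumes "u \<in> Cc_infty"
  obtains R B where "R > 0" "B > 0" "\<And>x. norm x > R \<Longrightarrow> u x = 0" "\<And>x. norm x > R \<Longrightarrow> grad u x = 0"
    "\<And>x. \<bar>u x\<bar> \<le> B" "\<And>x. norm (grad u x) \<le> B"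
proof -
  obtain R where R: "R > 0" "\<And>x. norm x > R \<Longrightarrow> u x = 0" "\<And>x. norm x > R \<Longrightarrow> grad u x = 0"
    using Cc_infty_support[OF assms] by blast
  obtain B where B: "B > 0" "\<And>x. norm (u x) \<le> B"
    using bounded_compact_support[OF Cc_infty_continuous[OF assms] R(2)] by blast
  obtain C where C: "C > 0" "\<And>x. norm (grad u x) \<le> C"
    using bounded_compact_support[OF Cc_infty_grad_continuous[OF assms] R(3)] by blast
  show thesis
  proof (rule that[of R "max B C"])
    show "\<bar>u x\<bar> \<le> max B C" for x using B(2)[of x] by simp
    show "norm (grad u x) \<le> max B C" for x using C(2)[of x] by simp
  qed (use R B in auto)
qed

lemma integrable_bounded_support:
  fixes f :: "'a::euclidean_space \<Rightarrow> 'b::{banach, second_countable_topology}"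
  assumes [measurable]: "f \<in> borel_measurable borel" and "\<And>x. norm x > R \<Longrightarrow> f x = 0" "\<And>x. norm (f x) \<le> B"
  shows "integrable lborel f"
proof -
  have "integrable lborel (\<lambda>x. indicator (cball 0 R) x *\<^sub>R B :: real)"
    by (intro integrable_scaleR_left integrable_real_indicator)
      (use emeasure_lborel_cball_finite[of 0 R] in simp_all)
  then show ?thesis
  proof (rule Bochner_Integration.integrable_bound)
    show "AE x in lborel. norm (f x) \<le> norm (indicator (cball 0 R) x *\<^sub>R B :: real)"
      using assms(2,3) order_trans[OF norm_ge_zero assms(3)]
      by (intro AE_I2) (auto simp: indicator_def intro: order_trans[OF assms(3)])
  qed simp
qed

lemma grad_diff:
  assumes "u \<in> Cc_infty" "v \<in> Cc_infty" shows "grad (\<lambda>x. u x - v x) x = grad u x - grad v x"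
  using assms by (intro grad_eqI GDERIV_diff Cc_infty_GDERIV)

lemma grad_add:
  assumes "u \<in> Cc_infty" "v \<in> Cc_infty" shows "grad (\<lambda>x. u x + v x) x = grad u x + grad v x"
  using assms by (intro grad_eqI GDERIV_add Cc_infty_GDERIV)

lemma grad_compose:
  assumes "u \<in> Cc_infty" "\<And>t. (h has_real_derivative h' t) (at t)"
  shows "grad (\<lambda>x. h (u x)) x = h' (u x) *\<^sub>R grad u x"
  using assms by (intro grad_eqI GDERIV_DERIV_compose Cc_infty_GDERIV)

lemma grad_cmult:
  assumes "u \<in> Cc_infty" shows "grad (\<lambda>x. c * u x) x = c *\<^sub>R grad u x"
  using grad_compose[OF assms, of "\<lambda>t. c * t" "\<lambda>_. c"] by (simp add: DERIV_cmult_Id)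

lemma grad_mult:
  assumes "u \<in> Cc_infty" "v \<in> Cc_infty"
  shows "grad (\<lambda>x. u x * v x) x = u x *\<^sub>R grad v x + v x *\<^sub>R grad u x"
  using assms by (intro grad_eqI GDERIV_mult Cc_infty_GDERIV)

section \<open>Bump functions and uniqueness of weak gradients\<close>

lemma poly_over_exp_tendsto:
  "((\<lambda>s::real. poly p s / exp s) \<longlongrightarrow> 0) at_top"
proof -
  have "((\<lambda>s::real. \<Sum>i\<le>degree p. coeff p i * (s ^ i / exp s)) \<longlongrightarrow> (\<Sum>i\<le>degree p. coeff p i * 0)) at_top"
    by (intro tendsto_intros tendsto_power_div_exp_0)
  then show ?thesis by (simp add: poly_altdef sum_divide_distrib)
qed

text \<open>A family of functions flat at 0 that is closed under differentiation, hence a witness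
  for \<open>real_smooth\<close>. The member p = 1 is the classical building block of bump
  functions.\<close>

definition exp_recip :: "real poly \<Rightarrow> real \<Rightarrow> real" where
  "exp_recip p t = (if t > 0 then poly p (1 / t) * exp (- (1 / t)) else 0)"

lemma exp_recip_tendsto_0: "(exp_recip p \<longlongrightarrow> 0) (at 0)"
proof -
  have "((\<lambda>t::real. poly p (inverse t) / exp (inverse t)) \<longlongrightarrow> 0) (at_right 0)"
    by (rule filterlim_compose[OF poly_over_exp_tendsto filterlim_inverse_at_top_right])
  then have "(exp_recip p \<longlongrightarrow> 0) (at_right 0)"
    by (rule Lim_transform_eventually)
       (auto simp: exp_recip_def eventually_at_right_field exp_minus field_simps intro!: exI[of _ 1])
  moreover have "(exp_recip p \<longlongrightarrow> 0) (at_left 0)"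
    by (rule tendsto_eventually) (auto simp: exp_recip_def eventually_at_left_field intro!: exI[of _ "-1"])
  ultimately show ?thesis by (simp add: filterlim_split_at)
qed

text \<open>For t > 0 the derivative is (p - p')(1/t) exp(-1/t) / t^2, and 1/t^2 is the value at 1/t
  of X^2, written \<open>[:0, 0, 1:]\<close>.\<close>

lemma exp_recip_DERIV:
  "(exp_recip p has_real_derivative exp_recip ([:0, 0, 1:] * (p - pderiv p)) t) (at t)"
proof -
  consider "t > 0" | "t < 0" | "t = 0" by linarith
  then show ?thesis
  proof cases
    case 1
    have "((\<lambda>t. poly p (1 / t) * exp (- (1 / t))) has_real_derivative
        exp_recip ([:0, 0, 1:] * (p - pderiv p)) t) (at t)"
      using 1 by (auto intro!: derivative_eq_intros DERIV_chain'[OF _ poly_DERIV]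
          simp: exp_recip_def field_simps power2_eq_square)
    then show ?thesis
      by (rule has_field_derivative_transform_within_open[where S="{0<..}"]) (use 1 in \<open>auto simp: exp_recip_def\<close>)
  next
    case 2
    have "((\<lambda>t. 0) has_real_derivative exp_recip ([:0, 0, 1:] * (p - pderiv p)) t) (at t)"
      using 2 by (simp add: exp_recip_def)
    then show ?thesis
      by (rule has_field_derivative_transform_within_open[where S="{..<0}"]) (use 2 in \<open>auto simp: exp_recip_def\<close>)
  next
    case 3
    \<comment> \<open>Dividing by t multiplies the polynomial by X, so the difference quotient at 0
      is again a member of the family.\<close>
    have "((\<lambda>t. exp_recip ([:0, 1:] * p) t) \<longlongrightarrow> 0) (at 0)" by (rule exp_recip_tendsto_0)
    moreover have "exp_recip ([:0, 1:] * p) t = (exp_recip p t - exp_recip p 0) / (t - 0)" for t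
      by (simp add: exp_recip_def)
    ultimately have "((\<lambda>t. (exp_recip p t - exp_recip p 0) / (t - 0)) \<longlongrightarrow> 0) (at 0)" by simp
    then show ?thesis unfolding 3 has_field_derivative_iff by (simp add: exp_recip_def)
  qed
qed

lemma real_smooth_exp_recip: "real_smooth (exp_recip p)"
  unfolding real_smooth_def by (rule exI[of _ "range exp_recip"]) (auto intro: exp_recip_DERIV)

definition box_bump :: "'a::euclidean_space \<Rightarrow> 'a \<Rightarrow> 'a \<Rightarrow> real" where
  "box_bump a b x = (\<Prod>i\<in>Basis. exp_recip 1 (x \<bullet> i + - (a \<bullet> i)) * exp_recip 1 (x \<bullet> (- i) + b \<bullet> i))"

lemma exp_recip_1: "exp_recip 1 t \<ge> 0" "exp_recip 1 t > 0 \<longleftrightarrow> t > 0" "exp_recip 1 t = 0 \<longleftrightarrow> t \<le> 0"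
  by (auto simp: exp_recip_def)

lemma box_bump: "box_bump a b x \<ge> 0" "box_bump a b x \<noteq> 0 \<longleftrightarrow> x \<in> box a b"
proof -
  show "box_bump a b x \<ge> 0"
    unfolding box_bump_def by (intro prod_nonneg mult_nonneg_nonneg ballI exp_recip_1)
  show "box_bump a b x \<noteq> 0 \<longleftrightarrow> x \<in> box a b"
    unfolding box_bump_def by (simp add: exp_recip_1 mem_box not_le)
qed

lemma Cc_infty_box_bump: "box_bump a b \<in> Cc_infty"
proof -
  have "C_diff k (box_bump a b)" for k
    unfolding box_bump_def
    by (intro C_diff_prod C_diff_mult finite_Basis C_diff_compose[OF real_smooth_exp_recip C_diff_inner])
  moreover have "compact (closure {x. box_bump a b x \<noteq> 0})"
    by (simp add: box_bump compact_closure)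
  ultimately show ?thesis by (simp add: Cc_infty_def)
qed

text \<open>The functions c + d exp(-k t) are closed under differentiation. This one vanishes at 0,
  so composing it with a bump gives a test function.\<close>

lemma real_smooth_one_minus_exp: "real_smooth (\<lambda>t. 1 - exp (- (k * t)))"
  unfolding real_smooth_def
proof (intro exI conjI)
  let ?S = "{\<lambda>t. c + d * exp (- (k * t)) | c d. True}"
  show "(\<lambda>t. 1 - exp (- (k * t))) \<in> ?S" by (intro CollectI exI[of _ 1] exI[of _ "-1"]) simp
  show "\<forall>g\<in>?S. \<exists>g'\<in>?S. \<forall>t. (g has_real_derivative g' t) (at t)"
  proof
    fix g assume "g \<in> ?S"
    then obtain c d where g: "g = (\<lambda>t. c + d * exp (- (k * t)))" by auto
    have "(g has_real_derivative 0 + (- k * d) * exp (- (k * t))) (at t)" for t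
      unfolding g by (auto intro!: derivative_eq_intros)
    then show "\<exists>g'\<in>?S. \<forall>t. (g has_real_derivative g' t) (at t)"
      by (intro bexI[of _ "\<lambda>t. 0 + (- k * d) * exp (- (k * t))"] allI) (assumption, blast)
  qed
qed

text \<open>The test functions \<open>1 - exp (-k \<psi>)\<close>, with \<open>\<psi>\<close> a bump on a box, increase to the indicator of the box.\<close>

lemma AE_eq_if_test_integrals_eq:
  fixes g g' :: "'a::euclidean_space \<Rightarrow> 'b::euclidean_space"
  assumes int: "\<And>K. compact K \<Longrightarrow> set_integrable lborel K g" "\<And>K. compact K \<Longrightarrow> set_integrable lborel K g'"
    and m [measurable]: "g \<in> borel_measurable borel" "g' \<in> borel_measurable borel"
    and eq: "\<And>\<psi>. \<psi> \<in> Cc_infty \<Longrightarrow> (\<integral>x. \<psi> x *\<^sub>R g x \<partial>lborel) = (\<integral>x. \<psi> x *\<^sub>R g' x \<partial>lborel)"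
  shows "AE x in lborel. g x = g' x"
proof -
  have lim: "(\<lambda>k. \<integral>x. (1 - exp (- (real k * box_bump a b x))) *\<^sub>R h x \<partial>lborel)
      \<longlonglongrightarrow> (\<integral>x. indicator (box a b) x *\<^sub>R h x \<partial>lborel)"
    if h: "\<And>K. compact K \<Longrightarrow> set_integrable lborel K h" and [measurable]: "h \<in> borel_measurable borel"
    for a b and h :: "'a \<Rightarrow> 'b"
  proof (rule integral_dominated_convergence)
    note Cc_infty_borel(1)[OF Cc_infty_box_bump, measurable]
    show "(\<lambda>x. indicator (box a b) x *\<^sub>R h x) \<in> borel_measurable lborel" by simp
    show "(\<lambda>x. (1 - exp (- (real k * box_bump a b x))) *\<^sub>R h x) \<in> borel_measurable lborel" for k by simp
    \<comment> \<open>The closed box is compact, so local integrability supplies the dominating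
      function.\<close>
    show "integrable lborel (\<lambda>x. norm (indicator (cbox a b) x *\<^sub>R h x))"
      using h[of "cbox a b"] unfolding set_integrable_def by (intro integrable_norm) auto
    show "AE x in lborel. norm ((1 - exp (- (real k * box_bump a b x))) *\<^sub>R h x)
        \<le> norm (indicator (cbox a b) x *\<^sub>R h x)" for k
    proof (intro AE_I2)
      fix x
      show "norm ((1 - exp (- (real k * box_bump a b x))) *\<^sub>R h x) \<le> norm (indicator (cbox a b) x *\<^sub>R h x)"
      proof (cases "x \<in> box a b")
        case True
        have "\<bar>1 - exp (- (real k * box_bump a b x))\<bar> \<le> 1"
          using box_bump(1)[of a b x] by simp
        then have "\<bar>1 - exp (- (real k * box_bump a b x))\<bar> * norm (h x) \<le> 1 * norm (h x)"
          by (intro mult_right_mono) auto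
        then show ?thesis using True box_subset_cbox[of a b] by (auto simp: indicator_def)
      qed (use box_bump(2)[of a b x] in auto)
    qed
    show "AE x in lborel. (\<lambda>k. (1 - exp (- (real k * box_bump a b x))) *\<^sub>R h x)
        \<longlonglongrightarrow> indicator (box a b) x *\<^sub>R h x"
    proof (intro AE_I2 tendsto_intros)
      fix x
      show "(\<lambda>k. 1 - exp (- (real k * box_bump a b x))) \<longlonglongrightarrow> indicator (box a b) x"
      proof (cases "x \<in> box a b")
        case True
        then have pos: "box_bump a b x > 0" using box_bump[of a b x] by linarith
        have "filterlim (\<lambda>k. real k * box_bump a b x) at_top sequentially"
          using pos by (intro filterlim_at_top_mult_tendsto_pos[OF tendsto_const]
            filterlim_tendsto_pos_mult_at_top[OF tendsto_const] filterlim_real_sequentially)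
            (simp_all add: mult.commute filterlim_real_sequentially)
        then have "(\<lambda>k. exp (- (real k * box_bump a b x))) \<longlonglongrightarrow> 0"
          by (intro filterlim_compose[OF exp_at_bot] filterlim_uminus_at_bot_at_top[THEN filterlim_compose])
        then have "(\<lambda>k. 1 - exp (- (real k * box_bump a b x))) \<longlonglongrightarrow> 1 - 0" by (intro tendsto_intros)
        then show ?thesis using True by simp
      qed (use box_bump(2)[of a b x] in auto)
    qed
  qed
  have test: "(\<lambda>x. 1 - exp (- (real k * box_bump a b x))) \<in> Cc_infty" for k and a b :: 'a
    using Cc_infty_compose[OF real_smooth_one_minus_exp _ Cc_infty_box_bump] by simp
  have boxeq: "(\<integral>x. indicator (box a b) x *\<^sub>R g x \<partial>lborel) = (\<integral>x. indicator (box a b) x *\<^sub>R g' x \<partial>lborel)" for a b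
    using LIMSEQ_unique[OF lim[OF int(1) m(1)]] lim[OF int(2) m(2)] by (simp add: eq[OF test])
  define d where "d x = g x - g' x" for x
  have [measurable]: "d \<in> borel_measurable borel" unfolding d_def by simp
  have di: "set_integrable lborel K d" if "compact K" for K
    using int[OF that] unfolding d_def by (rule set_integral_diff)
  have dz: "integral (cbox a b) d = 0" for a b
  proof -
    have i: "set_integrable lborel (box a b) g" "set_integrable lborel (box a b) g'"
      using int[of "cbox a b"] box_subset_cbox[of a b] by (auto intro: set_integrable_subset)
    have "(LINT x:box a b|lborel. d x) = 0"
      using boxeq[of a b] set_integral_diff(2)[OF i] unfolding d_def set_lebesgue_integral_def by simp
    moreover have "(LINT x:box a b|lborel. d x) = integral (box a b) d"
      using i unfolding d_def by (intro set_borel_integral_eq_integral set_integral_diff)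
    ultimately show ?thesis by (simp add: integral_open_interval)
  qed
  have "d integrable_on cbox a b" for a b using di[of "cbox a b"] by (intro set_borel_integral_eq_integral) auto
  \<comment> \<open>Lebesgue differentiation: off a negligible set, \<open>d x\<close> is the limit
    of its averages over the cubes with corner x, and these averages vanish by
    \<open>dz\<close>.\<close>
  then obtain N where N: "negligible N"
    "\<And>x e. \<lbrakk>x \<notin> N; 0 < e\<rbrakk> \<Longrightarrow> \<exists>r>0. \<forall>h. 0 < h \<and> h < r \<longrightarrow>
       norm (integral (cbox x (x + h *\<^sub>R One)) d /\<^sub>R h ^ DIM('a) - d x) < e"
    using integrable_ccontinuous_explicit by blast
  have "d x = 0" if nx: "x \<notin> N" for x
  proof (rule ccontr)
    assume "d x \<noteq> 0"
    then obtain r where "r > 0" "\<forall>h. 0 < h \<and> h < r \<longrightarrow> norm (integral (cbox x (x + h *\<^sub>R One)) d /\<^sub>R h ^ DIM('a) - d x) < norm (d x)"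
      using N(2)[OF nx, of "norm (d x)"] by auto
    then show False using dense[of 0 r] by (auto simp: dz)
  qed
  then have "negligible {x. d x \<noteq> 0}" using N(1) by (auto intro: negligible_subset)
  then have "{x. d x \<noteq> 0} \<in> null_sets lebesgue" by (simp add: negligible_iff_null_sets)
  \<comment> \<open>Negligibility concerns Lebesgue measurable sets; Borel measurability of
    \<open>d\<close> brings the null set back to \<open>lborel\<close>.\<close>
  moreover have "{x \<in> space borel. d x \<noteq> 0} \<in> sets borel" by measurable
  ultimately have "{x. d x \<noteq> 0} \<in> null_sets lborel" by (auto simp: null_sets_def)
  then have "AE x in lborel. d x = 0" by (auto dest!: AE_not_in)
  then show ?thesis by (simp add: d_def)
qed

text \<open>The truncations to balls of integer radius are measurable, and at each point they are
  eventually equal to g.\<close>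

lemma loc_integrable_borel:
  fixes g :: "'a::euclidean_space \<Rightarrow> 'b::euclidean_space"
  assumes "\<And>K. compact K \<Longrightarrow> set_integrable lborel K g"
  shows "g \<in> borel_measurable borel"
proof (rule borel_measurable_LIMSEQ_metric)
  show "(\<lambda>x. indicator (cball 0 (real n)) x *\<^sub>R g x) \<in> borel_measurable borel" for n
    using borel_measurable_integrable[OF assms[of "cball 0 (real n)", unfolded set_integrable_def]] by simp
  show "(\<lambda>n. indicator (cball 0 (real n)) x *\<^sub>R g x) \<longlonglongrightarrow> g x" for x
  proof (rule tendsto_eventually)
    obtain n0 where "norm x \<le> real n0" using real_arch_simple by blast
    then show "\<forall>\<^sub>F n in sequentially. indicator (cball 0 (real n)) x *\<^sub>R g x = g x"
      by (intro eventually_sequentiallyI[of n0]) (auto simp: indicator_def)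
  qed
qed

lemma has_weak_grad_unique:
  assumes "has_weak_grad f g" "has_weak_grad f g'"
  shows "AE x in lborel. g x = g' x"
proof (rule AE_eq_if_test_integrals_eq)
  show i: "set_integrable lborel K g" "set_integrable lborel K g'" if "compact K" for K
    using assms that by (auto simp: has_weak_grad_def)
  show "g \<in> borel_measurable borel" "g' \<in> borel_measurable borel"
    using i by (auto intro: loc_integrable_borel)
qed (use assms in \<open>auto simp: has_weak_grad_def\<close>)

section \<open>The Gagliardo--Nirenberg--Sobolev inequality\<close>

text \<open>At 0 the difference quotient is bounded by |y|^(c-1), which tends to 0 because c > 1;
  elsewhere the sign of s is locally constant.\<close>

lemma abs_powr_DERIV:
  fixes s :: real
  assumes c: "c > 1"
  shows "((\<lambda>s. \<bar>s\<bar> powr c) has_real_derivative c * \<bar>s\<bar> powr (c - 1) * sgn s) (at s)"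
proof -
  consider "s > 0" | "s < 0" | "s = 0" by linarith
  then show ?thesis
  proof cases
    case 1
    have "((\<lambda>s. s powr c) has_real_derivative c * \<bar>s\<bar> powr (c - 1) * sgn s) (at s)"
      using 1 by (auto intro!: derivative_eq_intros has_real_derivative_powr)
    then show ?thesis
      by (rule has_field_derivative_transform_within_open[where S="{0<..}"]) (use 1 in auto)
  next
    case 2
    have "((\<lambda>s. (- s) powr c) has_real_derivative c * \<bar>s\<bar> powr (c - 1) * sgn s) (at s)"
      using 2 by (auto intro!: derivative_eq_intros simp: powr_diff)
    then show ?thesis
      by (rule has_field_derivative_transform_within_open[where S="{..<0}"]) (use 2 in auto)
  next
    case 3
    have lim: "((\<lambda>y::real. \<bar>y\<bar> powr (c - 1)) \<longlongrightarrow> 0) (at 0)"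
      using c by (intro tendsto_eq_intros | auto)+
    have bd: "\<forall>y::real. norm ((\<bar>y\<bar> powr c - \<bar>0\<bar> powr c) / (y - 0)) \<le> \<bar>y\<bar> powr (c - 1)"
    proof
      fix y :: real
      show "norm ((\<bar>y\<bar> powr c - \<bar>0\<bar> powr c) / (y - 0)) \<le> \<bar>y\<bar> powr (c - 1)"
        by (cases "y = 0") (auto simp: powr_diff)
    qed
    have "((\<lambda>y::real. (\<bar>y\<bar> powr c - \<bar>0\<bar> powr c) / (y - 0)) \<longlongrightarrow> 0) (at 0)"
      by (rule Lim_null_comparison[OF always_eventually[OF bd] lim])
    then show ?thesis unfolding 3 has_field_derivative_iff by simp
  qed
qed

text \<open>Hoelder's inequality over the index type \<open>bool\<close>, both exponents being
  1/2.\<close>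

lemma nn_integral_Cauchy_Schwarz_real:
  fixes f g :: "'b \<Rightarrow> real"
  assumes [measurable]: "f \<in> borel_measurable M" "g \<in> borel_measurable M"
    and "\<And>x. f x \<ge> 0" "\<And>x. g x \<ge> 0"
  shows "(\<integral>\<^sup>+x. ennreal (f x * g x) \<partial>M)
    \<le> epow (\<integral>\<^sup>+x. ennreal ((f x)\<^sup>2) \<partial>M) (1/2) * epow (\<integral>\<^sup>+x. ennreal ((g x)\<^sup>2) \<partial>M) (1/2)"
proof -
  define h where "h b x = (if b then ennreal ((f x)\<^sup>2) else ennreal ((g x)\<^sup>2))" for b :: bool and x
  have [measurable]: "h b \<in> borel_measurable M" for b unfolding h_def by (cases b) auto
  have "(\<integral>\<^sup>+x. (\<Prod>b\<in>UNIV. epow (h b x) (1/2)) \<partial>M) \<le> (\<Prod>b\<in>UNIV. epow (\<integral>\<^sup>+x. h b x \<partial>M) (1/2))"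
    by (rule nn_integral_Holder_prod) auto
  moreover have "(\<Prod>b\<in>UNIV. epow (h b x) (1/2)) = ennreal (f x * g x)" for x
    using assms(3,4) by (simp add: UNIV_bool h_def epow_ennreal powr_half_sqrt ennreal_mult mult.commute)
  ultimately show ?thesis by (simp add: UNIV_bool h_def mult.commute)
qed

lemma nn_integral_grad_norm:
  assumes u: "u \<in> Cc_infty"
  shows "(\<integral>\<^sup>+x. ennreal ((norm (grad u x))\<^sup>2) \<partial>lborel) = ennreal ((grad_norm u)\<^sup>2)"
proof -
  obtain R B where RB: "R > 0" "B > 0" "\<And>x. norm x > R \<Longrightarrow> grad u x = 0" "\<And>x. norm (grad u x) \<le> B"
    using Cc_infty_bounded[OF u] by metis
  note Cc_infty_borel[OF u, measurable]
  have "integrable lborel (\<lambda>x. (norm (grad u x))\<^sup>2)"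
  proof (rule integrable_bounded_support)
    show "norm ((norm (grad u x))\<^sup>2) \<le> B\<^sup>2" for x using RB(4)[of x] by (simp add: power_mono)
  qed (use RB in auto)
  then show ?thesis
    by (simp add: nn_integral_eq_integral grad_norm_def)
qed

text \<open>The fundamental theorem of calculus with the derivative replaced by a continuous
  majorant. It serves twice: for |u|^c along coordinate lines and for u along segments.\<close>

lemma increment_le_nn_integral:
  fixes \<phi> D F :: "real \<Rightarrow> real"
  assumes ab: "a \<le> b" and der: "\<And>t. (\<phi> has_real_derivative D t) (at t)"
    and DF: "\<And>t. \<bar>D t\<bar> \<le> F t" and contF: "continuous_on UNIV F"
  shows "ennreal \<bar>\<phi> b - \<phi> a\<bar> \<le> (\<integral>\<^sup>+t. ennreal (indicator {a..b} t * F t) \<partial>lborel)"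
proof -
  have c: "continuous_on {a..b} F" using contF by (rule continuous_on_subset) simp
  have FTC: "(D has_integral (\<phi> b - \<phi> a)) {a..b}"
    using ab by (intro fundamental_theorem_of_calculus)
      (auto simp: has_real_derivative_iff_has_vector_derivative[symmetric] intro: has_field_derivative_at_within der)
  have F0: "F t \<ge> 0" for t using DF[of t] by linarith
  have "\<bar>\<phi> b - \<phi> a\<bar> = norm (integral {a..b} D)" using FTC by (simp add: integral_unique)
  also have "\<dots> \<le> integral {a..b} F"
    using FTC DF integrable_continuous_interval[OF c]
    by (intro integral_norm_bound_integral) (auto simp: has_integral_integrable)
  also have "\<dots> = (LINT t:{a..b}|lborel. F t)"
    by (rule set_borel_integral_eq_integral(2)[symmetric]) (simp add: borel_integrable_atLeastAtMost' c)
  finally have "ennreal \<bar>\<phi> b - \<phi> a\<bar> \<le> ennreal (LINT t:{a..b}|lborel. F t)" by (rule ennreal_leI)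
  also have "\<dots> = (\<integral>\<^sup>+t. ennreal (indicator {a..b} t *\<^sub>R F t) \<partial>lborel)"
    unfolding set_lebesgue_integral_def
    using borel_integrable_atLeastAtMost'[OF c] F0 unfolding set_integrable_def
    by (intro nn_integral_eq_integral[symmetric]) auto
  finally show ?thesis by simp
qed

text \<open>Moving from x in the direction -b one leaves the support of u, so |u x|^c is the
  increment of |u|^c along that half line.\<close>

lemma powr_le_line_integral:
  fixes u :: "'a::euclidean_space \<Rightarrow> real"
  assumes u: "u \<in> Cc_infty" and c: "c > 1" and b: "b \<in> Basis"
  shows "ennreal (\<bar>u x\<bar> powr c)
    \<le> (\<integral>\<^sup>+t. ennreal (c * \<bar>u (x + t *\<^sub>R b)\<bar> powr (c - 1) * norm (grad u (x + t *\<^sub>R b))) \<partial>lborel)"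
proof -
  obtain R where R: "R > 0" "\<And>x. norm x > R \<Longrightarrow> u x = 0"
    using Cc_infty_bounded[OF u] by metis
  \<comment> \<open>Chosen so that x - T b lies outside the ball of radius R: its norm is at least T
    - |x| = R + 1.\<close>
  define T where "T = norm x + R + 1"
  have T: "T > 0" using R norm_ge_zero[of x] unfolding T_def by linarith
  define F where "F t = c * \<bar>u (x + t *\<^sub>R b)\<bar> powr (c - 1) * norm (grad u (x + t *\<^sub>R b))" for t
  define D where "D t = c * \<bar>u (x + t *\<^sub>R b)\<bar> powr (c - 1) * sgn (u (x + t *\<^sub>R b)) * (b \<bullet> grad u (x + t *\<^sub>R b))" for t
  have contF: "continuous_on S F" for S unfolding F_def using c
    by (intro continuous_intros continuous_on_compose2[OF Cc_infty_continuous[OF u]]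
        continuous_on_compose2[OF Cc_infty_grad_continuous[OF u]] continuous_on_powr') auto
  have line: "((\<lambda>t. u (x + t *\<^sub>R b)) has_real_derivative b \<bullet> grad u (x + t *\<^sub>R b)) (at t)" for t
  proof -
    have "((\<lambda>t. x + t *\<^sub>R b) has_derivative (\<lambda>s. s *\<^sub>R b)) (at t)"
      by (auto intro!: derivative_eq_intros)
    from has_derivative_compose[OF this Cc_infty_has_derivative[OF u]] show ?thesis
      by (simp add: has_field_derivative_def mult.commute[of _ "b \<bullet> _"])
  qed
  have der: "((\<lambda>t. \<bar>u (x + t *\<^sub>R b)\<bar> powr c) has_real_derivative D t) (at t)" for t
    unfolding D_def using DERIV_chain2[OF abs_powr_DERIV[OF c] line] .
  have "norm (x + (-T) *\<^sub>R b) > R"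
  proof -
    have "norm (T *\<^sub>R b) \<le> norm (x + (-T) *\<^sub>R b) + norm x"
      using norm_triangle_ineq4[of x "x + (-T) *\<^sub>R b"] by simp
    then show ?thesis using b T by (simp add: T_def)
  qed
  then have uz: "u (x + (-T) *\<^sub>R b) = 0" by (rule R(2))
  have DF: "norm (D t) \<le> F t" for t
  proof -
    have "\<bar>b \<bullet> grad u (x + t *\<^sub>R b)\<bar> \<le> norm (grad u (x + t *\<^sub>R b))"
      using Cauchy_Schwarz_ineq2[of b "grad u (x + t *\<^sub>R b)"] b by simp
    moreover have "norm (D t) = (c * \<bar>u (x + t *\<^sub>R b)\<bar> powr (c - 1) * \<bar>sgn (u (x + t *\<^sub>R b))\<bar>) * \<bar>b \<bullet> grad u (x + t *\<^sub>R b)\<bar>"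
      using c by (simp add: D_def abs_mult)
    moreover have "c * \<bar>u (x + t *\<^sub>R b)\<bar> powr (c - 1) * \<bar>sgn (u (x + t *\<^sub>R b))\<bar> \<le> c * \<bar>u (x + t *\<^sub>R b)\<bar> powr (c - 1)"
      using c by (simp add: abs_sgn_eq)
    ultimately show ?thesis unfolding F_def using c by (simp add: mult_mono)
  qed
  have "ennreal (\<bar>u x\<bar> powr c) = ennreal \<bar>\<bar>u (x + 0 *\<^sub>R b)\<bar> powr c - \<bar>u (x + (-T) *\<^sub>R b)\<bar> powr c\<bar>"
    using uz by simp
  also have "\<dots> \<le> (\<integral>\<^sup>+t. ennreal (indicator {-T..0} t * F t) \<partial>lborel)"
    by (rule increment_le_nn_integral[OF _ der _ contF]) (use T DF in auto)
  also have "\<dots> \<le> (\<integral>\<^sup>+t. ennreal (F t) \<partial>lborel)"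
    using order_trans[OF norm_ge_zero DF] by (intro nn_integral_mono ennreal_leI) (auto simp: indicator_def)
  finally show ?thesis by (simp add: F_def)
qed

text \<open>The critical Sobolev exponent, which is the one built into \<open>D12\<close>.\<close>

definition pstar :: "'a::euclidean_space itself \<Rightarrow> real" where
  "pstar _ = 2 * real DIM('a) / (real DIM('a) - 2)"

text \<open>The exponent gamma of |u|^gamma in the proof below. It is also the constant of the
  inequality, because differentiating |u|^gamma produces the factor gamma.\<close>

definition gns_const :: "'a::euclidean_space itself \<Rightarrow> real" where
  "gns_const _ = 2 * (real DIM('a) - 1) / (real DIM('a) - 2)"

lemma pstar_gt_2: "DIM('a::euclidean_space) \<ge> 3 \<Longrightarrow> pstar TYPE('a) > 2"
  by (simp add: pstar_def field_simps)

text \<open>Apply the grid-lines inequality to \<open>\<gamma> \<bar>u\<bar>\<^bsup>\<gamma>-1\<^esup> \<bar>\<nabla>u\<bar>\<close>, \<open>\<gamma> = 2(N-1)/(N-2)\<close>; by Cauchy--Schwarz the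
  \<open>L\<^sup>p\<close> norm of \<open>u\<close> reappears on the right with a smaller power and is absorbed.\<close>

lemma GNS_inequality:
  fixes u :: "'a::euclidean_space \<Rightarrow> real"
  assumes N: "DIM('a) \<ge> 3" and u: "u \<in> Cc_infty"
  shows "(\<integral>\<^sup>+x. ennreal (\<bar>u x\<bar> powr pstar TYPE('a)) \<partial>lborel)
    \<le> ennreal ((gns_const TYPE('a) * grad_norm u) powr pstar TYPE('a))"
proof -
  define n where "n = real DIM('a)"
  have n: "n \<ge> 3" using N unfolding n_def by linarith
  define p where "p = pstar TYPE('a)"
  define c where "c = gns_const TYPE('a)"
  define q where "q = 1 / (n - 1)"
  have p: "p = 2 * n / (n - 2)" and c: "c = 2 * (n - 1) / (n - 2)"
    by (auto simp: p_def c_def pstar_def gns_const_def n_def)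
  have c1: "c > 1" and p0: "p > 0" and q0: "q > 0" and q1: "q < 1"
    using n by (auto simp: p c q_def field_simps)
  \<comment> \<open>The three exponent identities: the n line bounds for |u|^c, each to the power q,
    multiply to a bound for |u|^p; Cauchy-Schwarz applied to |u|^(c-1) |grad u| returns the integral
    of |u|^p; and p is the exponent left after absorption.\<close>
  have cqn: "c * q * n = p" using n by (simp add: p c q_def divide_simps)
  have cp: "2 * (c - 1) = p" using n by (simp add: p c field_simps)
  have qp: "(1 + q) / (1 - (1 + q) / 2) = p"
    using n by (simp add: p q_def divide_simps)
  obtain R B where RB: "R > 0" "B > 0" "\<And>x. norm x > R \<Longrightarrow> u x = 0" "\<And>x. \<bar>u x\<bar> \<le> B"
    using Cc_infty_bounded[OF u] by metis
  note Cc_infty_borel[OF u, measurable]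
  define G where "G = grad_norm u"
  have G: "G \<ge> 0" unfolding G_def grad_norm_def by simp
  have intu: "integrable lborel (\<lambda>x. \<bar>u x\<bar> powr p)"
  proof (rule integrable_bounded_support)
    show "norm (\<bar>u x\<bar> powr p) \<le> B powr p" for x using RB(4)[of x] p0 by (simp add: powr_mono2)
  qed (use RB in auto)
  define A where "A = (\<integral>x. \<bar>u x\<bar> powr p \<partial>lborel)"
  have A: "A \<ge> 0" unfolding A_def by simp
  have Aeq: "(\<integral>\<^sup>+x. ennreal (\<bar>u x\<bar> powr p) \<partial>lborel) = ennreal A"
    unfolding A_def by (rule nn_integral_eq_integral[OF intu]) simp
  define F where "F x = c * \<bar>u x\<bar> powr (c - 1) * norm (grad u x)" for x
  have F0: "F x \<ge> 0" for x unfolding F_def using c1 by simp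
  have [measurable]: "F \<in> borel_measurable borel" unfolding F_def by measurable
  have "ennreal (\<bar>u x\<bar> powr p) \<le> (\<Prod>b\<in>Basis. epow (\<integral>\<^sup>+t. ennreal (F (x + t *\<^sub>R b)) \<partial>lborel) q)" for x
  proof -
    have "\<bar>u x\<bar> powr p = ((\<bar>u x\<bar> powr c) powr q) ^ DIM('a)"
    proof (cases "u x = 0")
      case False
      then have "((\<bar>u x\<bar> powr c) powr q) ^ DIM('a) = ((\<bar>u x\<bar> powr c) powr q) powr n"
        unfolding n_def by (subst powr_realpow) auto
      then show ?thesis by (simp add: powr_powr cqn)
    qed (use n in \<open>simp add: n_def\<close>)
    then have "ennreal (\<bar>u x\<bar> powr p) = (\<Prod>b\<in>(Basis::'a set). ennreal ((\<bar>u x\<bar> powr c) powr q))"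
      by (simp add: ennreal_power)
    also have "\<dots> = (\<Prod>b\<in>(Basis::'a set). epow (ennreal (\<bar>u x\<bar> powr c)) q)"
      using q0 by (simp add: epow_ennreal)
    also have "\<dots> \<le> (\<Prod>b\<in>Basis. epow (\<integral>\<^sup>+t. ennreal (F (x + t *\<^sub>R b)) \<partial>lborel) q)"
      using powr_le_line_integral[OF u c1] q0 unfolding F_def
      by (intro prod_mono_ennreal epow_mono) auto
    finally show ?thesis .
  qed
  then have "ennreal A \<le> (\<integral>\<^sup>+x. (\<Prod>b\<in>Basis. epow (\<integral>\<^sup>+t. ennreal (F (x + t *\<^sub>R b)) \<partial>lborel) q) \<partial>lborel)"
    unfolding Aeq[symmetric] by (intro nn_integral_mono) auto
  also have "\<dots> \<le> epow (\<integral>\<^sup>+x. ennreal (F x) \<partial>lborel) (1 + q)"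
    unfolding q_def n_def using N by (intro grid_lines_lborel) auto
  also have "\<dots> \<le> epow (ennreal (c * (sqrt A * G))) (1 + q)"
  proof (intro epow_mono)
    have "(\<integral>\<^sup>+x. ennreal (F x) \<partial>lborel) = (\<integral>\<^sup>+x. ennreal c * ennreal (\<bar>u x\<bar> powr (c - 1) * norm (grad u x)) \<partial>lborel)"
      unfolding F_def using c1 by (simp add: ennreal_mult[symmetric] mult.assoc)
    also have "\<dots> = ennreal c * (\<integral>\<^sup>+x. ennreal (\<bar>u x\<bar> powr (c - 1) * norm (grad u x)) \<partial>lborel)"
      by (rule nn_integral_cmult) measurable
    also have "\<dots> \<le> ennreal c * (epow (\<integral>\<^sup>+x. ennreal ((\<bar>u x\<bar> powr (c - 1))\<^sup>2) \<partial>lborel) (1/2)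
        * epow (\<integral>\<^sup>+x. ennreal ((norm (grad u x))\<^sup>2) \<partial>lborel) (1/2))"
      by (intro mult_left_mono nn_integral_Cauchy_Schwarz_real) auto
    also have "(\<lambda>x. (\<bar>u x\<bar> powr (c - 1))\<^sup>2) = (\<lambda>x. \<bar>u x\<bar> powr p)"
      unfolding cp[symmetric] by (simp add: power2_eq_square powr_add[symmetric])
    also have "ennreal c * (epow (\<integral>\<^sup>+x. ennreal (\<bar>u x\<bar> powr p) \<partial>lborel) (1/2)
        * epow (\<integral>\<^sup>+x. ennreal ((norm (grad u x))\<^sup>2) \<partial>lborel) (1/2)) = ennreal (c * (sqrt A * G))"
      unfolding Aeq nn_integral_grad_norm[OF u] G_def[symmetric] using A G c1
      by (simp add: epow_ennreal powr_half_sqrt ennreal_mult)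
    finally show "(\<integral>\<^sup>+x. ennreal (F x) \<partial>lborel) \<le> ennreal (c * (sqrt A * G))" .
  qed (use q0 in auto)
  also have "\<dots> = ennreal ((c * (sqrt A * G)) powr (1 + q))"
    using A G c1 q0 by (intro epow_ennreal) auto
  finally have main: "A \<le> (c * (sqrt A * G)) powr (1 + q)" by simp
  have "A \<le> (c * G) powr p"
  proof (cases "A = 0")
    case False
    with A have Ap: "A > 0" by simp
    \<comment> \<open>\<open>A\<close> is finite because u is bounded with compact support. For A >
      0 its power (1 + q)/2 < 1 on the right can be cancelled, and the power r remains on the
      left.\<close>
    define r where "r = 1 - (1 + q) / 2"
    have r: "r > 0" using q1 by (simp add: r_def)
    have "A powr r * A powr ((1 + q) / 2) = A" using Ap by (simp add: powr_add[symmetric] r_def)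
    also have "A \<le> (c * G) powr (1 + q) * A powr ((1 + q) / 2)"
      using main A G c1 by (simp add: powr_mult powr_half_sqrt[symmetric] powr_powr mult_ac)
    finally have "A powr r \<le> (c * G) powr (1 + q)" using Ap by simp
    then have "(A powr r) powr (1 / r) \<le> ((c * G) powr (1 + q)) powr (1 / r)"
      using r by (intro powr_mono2) auto
    then show ?thesis using r Ap qp by (simp add: powr_powr r_def)
  qed simp
  then show ?thesis using Aeq unfolding p_def c_def G_def by (simp add: ennreal_leI)
qed

section \<open>Convergence in the mean\<close>

text \<open>This is the q-th power of the L^q distance. Omitting the root does not affect
  convergence to 0; the triangle inequality then holds with a factor 2^q.\<close>

definition Lp_dist :: "real \<Rightarrow> ('a::euclidean_space \<Rightarrow> 'b::euclidean_space) \<Rightarrow> ('a \<Rightarrow> 'b) \<Rightarrow> ennreal" where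
  "Lp_dist q f g = (\<integral>\<^sup>+x. ennreal (norm (f x - g x) powr q) \<partial>lborel)"

lemma Lp_dist_commute: "Lp_dist q f g = Lp_dist q g f"
  by (simp add: Lp_dist_def norm_minus_commute)

lemma Lp_dist_self [simp]: "Lp_dist q f f = 0"
  by (simp add: Lp_dist_def)

lemma Lp_dist_cong_AE:
  assumes "AE x in lborel. f x = f' x" "AE x in lborel. g x = g' x"
  shows "Lp_dist q f g = Lp_dist q f' g'"
  unfolding Lp_dist_def using assms by (intro nn_integral_cong_AE) (auto elim: eventually_elim2)

lemma Lp_dist_triangle:
  fixes f g h :: "'a::euclidean_space \<Rightarrow> 'b::euclidean_space"
  assumes q: "q \<ge> 0" and [measurable]: "f \<in> borel_measurable borel" "g \<in> borel_measurable borel" "h \<in> borel_measurable borel"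
  shows "Lp_dist q f h \<le> ennreal (2 powr q) * (Lp_dist q f g + Lp_dist q g h)"
proof -
  have *: "norm (f x - h x) powr q \<le> 2 powr q * (norm (f x - g x) powr q + norm (g x - h x) powr q)" for x
  proof -
    let ?a = "norm (f x - g x)" and ?b = "norm (g x - h x)"
    have "norm (f x - h x) \<le> ?a + ?b" using norm_triangle_ineq[of "f x - g x" "g x - h x"] by simp
    also have "\<dots> \<le> 2 * max ?a ?b" by simp
    finally have "norm (f x - h x) powr q \<le> (2 * max ?a ?b) powr q" using q by (intro powr_mono2) auto
    also have "\<dots> = 2 powr q * max ?a ?b powr q" by (simp add: powr_mult)
    also have "max ?a ?b powr q \<le> ?a powr q + ?b powr q" by (simp add: max_def)
    finally show ?thesis by simp
  qed
  have "Lp_dist q f h \<le> (\<integral>\<^sup>+x. ennreal (2 powr q) * (ennreal (norm (f x - g x) powr q) + ennreal (norm (g x - h x) powr q)) \<partial>lborel)"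
    unfolding Lp_dist_def using *
    by (intro nn_integral_mono) (simp add: ennreal_plus[symmetric] ennreal_mult[symmetric] del: ennreal_plus)
  also have "\<dots> = ennreal (2 powr q) * (Lp_dist q f g + Lp_dist q g h)"
    unfolding Lp_dist_def by (simp add: nn_integral_cmult nn_integral_add)
  finally show ?thesis .
qed

text \<open>The sum of the \<open>v k\<close> has finite integral, so it is finite almost
  everywhere.\<close>

lemma AE_summable_if_nn_integral_le:
  fixes v :: "nat \<Rightarrow> 'b \<Rightarrow> real"
  assumes [measurable]: "\<And>k. v k \<in> borel_measurable M" and v0: "\<And>k x. v k x \<ge> 0"
    and le: "\<And>k. (\<integral>\<^sup>+x. ennreal (v k x) \<partial>M) \<le> ennreal ((1/2) ^ k)"
  shows "AE x in M. summable (\<lambda>k. v k x)"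
proof -
  have "(\<integral>\<^sup>+x. (\<Sum>k. ennreal (v k x)) \<partial>M) = (\<Sum>k. \<integral>\<^sup>+x. ennreal (v k x) \<partial>M)"
    by (rule nn_integral_suminf) auto
  also have "\<dots> \<le> (\<Sum>k. ennreal ((1/2) ^ k))" by (intro suminf_le le) auto
  also have "\<dots> < \<infinity>"
    unfolding infinity_ennreal_def less_top[symmetric]
    by (intro ennreal_suminf_neq_top summable_geometric) auto
  finally have "AE x in M. (\<Sum>k. ennreal (v k x)) \<noteq> \<infinity>"
    by (intro nn_integral_PInf_AE) auto
  then show ?thesis by eventually_elim (use v0 in \<open>auto intro: summable_suminf_not_top\<close>)
qed

lemma ennreal_dense_real:
  assumes "(0::ennreal) < e" shows "\<exists>c>0. ennreal c < e"
proof -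
  obtain b where "0 < b" "b < e" using assms dense by blast
  then show ?thesis by (cases b) (auto simp: top_unique)
qed

lemma tendsto_0_subseq:
  fixes a :: "nat \<Rightarrow> ennreal"
  assumes "a \<longlonglongrightarrow> 0" and "\<And>k. e k > 0"
  obtains r :: "nat \<Rightarrow> nat" where "strict_mono r" "\<And>k. a (r k) < e k"
proof -
  have ev: "\<exists>N. \<forall>n\<ge>N. a n < e k" for k
    using order_tendstoD(2)[OF assms(1) assms(2)[of k]] by (simp add: eventually_sequentially)
  have "\<exists>r. \<forall>k. a (r k) < e k \<and> r k < r (Suc k)"
  proof (rule dependent_nat_choice)
    show "\<exists>x. a x < e 0" using ev[of 0] by blast
    show "\<exists>y. a y < e (Suc n) \<and> x < y" for x n
      using ev[of "Suc n"] by (metis le_add2 less_add_Suc2 add_Suc_right le_add1 less_add_Suc1)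
  qed
  then show thesis using that by (auto simp: strict_mono_Suc_iff)
qed

text \<open>Along a subsequence the distances are below 2^-k, so the q-th powers of the differences
  are summable almost everywhere and tend to 0.\<close>

lemma Lp_dist_AE_subseq:
  fixes u :: "nat \<Rightarrow> 'a::euclidean_space \<Rightarrow> 'b::euclidean_space"
  assumes q: "q > 0" and [measurable]: "\<And>n. u n \<in> borel_measurable borel" "f \<in> borel_measurable borel"
    and lim: "(\<lambda>n. Lp_dist q (u n) f) \<longlonglongrightarrow> 0"
  obtains r :: "nat \<Rightarrow> nat" where "strict_mono r" "AE x in lborel. (\<lambda>k. u (r k) x) \<longlonglongrightarrow> f x"
proof -
  obtain r where r: "strict_mono r" "\<And>k. Lp_dist q (u (r k)) f < ennreal ((1/2) ^ k)"
    using tendsto_0_subseq[OF lim, of "\<lambda>k. ennreal ((1/2) ^ k)"] by auto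
  have "AE x in lborel. summable (\<lambda>k. norm (u (r k) x - f x) powr q)"
    using r(2) by (intro AE_summable_if_nn_integral_le) (auto simp: Lp_dist_def less_imp_le)
  then have "AE x in lborel. (\<lambda>k. u (r k) x) \<longlonglongrightarrow> f x"
  proof eventually_elim
    case (elim x)
    then have "(\<lambda>k. (norm (u (r k) x - f x) powr q) powr (1/q)) \<longlonglongrightarrow> 0 powr (1/q)"
      using q by (intro tendsto_powr' summable_LIMSEQ_zero tendsto_const) auto
    then have "(\<lambda>k. norm (u (r k) x - f x)) \<longlonglongrightarrow> 0" using q by (simp add: powr_powr)
    then show ?case by (simp add: tendsto_norm_zero_iff LIM_zero_iff)
  qed
  with r(1) that show thesis by blast
qed

lemma Lp_dist_Fatou:
  fixes u :: "nat \<Rightarrow> 'a::euclidean_space \<Rightarrow> 'b::euclidean_space"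
  assumes q: "q > 0" and [measurable]: "\<And>n. u n \<in> borel_measurable borel" "f \<in> borel_measurable borel" "g \<in> borel_measurable borel"
    and lim: "AE x in lborel. (\<lambda>k. u k x) \<longlonglongrightarrow> f x"
    and le: "eventually (\<lambda>n. Lp_dist q (u n) g \<le> C) sequentially"
  shows "Lp_dist q f g \<le> C"
proof -
  have "Lp_dist q f g = (\<integral>\<^sup>+x. liminf (\<lambda>n. ennreal (norm (u n x - g x) powr q)) \<partial>lborel)"
    unfolding Lp_dist_def
  proof (rule nn_integral_cong_AE)
    show "AE x in lborel. ennreal (norm (f x - g x) powr q) = liminf (\<lambda>n. ennreal (norm (u n x - g x) powr q))"
      using lim
    proof eventually_elim
      case (elim x)
      have "(\<lambda>n. ennreal (norm (u n x - g x) powr q)) \<longlonglongrightarrow> ennreal (norm (f x - g x) powr q)"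
        using q by (intro tendsto_ennrealI tendsto_powr' tendsto_intros elim) auto
      then show ?case by (intro lim_imp_Liminf[symmetric]) auto
    qed
  qed
  also have "\<dots> \<le> liminf (\<lambda>n. Lp_dist q (u n) g)"
    unfolding Lp_dist_def by (rule nn_integral_liminf) auto
  also have "\<dots> \<le> C" using le by (metis Liminf_le_Limsup Limsup_bounded order_trans trivial_limit_sequentially)
  finally show ?thesis .
qed

text \<open>The Riesz-Fischer theorem. The limit is found pointwise almost everywhere along a fast
  subsequence, and Fatou's lemma shows that it is also the limit in the mean.\<close>

lemma Lp_dist_complete:
  fixes u :: "nat \<Rightarrow> 'a::euclidean_space \<Rightarrow> 'b::euclidean_space"
  assumes q: "q > 0" and m [measurable]: "\<And>n. u n \<in> borel_measurable borel"
    and cauchy: "\<And>e. e > 0 \<Longrightarrow> \<exists>M. \<forall>m\<ge>M. \<forall>n\<ge>M. Lp_dist q (u m) (u n) < e"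
  obtains f where "f \<in> borel_measurable borel" "(\<lambda>n. Lp_dist q (u n) f) \<longlonglongrightarrow> 0"
proof -
  \<comment> \<open>The factor 2^(-kq) makes room for the weight 2^(kq): the weighted q-th powers of
    the increments are still summable almost everywhere, so the increments are eventually at most
    2^-k and the telescoping series converges.\<close>
  define e where "e k = ennreal (2 powr (- (real k * q)) * (1/2) ^ k)" for k
  have e: "e k > 0" for k by (simp add: e_def ennreal_zero_less_mult_iff)
  have "\<exists>r. \<forall>k. (\<forall>m\<ge>r k. \<forall>n\<ge>r k. Lp_dist q (u m) (u n) < e k) \<and> r k < r (Suc k)"
  proof (rule dependent_nat_choice)
    show "\<exists>x. \<forall>m\<ge>x. \<forall>n\<ge>x. Lp_dist q (u m) (u n) < e 0" using cauchy[OF e] .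
    fix x k
    obtain M where "\<forall>m\<ge>M. \<forall>n\<ge>M. Lp_dist q (u m) (u n) < e (Suc k)" using cauchy[OF e] by blast
    then show "\<exists>y. (\<forall>m\<ge>y. \<forall>n\<ge>y. Lp_dist q (u m) (u n) < e (Suc k)) \<and> x < y"
      by (intro exI[of _ "max M (Suc x)"]) auto
  qed
  then obtain r where r: "\<And>k m n. m \<ge> r k \<Longrightarrow> n \<ge> r k \<Longrightarrow> Lp_dist q (u m) (u n) < e k" "strict_mono r"
    by (auto simp: strict_mono_Suc_iff)
  have step: "Lp_dist q (u (r (Suc k))) (u (r k)) < e k" for k
    using r(2) by (intro r(1)) (auto simp: strict_mono_less_eq)
  let ?D = "\<lambda>k x. norm (u (r (Suc k)) x - u (r k) x)"
  have "AE x in lborel. summable (\<lambda>k. 2 powr (real k * q) * ?D k x powr q)"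
  proof (rule AE_summable_if_nn_integral_le)
    fix k
    have "(\<integral>\<^sup>+x. ennreal (2 powr (real k * q) * ?D k x powr q) \<partial>lborel)
      = ennreal (2 powr (real k * q)) * Lp_dist q (u (r (Suc k))) (u (r k))"
      unfolding Lp_dist_def by (simp add: ennreal_mult nn_integral_cmult)
    also have "\<dots> \<le> ennreal (2 powr (real k * q)) * e k" using step by (intro mult_left_mono) (auto simp: less_imp_le)
    also have "\<dots> = ennreal ((1/2) ^ k)"
      unfolding e_def by (simp add: ennreal_mult[symmetric] powr_minus field_simps)
    finally show "(\<integral>\<^sup>+x. ennreal (2 powr (real k * q) * ?D k x powr q) \<partial>lborel) \<le> ennreal ((1/2) ^ k)" .
  qed auto
  then have conv: "AE x in lborel. convergent (\<lambda>k. u (r k) x)"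
  proof eventually_elim
    case (elim x)
    have "(\<lambda>k. 2 powr (real k * q) * ?D k x powr q) \<longlonglongrightarrow> 0" using elim by (rule summable_LIMSEQ_zero)
    then have "eventually (\<lambda>k. 2 powr (real k * q) * ?D k x powr q < 1) sequentially"
      by (rule order_tendstoD) simp
    then have ev: "eventually (\<lambda>k. norm (?D k x) \<le> (1/2) ^ k) sequentially"
    proof eventually_elim
      case (elim k)
      have "(2 powr real k * ?D k x) powr q < 1" using elim by (simp add: powr_mult powr_powr)
      then have "2 powr real k * ?D k x < 1"
        using q by (metis ge_one_powr_ge_zero less_imp_le linorder_not_less)
      then show ?case by (simp add: powr_realpow field_simps)
    qed
    have "summable (\<lambda>k. ?D k x)"
      using ev by (rule summable_comparison_test_ev) (simp add: summable_geometric)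
    then have "summable (\<lambda>k. u (r (Suc k)) x - u (r k) x)" by (rule summable_norm_cancel)
    then have "convergent (\<lambda>n. \<Sum>k<n. u (r (Suc k)) x - u (r k) x)" by (simp add: summable_iff_convergent)
    then have "convergent (\<lambda>n. u (r n) x - u (r 0) x)"
      using sum_lessThan_telescope[of "\<lambda>k. u (r k) x"] by simp
    then have "convergent (\<lambda>n. (u (r n) x - u (r 0) x) + u (r 0) x)" by (rule convergent_add) (rule convergent_const)
    then show ?case by simp
  qed
  define f where "f x = lim (\<lambda>k. u (r k) x)" for x
  have f [measurable]: "f \<in> borel_measurable borel"
    unfolding f_def by (rule borel_measurable_lim_metric) simp
  have lim: "AE x in lborel. (\<lambda>k. u (r k) x) \<longlonglongrightarrow> f x"
    using conv unfolding f_def by eventually_elim (simp add: convergent_LIMSEQ_iff)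
  have "(\<lambda>n. Lp_dist q (u n) f) \<longlonglongrightarrow> 0"
  proof (rule order_tendstoI)
    fix a :: ennreal assume "0 < a"
    then obtain b where b: "0 < b" "b < a" using dense by blast
    obtain M where M: "\<And>m n. m \<ge> M \<Longrightarrow> n \<ge> M \<Longrightarrow> Lp_dist q (u m) (u n) < b" using cauchy[OF b(1)] by blast
    \<comment> \<open>For fixed n, Fatou's lemma along the subsequence carries the Cauchy bound over
      to the limit.\<close>
    have "Lp_dist q f (u n) \<le> b" if "n \<ge> M" for n
    proof (rule Lp_dist_Fatou[OF q _ _ _ lim])
      show "\<forall>\<^sub>F k in sequentially. Lp_dist q (u (r k)) (u n) \<le> b"
        using M[OF _ that] seq_suble[OF r(2)]
        by (intro eventually_sequentiallyI[of M]) (meson le_trans less_imp_le)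
    qed auto
    then show "\<forall>\<^sub>F n in sequentially. Lp_dist q (u n) f < a"
      using b by (intro eventually_sequentiallyI[of M]) (auto simp: Lp_dist_commute[of q _ f] intro: le_less_trans)
  qed simp
  with f that show thesis by blast
qed

text \<open>Integrate a <= d + d^(1-q) a^q over K; for a > d the last term alone is a (a/d)^(q-1) >=
  a. The parameter d balances the measure of K against the L^q distance.\<close>

lemma Lp_dist_loc_L1_le:
  fixes f g :: "'a::euclidean_space \<Rightarrow> 'b::euclidean_space"
  assumes q: "q \<ge> 1" and d: "d > 0" and [measurable]: "f \<in> borel_measurable borel" "g \<in> borel_measurable borel" "K \<in> sets borel"
  shows "(\<integral>\<^sup>+x. ennreal (indicator K x * norm (f x - g x)) \<partial>lborel)
    \<le> ennreal d * emeasure lborel K + ennreal (d powr (1 - q)) * Lp_dist q f g"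
proof -
  have *: "a \<le> d + d powr (1 - q) * a powr q" if "a \<ge> 0" for a
  proof (cases "a \<le> d")
    case False
    then have "d powr (1 - q) * a powr q = a * (a / d) powr (q - 1)"
      using d by (simp add: powr_diff powr_divide field_simps)
    moreover have "(a / d) powr (q - 1) \<ge> 1" using False d q by (intro ge_one_powr_ge_zero) auto
    ultimately have "a * 1 \<le> d powr (1 - q) * a powr q" using that by (metis mult_left_mono)
    then show ?thesis using d by simp
  qed (use d in \<open>simp add: add_increasing2\<close>)
  have "(\<integral>\<^sup>+x. ennreal (indicator K x * norm (f x - g x)) \<partial>lborel)
     \<le> (\<integral>\<^sup>+x. ennreal d * indicator K x + ennreal (d powr (1 - q)) * ennreal (norm (f x - g x) powr q) \<partial>lborel)"
    using *[OF norm_ge_zero] d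
    by (intro nn_integral_mono) (auto simp: indicator_def ennreal_plus[symmetric] ennreal_mult[symmetric] simp del: ennreal_plus)
  also have "\<dots> = ennreal d * emeasure lborel K + ennreal (d powr (1 - q)) * Lp_dist q f g"
    unfolding Lp_dist_def by (simp add: nn_integral_add nn_integral_cmult)
  finally show ?thesis .
qed

lemma Lp_dist_loc_L1_tendsto:
  fixes f :: "'a::euclidean_space \<Rightarrow> 'b::euclidean_space"
  assumes q: "q \<ge> 1" and [measurable]: "\<And>n. u n \<in> borel_measurable borel" "f \<in> borel_measurable borel" "K \<in> sets borel"
    and K: "emeasure lborel K < \<infinity>" and lim: "(\<lambda>n. Lp_dist q (u n) f) \<longlonglongrightarrow> 0"
  shows "(\<lambda>n. \<integral>\<^sup>+x. ennreal (indicator K x * norm (u n x - f x)) \<partial>lborel) \<longlonglongrightarrow> 0"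
proof (rule order_tendstoI)
  fix a :: ennreal assume "0 < a"
  then obtain c where c: "c > 0" "ennreal c < a" using ennreal_dense_real by blast
  obtain m where m: "emeasure lborel K = ennreal m" "m \<ge> 0" using K by (cases "emeasure lborel K") auto
  \<comment> \<open>\<open>d\<close> makes the first term at most c/2. With \<open>d\<close> fixed,
    \<open>e\<close> makes the second term equal to c/2.\<close>
  define d where "d = c / (2 * (m + 1))"
  have d: "d > 0" using c m by (simp add: d_def)
  have dm: "d * m \<le> c / 2" using c m by (simp add: d_def field_simps)
  define e where "e = c / (2 * d powr (1 - q))"
  have e: "e > 0" using c d by (simp add: e_def)
  have "\<forall>\<^sub>F n in sequentially. Lp_dist q (u n) f < ennreal e" using lim e by (intro order_tendstoD) auto
  then show "\<forall>\<^sub>F n in sequentially. (\<integral>\<^sup>+x. ennreal (indicator K x * norm (u n x - f x)) \<partial>lborel) < a"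
  proof eventually_elim
    case (elim n)
    have "(\<integral>\<^sup>+x. ennreal (indicator K x * norm (u n x - f x)) \<partial>lborel)
      \<le> ennreal d * emeasure lborel K + ennreal (d powr (1 - q)) * Lp_dist q (u n) f"
      by (rule Lp_dist_loc_L1_le[OF q d]) auto
    also have "\<dots> \<le> ennreal d * ennreal m + ennreal (d powr (1 - q)) * ennreal e"
      unfolding m using elim by (intro add_mono mult_left_mono) auto
    also have "\<dots> = ennreal (d * m + d powr (1 - q) * e)"
      using d m e by (simp add: ennreal_mult)
    also have "\<dots> \<le> ennreal c" using dm d by (intro ennreal_leI) (simp add: e_def)
    finally show ?case using c by (auto intro: le_less_trans)
  qed
qed simp

section \<open>The space \<open>D\<^sup>1\<^sup>,\<^sup>2\<close> and its weak gradients\<close>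

lemma Lp_dist_2: "Lp_dist 2 f g = (\<integral>\<^sup>+x. ennreal ((norm (f x - g x))\<^sup>2) \<partial>lborel)"
  by (simp add: Lp_dist_def)

text \<open>\<open>D12\<close> says only that the gradients of the approximants are Cauchy, and
  \<open>weak_grad\<close> is an arbitrary choice. This predicate names the L2 limit g of the
  gradients along a sequence that also converges to f, so that each operation on f comes with the
  matching operation on g.\<close>

definition D12_grad :: "('a::euclidean_space \<Rightarrow> real) \<Rightarrow> ('a \<Rightarrow> 'a) \<Rightarrow> bool" where
  "D12_grad f g \<longleftrightarrow> f \<in> borel_measurable borel \<and> g \<in> borel_measurable borel \<and>
     (\<exists>u. (\<forall>n. u n \<in> Cc_infty) \<and> (\<lambda>n. Lp_dist 2 (grad (u n)) g) \<longlonglongrightarrow> 0 \<and>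
       (\<lambda>n. Lp_dist (pstar TYPE('a)) (u n) f) \<longlonglongrightarrow> 0)"

lemma D12_gradD:
  assumes "D12_grad f g"
  shows "f \<in> borel_measurable borel" "g \<in> borel_measurable borel"
  using assms by (auto simp: D12_grad_def)

lemma D12_gradE:
  fixes f :: "'a::euclidean_space \<Rightarrow> real"
  assumes "D12_grad f g"
  obtains u where "\<And>n. u n \<in> Cc_infty" "(\<lambda>n. Lp_dist 2 (grad (u n)) g) \<longlonglongrightarrow> 0"
    "(\<lambda>n. Lp_dist (pstar TYPE('a)) (u n) f) \<longlonglongrightarrow> 0"
  using assms by (auto simp: D12_grad_def)

lemma Lp_dist_grad:
  assumes "u \<in> Cc_infty" "v \<in> Cc_infty"
  shows "Lp_dist 2 (grad u) (grad v) = ennreal ((grad_norm (\<lambda>x. u x - v x))\<^sup>2)"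
  unfolding Lp_dist_2 using nn_integral_grad_norm[OF Cc_infty_diff[OF assms]] assms
  by (simp add: grad_diff)

lemma Lp_dist_tendsto_imp_Cauchy:
  fixes u :: "nat \<Rightarrow> 'a::euclidean_space \<Rightarrow> 'b::euclidean_space"
  assumes q: "q \<ge> 0" and [measurable]: "\<And>n. u n \<in> borel_measurable borel" "f \<in> borel_measurable borel"
    and lim: "(\<lambda>n. Lp_dist q (u n) f) \<longlonglongrightarrow> 0" and e: "e > 0"
  shows "\<exists>M. \<forall>m\<ge>M. \<forall>n\<ge>M. Lp_dist q (u m) (u n) < e"
proof -
  obtain c where c: "c > 0" "ennreal c < e" using ennreal_dense_real[OF e] by blast
  define d where "d = c / (2 * 2 powr q)"
  have d: "d > 0" using c by (simp add: d_def)
  have "\<forall>\<^sub>F n in sequentially. Lp_dist q (u n) f < ennreal d" using lim d by (intro order_tendstoD) auto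
  then obtain M where M: "\<And>n. n \<ge> M \<Longrightarrow> Lp_dist q (u n) f < ennreal d" by (auto simp: eventually_sequentially)
  have "Lp_dist q (u m) (u n) < e" if "m \<ge> M" "n \<ge> M" for m n
  proof -
    have "Lp_dist q (u m) (u n) \<le> ennreal (2 powr q) * (Lp_dist q (u m) f + Lp_dist q f (u n))"
      by (rule Lp_dist_triangle[OF q]) auto
    also have "\<dots> \<le> ennreal (2 powr q) * (ennreal d + ennreal d)"
      using M that by (intro mult_left_mono add_mono) (auto simp: Lp_dist_commute[of q f] less_imp_le)
    also have "\<dots> = ennreal c" using d by (simp add: ennreal_mult[symmetric] ennreal_plus[symmetric] d_def del: ennreal_plus)
    finally show ?thesis using c by (auto intro: le_less_trans)
  qed
  then show ?thesis by blast
qed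

lemma D12_imp_D12_grad:
  fixes f :: "'a::euclidean_space \<Rightarrow> real"
  assumes f: "f \<in> D12"
  obtains g where "D12_grad f g"
proof -
  obtain u where u: "\<And>n. u n \<in> Cc_infty"
    "\<And>e. e > 0 \<Longrightarrow> \<exists>M. \<forall>m\<ge>M. \<forall>n\<ge>M. grad_norm (\<lambda>x. u m x - u n x) < e"
    "(\<lambda>n. Lp_dist (pstar TYPE('a)) (u n) f) \<longlonglongrightarrow> 0"
    using f unfolding D12_def Lp_dist_def pstar_def by auto
  note [measurable] = Cc_infty_borel[OF u(1)]
  have "\<exists>M. \<forall>m\<ge>M. \<forall>n\<ge>M. Lp_dist 2 (grad (u m)) (grad (u n)) < e" if e0: "e > 0" for e
  proof -
    obtain c where c: "c > 0" "ennreal c < e" using ennreal_dense_real[OF e0] by blast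
    obtain M where M: "\<And>m n. m \<ge> M \<Longrightarrow> n \<ge> M \<Longrightarrow> grad_norm (\<lambda>x. u m x - u n x) < sqrt c"
      using u(2)[of "sqrt c"] c by auto
    have "Lp_dist 2 (grad (u m)) (grad (u n)) < e" if "m \<ge> M" "n \<ge> M" for m n
    proof -
      have "(grad_norm (\<lambda>x. u m x - u n x))\<^sup>2 \<le> (sqrt c)\<^sup>2"
        using M[OF that] by (intro power_mono) (auto simp: grad_norm_def)
      then have "Lp_dist 2 (grad (u m)) (grad (u n)) \<le> ennreal c"
        using c by (simp add: Lp_dist_grad[OF u(1) u(1)] ennreal_leI)
      then show ?thesis using c by (auto intro: le_less_trans)
    qed
    then show ?thesis by blast
  qed
  then obtain g where "g \<in> borel_measurable borel" "(\<lambda>n. Lp_dist 2 (grad (u n)) g) \<longlonglongrightarrow> 0"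
    using Lp_dist_complete[of 2 "\<lambda>n. grad (u n)", OF _ Cc_infty_borel(2)[OF u(1)]] by (simp, blast)
  with u f have "D12_grad f g" unfolding D12_grad_def D12_def by auto
  with that show thesis .
qed

lemma D12_grad_imp_D12:
  fixes f :: "'a::euclidean_space \<Rightarrow> real"
  assumes fg: "D12_grad f g"
  shows "f \<in> D12"
proof -
  obtain u where u: "\<And>n. u n \<in> Cc_infty" "(\<lambda>n. Lp_dist 2 (grad (u n)) g) \<longlonglongrightarrow> 0"
    "(\<lambda>n. Lp_dist (pstar TYPE('a)) (u n) f) \<longlonglongrightarrow> 0" using D12_gradE[OF fg] by metis
  note [measurable] = Cc_infty_borel[OF u(1)] D12_gradD[OF fg]
  have "\<exists>M. \<forall>m\<ge>M. \<forall>n\<ge>M. grad_norm (\<lambda>x. u m x - u n x) < e" if e: "e > 0" for e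
  proof -
    obtain M where M: "\<And>m n. m \<ge> M \<Longrightarrow> n \<ge> M \<Longrightarrow> Lp_dist 2 (grad (u m)) (grad (u n)) < ennreal (e\<^sup>2)"
      using Lp_dist_tendsto_imp_Cauchy[OF _ _ _ u(2), of "ennreal (e\<^sup>2)"] e by auto
    have "grad_norm (\<lambda>x. u m x - u n x) < e" if "m \<ge> M" "n \<ge> M" for m n
      using M[OF that] e unfolding Lp_dist_grad[OF u(1) u(1)]
      by (simp add: ennreal_less_iff power2_less_imp_less)
    then show ?thesis by blast
  qed
  moreover have "f \<in> borel_measurable lborel" by simp
  ultimately show ?thesis using u unfolding D12_def Lp_dist_def pstar_def by auto
qed

lemma D12_grad_cong_AE:
  assumes "D12_grad f g" "AE x in lborel. f x = f' x" "AE x in lborel. g x = g' x"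
    "f' \<in> borel_measurable borel" "g' \<in> borel_measurable borel"
  shows "D12_grad f' g'"
proof -
  have "Lp_dist 2 v g = Lp_dist 2 v g'" "Lp_dist q w f = Lp_dist q w f'" for v w q
    using assms by (auto intro!: Lp_dist_cong_AE)
  then show ?thesis using assms unfolding D12_grad_def by simp
qed

section \<open>Integration by parts, and weak gradients of \<open>D12\<close> functions\<close>

lemma Cc_infty_lipschitz:
  fixes w :: "'a::euclidean_space \<Rightarrow> real"
  assumes w: "w \<in> Cc_infty" and B: "\<And>x. norm (grad w x) \<le> B"
  shows "\<bar>w x - w y\<bar> \<le> B * norm (x - y)"
proof -
  have "norm (w x - w y) \<le> B * norm (x - y)"
  proof (rule differentiable_bound[of UNIV])
    fix z show "(w has_derivative (\<lambda>v. v \<bullet> grad w z)) (at z within UNIV)"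
      using Cc_infty_has_derivative[OF w] by simp
    show "onorm (\<lambda>v. v \<bullet> grad w z) \<le> B"
    proof (rule onorm_bound)
      show "0 \<le> B" using B[of z] norm_ge_zero order_trans by blast
      fix v show "norm (v \<bullet> grad w z) \<le> B * norm v"
        using Cauchy_Schwarz_ineq2[of v "grad w z"] mult_right_mono[OF B[of z] norm_ge_zero[of v]]
        by (simp add: mult.commute)
    qed
  qed auto
  then show ?thesis by simp
qed

lemma integral_translate_lborel:
  fixes f :: "'a::euclidean_space \<Rightarrow> 'b::euclidean_space"
  assumes [measurable]: "f \<in> borel_measurable borel"
  shows "(\<integral>x. f (c + x) \<partial>lborel) = (\<integral>x. f x \<partial>lborel)"
proof -
  have "(\<integral>x. f x \<partial>lborel) = (\<integral>x. f x \<partial>distr lborel borel ((+) c))" by (simp add: lborel_distr_plus)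
  also have "\<dots> = (\<integral>x. f (c + x) \<partial>lborel)" by (rule integral_distr) auto
  finally show ?thesis by simp
qed

lemma nn_integral_translate_lborel:
  fixes f :: "'a::euclidean_space \<Rightarrow> ennreal"
  assumes [measurable]: "f \<in> borel_measurable borel"
  shows "(\<integral>\<^sup>+x. f (c + x) \<partial>lborel) = (\<integral>\<^sup>+x. f x \<partial>lborel)"
proof -
  have "(\<integral>\<^sup>+x. f x \<partial>lborel) = (\<integral>\<^sup>+x. f x \<partial>distr lborel borel ((+) c))" by (simp add: lborel_distr_plus)
  also have "\<dots> = (\<integral>\<^sup>+x. f (c + x) \<partial>lborel)" by (rule nn_integral_distr) auto
  finally show ?thesis by simp
qed

lemma Cc_infty_integrable:
  fixes u :: "'a::euclidean_space \<Rightarrow> real"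
  assumes "u \<in> Cc_infty" shows "integrable lborel u" "integrable lborel (grad u)"
proof -
  obtain R B where RB: "R > 0" "B > 0" "\<And>x. norm x > R \<Longrightarrow> u x = 0" "\<And>x. norm x > R \<Longrightarrow> grad u x = 0"
    "\<And>x. \<bar>u x\<bar> \<le> B" "\<And>x. norm (grad u x) \<le> B"
    using Cc_infty_bounded[OF assms] by metis
  show "integrable lborel u" using RB by (intro integrable_bounded_support[of u R B] Cc_infty_borel assms) auto
  show "integrable lborel (grad u)" using RB by (intro integrable_bounded_support[of _ R B] Cc_infty_borel assms) auto
qed

text \<open>By translation invariance the difference quotients of \<open>w\<close> have integral zero.\<close>

lemma integral_grad_eq_0:
  fixes w :: "'a::euclidean_space \<Rightarrow> real"
  assumes w: "w \<in> Cc_infty"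
  shows "(\<integral>x. grad w x \<partial>lborel) = 0"
proof (rule euclidean_eqI)
  fix b :: 'a assume b: "b \<in> Basis"
  obtain R B where RB: "R > 0" "B > 0" "\<And>x. norm x > R \<Longrightarrow> w x = 0" "\<And>x. norm (grad w x) \<le> B"
    using Cc_infty_bounded[OF w] by metis
  note Cc_infty_borel[OF w, measurable]
  define h where "h n = 1 / real (Suc n)" for n
  have h: "h n > 0" "h n \<le> 1" for n by (auto simp: h_def)
  have h0: "h \<longlonglongrightarrow> 0" unfolding h_def by (rule LIMSEQ_Suc) (rule lim_1_over_n)
  define Q where "Q n x = (w (h n *\<^sub>R b + x) - w x) / h n" for n x
  have "(\<lambda>n. \<integral>x. Q n x \<partial>lborel) \<longlonglongrightarrow> (\<integral>x. grad w x \<bullet> b \<partial>lborel)"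
  proof (rule integral_dominated_convergence)
    show "integrable lborel (\<lambda>x::'a. indicator (cball 0 (R + 1)) x *\<^sub>R B)"
      using emeasure_lborel_cball_finite[of "0::'a" "R + 1"]
      by (intro integrable_scaleR_left integrable_real_indicator) auto
    show "AE x in lborel. norm (Q n x) \<le> indicator (cball 0 (R + 1)) x *\<^sub>R B" for n
    proof (intro AE_I2)
      fix x :: 'a
      show "norm (Q n x) \<le> indicator (cball 0 (R + 1)) x *\<^sub>R B"
      proof (cases "norm x \<le> R + 1")
        case True
        have "\<bar>w (h n *\<^sub>R b + x) - w x\<bar> \<le> B * norm (h n *\<^sub>R b + x - x)"
          by (rule Cc_infty_lipschitz[OF w RB(4)])
        then have "\<bar>w (h n *\<^sub>R b + x) - w x\<bar> \<le> B * h n" using b h[of n] by simp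
        then show ?thesis using True h[of n] by (simp add: Q_def field_simps)
      next
        case False
        have "norm x \<le> norm (h n *\<^sub>R b + x) + norm (h n *\<^sub>R b)"
          using norm_triangle_ineq4[of "h n *\<^sub>R b + x" "h n *\<^sub>R b"] by simp
        then have "norm (h n *\<^sub>R b + x) > R" using False b h[of n] by simp
        then show ?thesis using False RB(3) by (simp add: Q_def)
      qed
    qed
    show "AE x in lborel. (\<lambda>n. Q n x) \<longlonglongrightarrow> grad w x \<bullet> b"
    proof (intro AE_I2)
      fix x :: 'a
      have "((\<lambda>t. w (x + t *\<^sub>R b)) has_real_derivative grad w x \<bullet> b) (at 0)"
      proof -
        have "((\<lambda>t. x + t *\<^sub>R b) has_derivative (\<lambda>s. s *\<^sub>R b)) (at 0)"
          by (auto intro!: derivative_eq_intros)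
        from has_derivative_compose[OF this Cc_infty_has_derivative[OF w]] show ?thesis
          by (simp add: has_field_derivative_def mult.commute[of _ "b \<bullet> _"] inner_commute)
      qed
      then have *: "((\<lambda>t. (w (x + t *\<^sub>R b) - w x) / t) \<longlongrightarrow> grad w x \<bullet> b) (at 0)"
        by (simp add: has_field_derivative_iff)
      have "filterlim h (at 0) sequentially"
        using h0 h by (auto simp: filterlim_at less_imp_neq[symmetric] intro!: always_eventually)
      from filterlim_compose[OF * this] show "(\<lambda>n. Q n x) \<longlonglongrightarrow> grad w x \<bullet> b"
        by (simp add: Q_def add.commute)
    qed
  qed (auto simp: Q_def)
  moreover have "(\<integral>x. Q n x \<partial>lborel) = 0" for n
  proof -
    have "integrable lborel (\<lambda>x. w (h n *\<^sub>R b + x))"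
      using integrable_distr[of "(+) (h n *\<^sub>R b)" lborel borel w] Cc_infty_integrable(1)[OF w]
      by (simp add: lborel_distr_plus)
    then have "(\<integral>x. w (h n *\<^sub>R b + x) - w x \<partial>lborel) = 0"
      using Cc_infty_integrable[OF w] integral_translate_lborel[of w "h n *\<^sub>R b"]
      by (subst Bochner_Integration.integral_diff) auto
    then show ?thesis by (simp add: Q_def)
  qed
  ultimately have "(\<integral>x. grad w x \<bullet> b \<partial>lborel) = 0" by (simp add: LIMSEQ_const_iff)
  then show "(\<integral>x. grad w x \<partial>lborel) \<bullet> b = 0 \<bullet> b"
    using Cc_infty_integrable[OF w] by simp
qed

text \<open>The product u v is a test function, so the integral of its gradient vanishes; the
  product rule splits it.\<close>

lemma Cc_infty_integration_by_parts:
  fixes u :: "'a::euclidean_space \<Rightarrow> real"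
  assumes u: "u \<in> Cc_infty" and v: "v \<in> Cc_infty"
  shows "(\<integral>x. u x *\<^sub>R grad v x \<partial>lborel) = - (\<integral>x. v x *\<^sub>R grad u x \<partial>lborel)"
proof -
  have int: "integrable lborel (\<lambda>x. u x *\<^sub>R grad v x)" if uu: "u \<in> Cc_infty" and vv: "v \<in> Cc_infty" for u v :: "'a \<Rightarrow> real"
  proof -
    note Cc_infty_borel[OF uu, measurable] Cc_infty_borel[OF vv, measurable]
    obtain R B where RB: "B > 0" "\<And>x. norm x > R \<Longrightarrow> u x = 0" "\<And>x. \<bar>u x\<bar> \<le> B"
      using Cc_infty_bounded[OF uu] by metis
    obtain C where C: "\<And>x. norm (grad v x) \<le> C" using Cc_infty_bounded[OF vv] by metis
    show ?thesis
    proof (rule integrable_bounded_support)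
      show "norm (u x *\<^sub>R grad v x) \<le> B * C" for x using RB C by (simp add: mult_mono less_imp_le)
    qed (use RB in auto)
  qed
  have uv: "(\<lambda>x. u x * v x) \<in> Cc_infty" using v by (intro Cc_infty_mult u) (auto simp: Cc_infty_def)
  have "(\<integral>x. u x *\<^sub>R grad v x + v x *\<^sub>R grad u x \<partial>lborel) = 0"
    using integral_grad_eq_0[OF uv] by (simp add: grad_mult[OF u v])
  then show ?thesis using int[OF u v] int[OF v u] by (simp add: add_eq_0_iff2)
qed

lemma Lp_dist_Cc_infty_finite:
  assumes u: "u \<in> Cc_infty" and q: "q > 0"
  shows "Lp_dist q u (\<lambda>x. 0) < \<infinity>" "Lp_dist q (grad u) (\<lambda>x. 0) < \<infinity>"
proof -
  note Cc_infty_borel[OF u, measurable]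
  obtain R B where RB: "B > 0" "\<And>x. norm x > R \<Longrightarrow> u x = 0" "\<And>x. norm x > R \<Longrightarrow> grad u x = 0"
    "\<And>x. \<bar>u x\<bar> \<le> B" "\<And>x. norm (grad u x) \<le> B"
    using Cc_infty_bounded[OF u] by metis
  have "integrable lborel (\<lambda>x. \<bar>u x\<bar> powr q)"
    by (rule integrable_bounded_support[of _ R "B powr q"]) (use RB q in \<open>auto intro!: powr_mono2\<close>)
  then show "Lp_dist q u (\<lambda>x. 0) < \<infinity>"
    unfolding Lp_dist_def by (simp add: nn_integral_eq_integral)
  have "integrable lborel (\<lambda>x. norm (grad u x) powr q)"
    by (rule integrable_bounded_support[of _ R "B powr q"]) (use RB q in \<open>auto intro!: powr_mono2\<close>)
  then show "Lp_dist q (grad u) (\<lambda>x. 0) < \<infinity>"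
    unfolding Lp_dist_def by (simp add: nn_integral_eq_integral)
qed

lemma Lp_dist_limit_finite:
  fixes u :: "nat \<Rightarrow> 'a::euclidean_space \<Rightarrow> 'b::euclidean_space"
  assumes q: "q > 0" and [measurable]: "\<And>n. u n \<in> borel_measurable borel" "f \<in> borel_measurable borel"
    and lim: "(\<lambda>n. Lp_dist q (u n) f) \<longlonglongrightarrow> 0" and fin: "\<And>n. Lp_dist q (u n) (\<lambda>x. 0) < \<infinity>"
  shows "Lp_dist q f (\<lambda>x. 0) < \<infinity>"
proof -
  have "\<forall>\<^sub>F n in sequentially. Lp_dist q (u n) f < 1" using lim by (intro order_tendstoD) auto
  then obtain n where n: "Lp_dist q (u n) f < 1" using eventually_happens trivial_limit_sequentially by blast
  have "Lp_dist q f (\<lambda>x. 0) \<le> ennreal (2 powr q) * (Lp_dist q f (u n) + Lp_dist q (u n) (\<lambda>x. 0))"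
    using q by (intro Lp_dist_triangle) auto
  also have "\<dots> < \<infinity>" using n fin[of n] less_trans[OF n ennreal_one_less_top]
    by (simp add: Lp_dist_commute[of q f] ennreal_mult_less_top)
  finally show ?thesis .
qed

lemma D12_grad_finite:
  fixes f :: "'a::euclidean_space \<Rightarrow> real"
  assumes N: "DIM('a) \<ge> 3" and fg: "D12_grad f g"
  shows "Lp_dist 2 g (\<lambda>x. 0) < \<infinity>" "Lp_dist (pstar TYPE('a)) f (\<lambda>x. 0) < \<infinity>"
proof -
  obtain u where u: "\<And>n. u n \<in> Cc_infty" "(\<lambda>n. Lp_dist 2 (grad (u n)) g) \<longlonglongrightarrow> 0"
    "(\<lambda>n. Lp_dist (pstar TYPE('a)) (u n) f) \<longlonglongrightarrow> 0" using D12_gradE[OF fg] by metis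
  note m = Cc_infty_borel[OF u(1)] D12_gradD[OF fg]
  show "Lp_dist 2 g (\<lambda>x. 0) < \<infinity>"
    using Lp_dist_Cc_infty_finite(2)[OF u(1), of 2] by (intro Lp_dist_limit_finite[OF _ m(2,4) u(2)]) auto
  show "Lp_dist (pstar TYPE('a)) f (\<lambda>x. 0) < \<infinity>"
    using pstar_gt_2[OF N] by (intro Lp_dist_limit_finite[OF _ m(1,3) u(3)] Lp_dist_Cc_infty_finite u) auto
qed

lemma Lp_finite_set_integrable:
  fixes f :: "'a::euclidean_space \<Rightarrow> 'b::euclidean_space"
  assumes q: "q \<ge> 1" and [measurable]: "f \<in> borel_measurable borel"
    and fin: "Lp_dist q f (\<lambda>x. 0) < \<infinity>" and K: "compact K"
  shows "set_integrable lborel K f"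
proof -
  have [measurable]: "K \<in> sets borel" using K by (simp add: borel_compact)
  have "(\<integral>\<^sup>+x. ennreal (indicator K x * norm (f x)) \<partial>lborel)
    \<le> ennreal 1 * emeasure lborel K + ennreal (1 powr (1 - q)) * Lp_dist q f (\<lambda>x. 0)"
    using Lp_dist_loc_L1_le[OF q, of 1 f "\<lambda>x. 0" K] by simp
  also have "\<dots> < \<infinity>" using fin emeasure_compact_finite[OF K] by simp
  finally have "(\<integral>\<^sup>+x. ennreal (norm (indicator K x *\<^sub>R f x)) \<partial>lborel) < \<infinity>" by (simp add: mult.commute)
  then show ?thesis unfolding set_integrable_def by (intro integrableI_bounded) auto
qed

text \<open>On a fixed ball, L^q convergence implies L1 convergence. The hypothesis
  \<open>le\<close> covers multiplication by a test function as well as by its gradient, both of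
  which are bounded.\<close>

lemma tendsto_integral_test:
  fixes F :: "'a::euclidean_space \<Rightarrow> 'b::euclidean_space" and v :: "nat \<Rightarrow> 'a \<Rightarrow> 'b"
    and G :: "'a \<Rightarrow> 'c::euclidean_space"
  assumes q: "q \<ge> 1" and [measurable]: "\<And>n. v n \<in> borel_measurable borel" "F \<in> borel_measurable borel"
      "\<And>n. H n \<in> borel_measurable borel" "G \<in> borel_measurable borel"
    and lim: "(\<lambda>n. Lp_dist q (v n) F) \<longlonglongrightarrow> 0"
    and H: "\<And>n. integrable lborel (H n)" and G: "integrable lborel G"
    and le: "\<And>n x. norm (H n x - G x) \<le> B * norm (v n x - F x)"
    and supp: "\<And>n x. norm x > R \<Longrightarrow> H n x = 0 \<and> G x = 0"
  shows "(\<lambda>n. \<integral>x. H n x \<partial>lborel) \<longlonglongrightarrow> (\<integral>x. G x \<partial>lborel)"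
proof (rule tendsto_L1_int[OF H G])
  define I where "I n = (\<integral>\<^sup>+x. ennreal (indicator (cball 0 R) x * norm (v n x - F x)) \<partial>lborel)" for n
  have "I \<longlonglongrightarrow> 0"
    unfolding I_def using emeasure_lborel_cball_finite by (intro Lp_dist_loc_L1_tendsto[OF q _ _ _ _ lim]) auto
  then have "(\<lambda>n. ennreal \<bar>B\<bar> * I n) \<longlonglongrightarrow> ennreal \<bar>B\<bar> * 0" by (intro ennreal_tendsto_cmult) auto
  then have lim0: "(\<lambda>n. ennreal \<bar>B\<bar> * I n) \<longlonglongrightarrow> 0" by simp
  have bd: "(\<integral>\<^sup>+x. ennreal (norm (H n x - G x)) \<partial>lborel) \<le> ennreal \<bar>B\<bar> * I n" for n
  proof -
    have "norm (H n x - G x) \<le> \<bar>B\<bar> * (indicator (cball 0 R) x * norm (v n x - F x))" for x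
    proof (cases "norm x > R")
      case False
      have "norm (H n x - G x) \<le> \<bar>B\<bar> * norm (v n x - F x)"
        by (rule order_trans[OF le mult_right_mono]) auto
      then show ?thesis using False by simp
    qed (use supp in simp)
    then have "(\<integral>\<^sup>+x. ennreal (norm (H n x - G x)) \<partial>lborel)
       \<le> (\<integral>\<^sup>+x. ennreal \<bar>B\<bar> * ennreal (indicator (cball 0 R) x * norm (v n x - F x)) \<partial>lborel)"
      by (intro nn_integral_mono) (simp add: ennreal_mult[symmetric])
    also have "\<dots> = ennreal \<bar>B\<bar> * I n"
    proof -
      have "(\<lambda>x. norm (v n x - F x)) \<in> borel_measurable borel"
        using assms(2)[of n] assms(3) by measurable
      then have "(\<lambda>x. ennreal (indicator (cball 0 R) x * norm (v n x - F x))) \<in> borel_measurable lborel"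
        by (intro measurable_ennreal[THEN measurable_compose_rev] borel_measurable_times borel_measurable_indicator)
           (auto simp: borel_closed)
      then show ?thesis unfolding I_def by (rule nn_integral_cmult)
    qed
    finally show ?thesis .
  qed
  show "(\<lambda>n. \<integral>\<^sup>+x. ennreal (norm (H n x - G x)) \<partial>lborel) \<longlonglongrightarrow> 0"
    by (rule tendsto_sandwich[OF _ _ tendsto_const lim0]) (auto simp: bd)
qed

text \<open>For a fixed test function both sides of the integration by parts pass to the limit: the
  left through the L^p convergence of the functions, the right through the L2 convergence of the
  gradients.\<close>

lemma D12_grad_has_weak_grad:
  fixes f :: "'a::euclidean_space \<Rightarrow> real"
  assumes N: "DIM('a) \<ge> 3" and fg: "D12_grad f g"
  shows "has_weak_grad f g"
proof -
  obtain u where u: "\<And>n. u n \<in> Cc_infty" "(\<lambda>n. Lp_dist 2 (grad (u n)) g) \<longlonglongrightarrow> 0"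
    "(\<lambda>n. Lp_dist (pstar TYPE('a)) (u n) f) \<longlonglongrightarrow> 0" using D12_gradE[OF fg] by metis
  note [measurable] = Cc_infty_borel[OF u(1)] D12_gradD[OF fg]
  have p: "pstar TYPE('a) \<ge> 1" using pstar_gt_2[OF N] by simp
  have f: "set_integrable lborel K f" if "compact K" for K
    using D12_grad_finite[OF N fg] that p by (intro Lp_finite_set_integrable[of "pstar TYPE('a)"]) auto
  have g: "set_integrable lborel K g" if "compact K" for K
    using D12_grad_finite[OF N fg] that by (intro Lp_finite_set_integrable[of 2]) auto
  have "(\<integral>x. f x *\<^sub>R grad \<psi> x \<partial>lborel) = - (\<integral>x. \<psi> x *\<^sub>R g x \<partial>lborel)" if psi: "\<psi> \<in> Cc_infty" for \<psi>
  proof -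
    note [measurable] = Cc_infty_borel[OF psi]
    obtain R B where RB: "B > 0" "\<And>x. norm x > R \<Longrightarrow> \<psi> x = 0" "\<And>x. norm x > R \<Longrightarrow> grad \<psi> x = 0"
      "\<And>x. \<bar>\<psi> x\<bar> \<le> B" "\<And>x. norm (grad \<psi> x) \<le> B"
      using Cc_infty_bounded[OF psi] by metis
    have i1: "integrable lborel (\<lambda>x. v x *\<^sub>R grad \<psi> x)"
      if v: "set_integrable lborel (cball 0 R) v" and [measurable]: "v \<in> borel_measurable borel" for v
    proof (rule Bochner_Integration.integrable_bound)
      show "integrable lborel (\<lambda>x. B * norm (indicator (cball 0 R) x *\<^sub>R v x))"
        using v unfolding set_integrable_def by (intro integrable_mult_right integrable_norm)
      show "AE x in lborel. norm (v x *\<^sub>R grad \<psi> x) \<le> norm (B * norm (indicator (cball 0 R) x *\<^sub>R v x))"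
        using RB by (intro AE_I2) (auto simp: indicator_def mult.commute[of _ "norm _"] intro!: mult_right_mono)
    qed simp
    have i2: "integrable lborel (\<lambda>x. \<psi> x *\<^sub>R w x)"
      if w: "set_integrable lborel (cball 0 R) w" and [measurable]: "w \<in> borel_measurable borel" for w :: "'a \<Rightarrow> 'a"
    proof (rule Bochner_Integration.integrable_bound)
      show "integrable lborel (\<lambda>x. B * norm (indicator (cball 0 R) x *\<^sub>R w x))"
        using w unfolding set_integrable_def by (intro integrable_mult_right integrable_norm)
      show "AE x in lborel. norm (\<psi> x *\<^sub>R w x) \<le> norm (B * norm (indicator (cball 0 R) x *\<^sub>R w x))"
        using RB by (intro AE_I2) (auto simp: indicator_def intro!: mult_right_mono)
    qed simp
    have cc: "set_integrable lborel (cball 0 R) (u n)" "set_integrable lborel (cball 0 R) (grad (u n))" for n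
      using Cc_infty_integrable[OF u(1)[of n]] unfolding set_integrable_def by (intro integrable_mult_indicator; simp)+
    have "(\<lambda>n. \<integral>x. u n x *\<^sub>R grad \<psi> x \<partial>lborel) \<longlonglongrightarrow> (\<integral>x. f x *\<^sub>R grad \<psi> x \<partial>lborel)"
    proof (rule tendsto_integral_test[OF p _ _ _ _ u(3), where B=B and R=R])
      show "norm (u n x *\<^sub>R grad \<psi> x - f x *\<^sub>R grad \<psi> x) \<le> B * norm (u n x - f x)" for n x
        using RB(5)[of x] by (simp add: scaleR_diff_left[symmetric] mult.commute[of B] mult_left_mono)
    qed (use RB cc f in \<open>auto intro!: i1\<close>)
    moreover have "(\<lambda>n. \<integral>x. \<psi> x *\<^sub>R grad (u n) x \<partial>lborel) \<longlonglongrightarrow> (\<integral>x. \<psi> x *\<^sub>R g x \<partial>lborel)"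
    proof (rule tendsto_integral_test[OF _ _ _ _ _ u(2), where B=B and R=R])
      show "norm (\<psi> x *\<^sub>R grad (u n) x - \<psi> x *\<^sub>R g x) \<le> B * norm (grad (u n) x - g x)" for n x
        using RB(4)[of x] by (simp add: scaleR_diff_right[symmetric] mult_right_mono)
    qed (use RB cc g in \<open>auto intro!: i2\<close>)
    then have "(\<lambda>n. - (\<integral>x. \<psi> x *\<^sub>R grad (u n) x \<partial>lborel)) \<longlonglongrightarrow> - (\<integral>x. \<psi> x *\<^sub>R g x \<partial>lborel)"
      by (rule tendsto_minus)
    ultimately show ?thesis
      unfolding Cc_infty_integration_by_parts[OF u(1) psi] by (rule LIMSEQ_unique)
  qed
  with f g show ?thesis unfolding has_weak_grad_def by blast
qed

text \<open>Since a weak gradient exists, \<open>SOME\<close> selects one, and any two agree almost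
  everywhere.\<close>

lemma D12_grad_AE_weak_grad:
  fixes f :: "'a::euclidean_space \<Rightarrow> real"
  assumes "DIM('a) \<ge> 3" "D12_grad f g"
  shows "AE x in lborel. weak_grad f x = g x"
proof -
  have g: "has_weak_grad f g" by (rule D12_grad_has_weak_grad[OF assms])
  then have "has_weak_grad f (weak_grad f)" unfolding weak_grad_def by (rule someI[of "has_weak_grad f"])
  then show ?thesis using g by (rule has_weak_grad_unique)
qed

lemma D12_grad_weak_grad:
  fixes f :: "'a::euclidean_space \<Rightarrow> real"
  assumes N: "DIM('a) \<ge> 3" and f: "f \<in> D12"
  shows "D12_grad f (weak_grad f)"
proof -
  obtain g where g: "D12_grad f g" using D12_imp_D12_grad[OF f] .
  then have "has_weak_grad f g" by (rule D12_grad_has_weak_grad[OF N])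
  then have "has_weak_grad f (weak_grad f)" unfolding weak_grad_def by (rule someI[of "has_weak_grad f"])
  then have "weak_grad f \<in> borel_measurable borel"
    by (intro loc_integrable_borel) (auto simp: has_weak_grad_def)
  then show ?thesis
    using D12_grad_AE_weak_grad[OF N g] D12_gradD[OF g]
    by (intro D12_grad_cong_AE[OF g]) (auto elim: eventually_mono)
qed

section \<open>Linear structure, Sobolev inequality and completeness\<close>

lemma Lp_dist_linear:
  fixes f f' h h' :: "'a::euclidean_space \<Rightarrow> 'b::euclidean_space"
  assumes q: "q > 0" and [measurable]: "f \<in> borel_measurable borel" "f' \<in> borel_measurable borel"
    "h \<in> borel_measurable borel" "h' \<in> borel_measurable borel"
  shows "Lp_dist q (\<lambda>x. a *\<^sub>R f x + b *\<^sub>R f' x) (\<lambda>x. a *\<^sub>R h x + b *\<^sub>R h' x)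
    \<le> ennreal (2 powr q) * (ennreal (\<bar>a\<bar> powr q) * Lp_dist q f h + ennreal (\<bar>b\<bar> powr q) * Lp_dist q f' h')"
proof -
  \<comment> \<open>The two summands are changed one at a time; each comparison then has a common
    summand \<open>k\<close> and scales with the coefficient.\<close>
  have sc: "Lp_dist q (\<lambda>x. a *\<^sub>R f x + k x) (\<lambda>x. a *\<^sub>R h x + k x) = ennreal (\<bar>a\<bar> powr q) * Lp_dist q f h"
    if [measurable]: "f \<in> borel_measurable borel" "h \<in> borel_measurable borel" for a f h and k :: "'a \<Rightarrow> 'b"
    unfolding Lp_dist_def
    by (simp add: scaleR_diff_right[symmetric] powr_mult ennreal_mult nn_integral_cmult)
  have "Lp_dist q (\<lambda>x. a *\<^sub>R f x + b *\<^sub>R f' x) (\<lambda>x. a *\<^sub>R h x + b *\<^sub>R h' x)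
    \<le> ennreal (2 powr q) * (Lp_dist q (\<lambda>x. a *\<^sub>R f x + b *\<^sub>R f' x) (\<lambda>x. a *\<^sub>R h x + b *\<^sub>R f' x)
      + Lp_dist q (\<lambda>x. a *\<^sub>R h x + b *\<^sub>R f' x) (\<lambda>x. a *\<^sub>R h x + b *\<^sub>R h' x))"
    using q by (intro Lp_dist_triangle) auto
  then show ?thesis using sc[of f h a "\<lambda>x. b *\<^sub>R f' x"] sc[of f' h' b "\<lambda>x. a *\<^sub>R h x"]
    by (simp add: add.commute)
qed

lemma D12_grad_linear:
  fixes f f' :: "'a::euclidean_space \<Rightarrow> real"
  assumes N: "DIM('a) \<ge> 3" and fg: "D12_grad f g" and fg': "D12_grad f' g'"
  shows "D12_grad (\<lambda>x. a * f x + b * f' x) (\<lambda>x. a *\<^sub>R g x + b *\<^sub>R g' x)"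
proof -
  obtain u where u: "\<And>n. u n \<in> Cc_infty" "(\<lambda>n. Lp_dist 2 (grad (u n)) g) \<longlonglongrightarrow> 0"
    "(\<lambda>n. Lp_dist (pstar TYPE('a)) (u n) f) \<longlonglongrightarrow> 0" using D12_gradE[OF fg] by metis
  obtain v where v: "\<And>n. v n \<in> Cc_infty" "(\<lambda>n. Lp_dist 2 (grad (v n)) g') \<longlonglongrightarrow> 0"
    "(\<lambda>n. Lp_dist (pstar TYPE('a)) (v n) f') \<longlonglongrightarrow> 0" using D12_gradE[OF fg'] by metis
  note [measurable] = Cc_infty_borel[OF u(1)] Cc_infty_borel[OF v(1)] D12_gradD[OF fg] D12_gradD[OF fg']
  have p: "pstar TYPE('a) > 0" using pstar_gt_2[OF N] by simp
  have w: "(\<lambda>x. a * u n x + b * v n x) \<in> Cc_infty" for n by (intro Cc_infty_add Cc_infty_cmult u v)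
  have gw: "grad (\<lambda>x. a * u n x + b * v n x) x = a *\<^sub>R grad (u n) x + b *\<^sub>R grad (v n) x" for n x
    by (simp add: grad_add grad_cmult Cc_infty_cmult u v)
  have lim0: "(\<lambda>n. ennreal c * (ennreal d * x n + ennreal e * y n)) \<longlonglongrightarrow> 0"
    if "x \<longlonglongrightarrow> 0" "y \<longlonglongrightarrow> 0" for x y :: "nat \<Rightarrow> ennreal" and c d e
  proof -
    have "(\<lambda>n. ennreal c * (ennreal d * x n + ennreal e * y n)) \<longlonglongrightarrow> ennreal c * (ennreal d * 0 + ennreal e * 0)"
      using that by (intro ennreal_tendsto_cmult tendsto_add) auto
    then show ?thesis by simp
  qed
  have "(\<lambda>n. Lp_dist 2 (grad (\<lambda>x. a * u n x + b * v n x)) (\<lambda>x. a *\<^sub>R g x + b *\<^sub>R g' x)) \<longlonglongrightarrow> 0"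
    unfolding gw[abs_def]
    by (rule tendsto_sandwich[OF _ _ tendsto_const lim0[OF u(2) v(2)]])
       (auto intro!: always_eventually Lp_dist_linear)
  moreover have "(\<lambda>n. Lp_dist (pstar TYPE('a)) (\<lambda>x. a * u n x + b * v n x) (\<lambda>x. a * f x + b * f' x)) \<longlonglongrightarrow> 0"
    by (rule tendsto_sandwich[OF _ _ tendsto_const lim0[OF u(3) v(3)]])
       (use Lp_dist_linear[OF p, of "u _" "v _" f f' a b] in \<open>auto intro!: always_eventually\<close>)
  ultimately show ?thesis unfolding D12_grad_def using w
    by (intro conjI exI[of _ "\<lambda>n x. a * u n x + b * v n x"]) auto
qed

definition L2sq :: "('a::euclidean_space \<Rightarrow> 'a) \<Rightarrow> real" where
  "L2sq g = (\<integral>x. (norm (g x))\<^sup>2 \<partial>lborel)"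

lemma L2sq_nonneg: "L2sq g \<ge> 0"
  by (simp add: L2sq_def)

lemma D12_grad_L2:
  fixes f :: "'a::euclidean_space \<Rightarrow> real"
  assumes N: "DIM('a) \<ge> 3" and fg: "D12_grad f g"
  shows "integrable lborel (\<lambda>x. (norm (g x))\<^sup>2)" "Lp_dist 2 g (\<lambda>x. 0) = ennreal (L2sq g)"
proof -
  note [measurable] = D12_gradD[OF fg]
  show i: "integrable lborel (\<lambda>x. (norm (g x))\<^sup>2)"
    using D12_grad_finite(1)[OF N fg] unfolding Lp_dist_2 by (intro integrableI_bounded) auto
  show "Lp_dist 2 g (\<lambda>x. 0) = ennreal (L2sq g)"
    unfolding Lp_dist_2 L2sq_def using nn_integral_eq_integral[OF i] by simp
qed

lemma D12_grad_diff:
  fixes f f' :: "'a::euclidean_space \<Rightarrow> real"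
  assumes N: "DIM('a) \<ge> 3" and fg: "D12_grad f g" and fg': "D12_grad f' g'"
  shows "D12_grad (\<lambda>x. f x - f' x) (\<lambda>x. g x - g' x)"
  using D12_grad_linear[OF assms, of 1 "-1"] by simp

lemma Lp_dist_D12_grad:
  fixes f f' :: "'a::euclidean_space \<Rightarrow> real"
  assumes N: "DIM('a) \<ge> 3" and fg: "D12_grad f g" and fg': "D12_grad f' g'"
  shows "Lp_dist 2 g g' = ennreal (L2sq (\<lambda>x. g x - g' x))"
  using D12_grad_L2(2)[OF N D12_grad_diff[OF assms]] by (simp add: Lp_dist_def)

text \<open>The factor 2 comes from the crude triangle inequality in L2, which bounds the squared
  Dirichlet norms of the approximants by 4 (d + E). The constant belongs to the p-th power of the
  norm.\<close>

definition sobolev_const :: "'a::euclidean_space itself \<Rightarrow> real" where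
  "sobolev_const _ = (2 * gns_const TYPE('a)) powr pstar TYPE('a)"

text \<open>The inequality for test functions, applied to the approximants, passes to f by Fatou's
  lemma along an almost everywhere convergent subsequence; then d tends to 0.\<close>

lemma D12_grad_Sobolev:
  fixes f :: "'a::euclidean_space \<Rightarrow> real"
  assumes N: "DIM('a) \<ge> 3" and fg: "D12_grad f g"
  shows "Lp_dist (pstar TYPE('a)) f (\<lambda>x. 0)
    \<le> ennreal (sobolev_const TYPE('a) * L2sq g powr (pstar TYPE('a) / 2))"
proof -
  define p where "p = pstar TYPE('a)"
  have p: "p > 0" using pstar_gt_2[OF N] by (simp add: p_def)
  define c where "c = gns_const TYPE('a)"
  have c: "c > 0" using N by (auto simp: c_def gns_const_def)
  define E where "E = L2sq g"
  have E: "E \<ge> 0" by (simp add: E_def L2sq_nonneg)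
  obtain u where u: "\<And>n. u n \<in> Cc_infty" "(\<lambda>n. Lp_dist 2 (grad (u n)) g) \<longlonglongrightarrow> 0"
    "(\<lambda>n. Lp_dist p (u n) f) \<longlonglongrightarrow> 0" using D12_gradE[OF fg] unfolding p_def by metis
  note [measurable] = Cc_infty_borel[OF u(1)] D12_gradD[OF fg]
  obtain r where r: "strict_mono r" "AE x in lborel. (\<lambda>k. u (r k) x) \<longlonglongrightarrow> f x"
    using Lp_dist_AE_subseq[OF p _ _ u(3)] by auto
  have bound: "Lp_dist p f (\<lambda>x. 0) \<le> ennreal ((c * sqrt (4 * (d + E))) powr p)" if d: "d > 0" for d
  proof (rule Lp_dist_Fatou[OF p _ _ _ r(2)])
    have "\<forall>\<^sub>F n in sequentially. Lp_dist 2 (grad (u n)) g < ennreal d" using u(2) d by (intro order_tendstoD) auto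
    then have "\<forall>\<^sub>F k in sequentially. Lp_dist 2 (grad (u (r k))) g < ennreal d"
      using r(1) by (rule eventually_subseq[rotated])
    then show "\<forall>\<^sub>F k in sequentially. Lp_dist p (u (r k)) (\<lambda>x. 0) \<le> ennreal ((c * sqrt (4 * (d + E))) powr p)"
    proof eventually_elim
      case (elim k)
      have "ennreal ((grad_norm (u (r k)))\<^sup>2) = Lp_dist 2 (grad (u (r k))) (\<lambda>x. 0)"
        using nn_integral_grad_norm[OF u(1)] by (simp add: Lp_dist_2)
      also have "\<dots> \<le> ennreal (2 powr 2) * (Lp_dist 2 (grad (u (r k))) g + Lp_dist 2 g (\<lambda>x. 0))"
        by (intro Lp_dist_triangle) auto
      also have "\<dots> \<le> ennreal 4 * (ennreal d + ennreal E)"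
        using elim unfolding D12_grad_L2(2)[OF N fg] E_def by (intro mult_mono add_mono) auto
      also have "\<dots> = ennreal 4 * ennreal (d + E)" using d E by simp
      also have "\<dots> = ennreal (4 * (d + E))" using d E by (intro ennreal_mult[symmetric]) auto
      finally have "(grad_norm (u (r k)))\<^sup>2 \<le> 4 * (d + E)" using d E by (subst (asm) ennreal_le_iff) auto
      then have "grad_norm (u (r k)) \<le> sqrt (4 * (d + E))" by (rule real_le_rsqrt)
      then have "(c * grad_norm (u (r k))) powr p \<le> (c * sqrt (4 * (d + E))) powr p"
        using c p by (intro powr_mono2 mult_left_mono) (auto simp: grad_norm_def)
      then show ?case using GNS_inequality[OF N u(1)[of "r k"]] unfolding Lp_dist_def p_def c_def
        by (auto intro: order_trans ennreal_leI)
    qed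
  qed auto
  have "(\<lambda>n. ennreal ((c * sqrt (4 * (1 / real (Suc n) + E))) powr p)) \<longlonglongrightarrow> ennreal ((c * sqrt (4 * (0 + E))) powr p)"
    using p c E by (intro tendsto_ennrealI tendsto_powr' tendsto_intros LIMSEQ_Suc[OF lim_1_over_n]) auto
  then have "Lp_dist p f (\<lambda>x. 0) \<le> ennreal ((c * sqrt (4 * (0 + E))) powr p)"
    by (rule LIMSEQ_le_const) (intro exI[of _ 0] allI impI bound, simp)
  also have "(c * sqrt (4 * (0 + E))) powr p = (2 * c) powr p * E powr (p / 2)"
    using c E by (simp add: real_sqrt_mult powr_mult powr_half_sqrt[symmetric] powr_powr)
  finally show ?thesis unfolding sobolev_const_def p_def c_def E_def .
qed

text \<open>This closes up a minimizing sequence. By the Sobolev inequality the functions are Cauchy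
  in L^p, and an almost everywhere convergent subsequence identifies their L^p limit with the
  pointwise limit F.\<close>

lemma D12_grad_closed:
  fixes f :: "nat \<Rightarrow> 'a::euclidean_space \<Rightarrow> real"
  assumes N: "DIM('a) \<ge> 3" and fg: "\<And>n. D12_grad (f n) (g n)"
    and cauchy: "\<And>e. e > 0 \<Longrightarrow> \<exists>M. \<forall>m\<ge>M. \<forall>n\<ge>M. L2sq (\<lambda>x. g m x - g n x) < e"
    and lim: "\<And>x. (\<lambda>n. f n x) \<longlonglongrightarrow> F x"
  obtains G where "D12_grad F G" "(\<lambda>n. Lp_dist 2 (g n) G) \<longlonglongrightarrow> 0"
proof -
  define p where "p = pstar TYPE('a)"
  have p: "p > 2" using pstar_gt_2[OF N] by (simp add: p_def)
  define S where "S = sobolev_const TYPE('a)"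
  have S: "S > 0" using N by (auto simp: S_def sobolev_const_def gns_const_def)
  note [measurable] = D12_gradD[OF fg]
  have F [measurable]: "F \<in> borel_measurable borel"
    by (rule borel_measurable_LIMSEQ_metric[OF _ lim]) simp
  have c2: "\<exists>M. \<forall>m\<ge>M. \<forall>n\<ge>M. Lp_dist 2 (g m) (g n) < e" if e0: "e > 0" for e
  proof -
    obtain c where c: "c > 0" "ennreal c < e" using ennreal_dense_real[OF e0] by blast
    obtain M where M: "\<And>m n. m \<ge> M \<Longrightarrow> n \<ge> M \<Longrightarrow> L2sq (\<lambda>x. g m x - g n x) < c" using cauchy[OF c(1)] by blast
    have "Lp_dist 2 (g m) (g n) < e" if "m \<ge> M" "n \<ge> M" for m n
    proof -
      have "Lp_dist 2 (g m) (g n) \<le> ennreal c"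
        unfolding Lp_dist_D12_grad[OF N fg fg] using M[OF that] by (intro ennreal_leI) simp
      then show ?thesis using c by (auto intro: le_less_trans)
    qed
    then show ?thesis by blast
  qed
  have cp: "\<exists>M. \<forall>m\<ge>M. \<forall>n\<ge>M. Lp_dist p (f m) (f n) < e" if e0: "e > 0" for e
  proof -
    obtain c where c: "c > 0" "ennreal c < e" using ennreal_dense_real[OF e0] by blast
    \<comment> \<open>The solution of S d^(p/2) = c.\<close>
    define d where "d = (c / S) powr (2 / p)"
    have d: "d > 0" using c S by (simp add: d_def)
    obtain M where M: "\<And>m n. m \<ge> M \<Longrightarrow> n \<ge> M \<Longrightarrow> L2sq (\<lambda>x. g m x - g n x) < d" using cauchy[OF d] by blast
    have "Lp_dist p (f m) (f n) < e" if "m \<ge> M" "n \<ge> M" for m n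
    proof -
      have "Lp_dist p (f m) (f n) \<le> ennreal (S * L2sq (\<lambda>x. g m x - g n x) powr (p / 2))"
        using D12_grad_Sobolev[OF N D12_grad_diff[OF N fg fg], of m n] unfolding p_def S_def by (simp add: Lp_dist_def)
      also have "L2sq (\<lambda>x. g m x - g n x) powr (p / 2) \<le> d powr (p / 2)"
        using M[OF that] p by (intro powr_mono2) (auto simp: L2sq_nonneg)
      also have "d powr (p / 2) = c / S" using c S p by (simp add: d_def powr_powr)
      finally show ?thesis using c S by (auto intro: le_less_trans simp: ennreal_leI)
    qed
    then show ?thesis by blast
  qed
  obtain G where G [measurable]: "G \<in> borel_measurable borel" and G0: "(\<lambda>n. Lp_dist 2 (g n) G) \<longlonglongrightarrow> 0"
    using Lp_dist_complete[OF _ _ c2] by auto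
  obtain F' where F' [measurable]: "F' \<in> borel_measurable borel" and F'0: "(\<lambda>n. Lp_dist p (f n) F') \<longlonglongrightarrow> 0"
    using Lp_dist_complete[OF _ _ cp] p by auto
  have "AE x in lborel. F' x = F x"
  proof -
    have p0: "p > 0" using p by simp
    obtain r where r: "strict_mono r" "AE x in lborel. (\<lambda>k. f (r k) x) \<longlonglongrightarrow> F' x"
      using Lp_dist_AE_subseq[OF p0 _ _ F'0] by auto
    have sub: "(\<lambda>k. f (r k) x) \<longlonglongrightarrow> F x" for x
      using LIMSEQ_subseq_LIMSEQ[OF lim[of x] r(1)] by (simp add: comp_def)
    show ?thesis using r(2)
    proof eventually_elim
      case (elim x)
      then show ?case using sub[of x] by (rule LIMSEQ_unique)
    qed
  qed
  then have F0: "(\<lambda>n. Lp_dist p (f n) F) \<longlonglongrightarrow> 0"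
    using F'0 by (simp add: Lp_dist_cong_AE[OF AE_I2[OF refl], where g=F' and g'=F])
  \<comment> \<open>A diagonal choice: \<open>D12_grad F G\<close> asks for test functions, so each
    pair \<open>f n\<close>, \<open>g n\<close> is replaced by a test function within 1/(n+1) of it
    in both distances.\<close>
  have "\<exists>u\<in>Cc_infty. Lp_dist 2 (grad u) (g n) < ennreal (1 / real (Suc n)) \<and> Lp_dist p u (f n) < ennreal (1 / real (Suc n))" for n
  proof -
    obtain u where u: "\<And>n. u n \<in> Cc_infty" "(\<lambda>k. Lp_dist 2 (grad (u k)) (g n)) \<longlonglongrightarrow> 0"
      "(\<lambda>k. Lp_dist p (u k) (f n)) \<longlonglongrightarrow> 0" using D12_gradE[OF fg[of n]] unfolding p_def by metis
    have "\<forall>\<^sub>F k in sequentially. Lp_dist 2 (grad (u k)) (g n) < ennreal (1 / real (Suc n))"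
      by (rule order_tendstoD(2)[OF u(2)]) simp
    moreover have "\<forall>\<^sub>F k in sequentially. Lp_dist p (u k) (f n) < ennreal (1 / real (Suc n))"
      by (rule order_tendstoD(2)[OF u(3)]) simp
    ultimately have "\<forall>\<^sub>F k in sequentially. Lp_dist 2 (grad (u k)) (g n) < ennreal (1 / real (Suc n)) \<and> Lp_dist p (u k) (f n) < ennreal (1 / real (Suc n))"
      by eventually_elim auto
    then show ?thesis using u(1) eventually_happens trivial_limit_sequentially by blast
  qed
  then obtain v where v: "\<And>n. v n \<in> Cc_infty" "\<And>n. Lp_dist 2 (grad (v n)) (g n) < ennreal (1 / real (Suc n))"
    "\<And>n. Lp_dist p (v n) (f n) < ennreal (1 / real (Suc n))" by metis
  note [measurable] = Cc_infty_borel[OF v(1)]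
  have lim0: "(\<lambda>n. ennreal c * (ennreal (1 / real (Suc n)) + y n)) \<longlonglongrightarrow> 0" if "y \<longlonglongrightarrow> 0" for c y
  proof -
    have "(\<lambda>n. ennreal (1 / real (Suc n))) \<longlonglongrightarrow> ennreal 0"
      by (intro tendsto_ennrealI LIMSEQ_Suc[OF lim_1_over_n])
    with that have "(\<lambda>n. ennreal c * (ennreal (1 / real (Suc n)) + y n)) \<longlonglongrightarrow> ennreal c * (ennreal 0 + 0)"
      by (intro ennreal_tendsto_cmult tendsto_add) auto
    then show ?thesis by simp
  qed
  have "(\<lambda>n. Lp_dist 2 (grad (v n)) G) \<longlonglongrightarrow> 0"
  proof (rule tendsto_sandwich[OF _ _ tendsto_const lim0[OF G0]])
    have "Lp_dist 2 (grad (v n)) G \<le> ennreal (2 powr 2) * (ennreal (1 / real (Suc n)) + Lp_dist 2 (g n) G)" for n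
    proof -
      have "Lp_dist 2 (grad (v n)) G \<le> ennreal (2 powr 2) * (Lp_dist 2 (grad (v n)) (g n) + Lp_dist 2 (g n) G)"
        by (rule Lp_dist_triangle) auto
      also have "\<dots> \<le> ennreal (2 powr 2) * (ennreal (1 / real (Suc n)) + Lp_dist 2 (g n) G)"
        by (intro mult_left_mono add_mono less_imp_le[OF v(2)] order_refl) simp
      finally show ?thesis .
    qed
    then show "\<forall>\<^sub>F n in sequentially. Lp_dist 2 (grad (v n)) G \<le> ennreal (2 powr 2) * (ennreal (1 / real (Suc n)) + Lp_dist 2 (g n) G)"
      by (intro always_eventually allI)
  qed auto
  moreover have "(\<lambda>n. Lp_dist p (v n) F) \<longlonglongrightarrow> 0"
  proof (rule tendsto_sandwich[OF _ _ tendsto_const lim0[OF F0]])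
    have "Lp_dist p (v n) F \<le> ennreal (2 powr p) * (ennreal (1 / real (Suc n)) + Lp_dist p (f n) F)" for n
    proof -
      have "Lp_dist p (v n) F \<le> ennreal (2 powr p) * (Lp_dist p (v n) (f n) + Lp_dist p (f n) F)"
        using p by (intro Lp_dist_triangle) auto
      also have "\<dots> \<le> ennreal (2 powr p) * (ennreal (1 / real (Suc n)) + Lp_dist p (f n) F)"
        by (intro mult_left_mono add_mono less_imp_le[OF v(3)] order_refl) simp
      finally show ?thesis .
    qed
    then show "\<forall>\<^sub>F n in sequentially. Lp_dist p (v n) F \<le> ennreal (2 powr p) * (ennreal (1 / real (Suc n)) + Lp_dist p (f n) F)"
      by (intro always_eventually allI)
  qed auto
  ultimately have "D12_grad F G" unfolding D12_grad_def using v(1) p_def F G by auto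
  with G0 that show thesis by blast
qed

section \<open>Composition with smooth functions of slope at most 1\<close>

lemma real_smooth_continuous:
  assumes "real_smooth h" shows "continuous_on S h"
proof -
  obtain h' where "\<And>t. (h has_real_derivative h' t) (at t)" using real_smoothD[OF assms] by blast
  then show ?thesis by (meson DERIV_isCont continuous_at_imp_continuous_on)
qed

lemma nonexpansive_if_deriv_le_1:
  fixes h :: "real \<Rightarrow> real"
  assumes "\<And>t. (h has_real_derivative h' t) (at t)" "\<And>t. \<bar>h' t\<bar> \<le> 1"
  shows "\<bar>h s - h t\<bar> \<le> \<bar>s - t\<bar>"
  using field_differentiable_bound[of UNIV h h' 1 s t] assms by simp

lemma Lp_dist_mono:
  assumes "q \<ge> 0" "\<And>x. norm (f x - g x) \<le> norm (f' x - g' x)"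
  shows "Lp_dist q f g \<le> Lp_dist q f' g'"
  unfolding Lp_dist_def using assms by (intro nn_integral_mono ennreal_leI powr_mono2) auto

text \<open>The gradient error splits into h'(v_n)(grad v_n - g), which is small in L2 because |h'|
  <= 1, and (h'(v_n) - h'(f)) g, which tends to 0 by dominated convergence. The second part asks for
  pointwise convergence, hence the subsequence v.\<close>

lemma D12_grad_chain:
  fixes f :: "'a::euclidean_space \<Rightarrow> real"
  assumes N: "DIM('a) \<ge> 3" and fg: "D12_grad f g"
    and h: "real_smooth h" "h 0 = 0" and h': "\<And>t. (h has_real_derivative h' t) (at t)"
    and le: "\<And>t. \<bar>h' t\<bar> \<le> 1"
  shows "D12_grad (\<lambda>x. h (f x)) (\<lambda>x. h' (f x) *\<^sub>R g x)"
proof -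
  define p where "p = pstar TYPE('a)"
  have p: "p > 0" using pstar_gt_2[OF N] by (simp add: p_def)
  obtain u where u: "\<And>n. u n \<in> Cc_infty" "(\<lambda>n. Lp_dist 2 (grad (u n)) g) \<longlonglongrightarrow> 0"
    "(\<lambda>n. Lp_dist p (u n) f) \<longlonglongrightarrow> 0" using D12_gradE[OF fg] unfolding p_def by metis
  note [measurable] = Cc_infty_borel[OF u(1)] D12_gradD[OF fg]
  obtain r where r: "strict_mono r" "AE x in lborel. (\<lambda>k. u (r k) x) \<longlonglongrightarrow> f x"
    using Lp_dist_AE_subseq[OF p _ _ u(3)] by auto
  define v where "v k = u (r k)" for k
  have v: "v k \<in> Cc_infty" for k by (simp add: v_def u)
  note [measurable] = Cc_infty_borel[OF v]
  have v2: "(\<lambda>n. Lp_dist 2 (grad (v n)) g) \<longlonglongrightarrow> 0" and vp: "(\<lambda>n. Lp_dist p (v n) f) \<longlonglongrightarrow> 0"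
    using LIMSEQ_subseq_LIMSEQ[OF u(2) r(1)] LIMSEQ_subseq_LIMSEQ[OF u(3) r(1)] by (auto simp: comp_def v_def)
  have sh': "real_smooth h'" by (rule real_smooth_deriv[OF h(1) h'])
  have [measurable]: "h \<in> borel_measurable borel" "h' \<in> borel_measurable borel"
    using real_smooth_continuous[OF h(1)] real_smooth_continuous[OF sh'] by (auto intro: borel_measurable_continuous_onI)
  have w: "(\<lambda>x. h (v n x)) \<in> Cc_infty" for n by (rule Cc_infty_compose[OF h v])
  have gw: "grad (\<lambda>x. h (v n x)) = (\<lambda>x. h' (v n x) *\<^sub>R grad (v n) x)" for n
    using grad_compose[OF v h'] by auto
  have "(\<lambda>n. Lp_dist p (\<lambda>x. h (v n x)) (\<lambda>x. h (f x))) \<longlonglongrightarrow> 0"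
  proof (rule tendsto_sandwich[OF _ _ tendsto_const vp])
    show "\<forall>\<^sub>F n in sequentially. Lp_dist p (\<lambda>x. h (v n x)) (\<lambda>x. h (f x)) \<le> Lp_dist p (v n) f"
      using p nonexpansive_if_deriv_le_1[OF h' le] by (intro always_eventually allI Lp_dist_mono) auto
  qed auto
  moreover have "(\<lambda>n. Lp_dist 2 (grad (\<lambda>x. h (v n x))) (\<lambda>x. h' (f x) *\<^sub>R g x)) \<longlonglongrightarrow> 0"
  proof -
    have gfin: "(\<integral>\<^sup>+x. ennreal ((2 * norm (g x))\<^sup>2) \<partial>lborel) < \<infinity>"
    proof -
      have "(\<integral>\<^sup>+x. ennreal ((2 * norm (g x))\<^sup>2) \<partial>lborel) = ennreal 4 * Lp_dist 2 g (\<lambda>x. 0)"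
        unfolding Lp_dist_2 by (simp add: nn_integral_cmult[symmetric] power_mult_distrib ennreal_mult)
      then show ?thesis using D12_grad_finite(1)[OF N fg] by (simp add: ennreal_mult_less_top)
    qed
    have D0: "(\<lambda>n. Lp_dist 2 (\<lambda>x. h' (v n x) *\<^sub>R g x) (\<lambda>x. h' (f x) *\<^sub>R g x)) \<longlonglongrightarrow> (\<integral>\<^sup>+(x::'a). 0 \<partial>lborel)"
      unfolding Lp_dist_2
    proof (rule nn_integral_dominated_convergence)
      show "AE x in lborel. ennreal ((norm (h' (v n x) *\<^sub>R g x - h' (f x) *\<^sub>R g x))\<^sup>2) \<le> ennreal ((2 * norm (g x))\<^sup>2)" for n
      proof (intro AE_I2 ennreal_leI power_mono)
        fix x
        have "norm (h' (v n x) *\<^sub>R g x - h' (f x) *\<^sub>R g x) = \<bar>h' (v n x) - h' (f x)\<bar> * norm (g x)"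
          by (simp add: scaleR_diff_left[symmetric])
        also have "\<dots> \<le> 2 * norm (g x)"
          using le[of "v n x"] le[of "f x"] by (intro mult_right_mono) auto
        finally show "norm (h' (v n x) *\<^sub>R g x - h' (f x) *\<^sub>R g x) \<le> 2 * norm (g x)" .
      qed auto
      show "AE x in lborel. (\<lambda>n. ennreal ((norm (h' (v n x) *\<^sub>R g x - h' (f x) *\<^sub>R g x))\<^sup>2)) \<longlonglongrightarrow> 0"
        using r(2)
      proof eventually_elim
        case (elim x)
        have "isCont h' (f x)" using real_smooth_continuous[OF sh', of UNIV] by (simp add: continuous_on_eq_continuous_at)
        then have "(\<lambda>n. h' (v n x)) \<longlonglongrightarrow> h' (f x)"
          using elim unfolding v_def by (rule isCont_tendsto_compose)
        then have "(\<lambda>n. ennreal ((norm (h' (v n x) *\<^sub>R g x - h' (f x) *\<^sub>R g x))\<^sup>2)) \<longlonglongrightarrow> ennreal ((norm (h' (f x) *\<^sub>R g x - h' (f x) *\<^sub>R g x))\<^sup>2)"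
          by (intro tendsto_ennrealI tendsto_intros)
        then show ?case by simp
      qed
    qed (use gfin in auto)
    have bd: "Lp_dist 2 (grad (\<lambda>x. h (v n x))) (\<lambda>x. h' (f x) *\<^sub>R g x)
      \<le> ennreal (2 powr 2) * (Lp_dist 2 (grad (v n)) g + Lp_dist 2 (\<lambda>x. h' (v n x) *\<^sub>R g x) (\<lambda>x. h' (f x) *\<^sub>R g x))" for n
    proof -
      have "Lp_dist 2 (grad (\<lambda>x. h (v n x))) (\<lambda>x. h' (f x) *\<^sub>R g x)
        \<le> ennreal (2 powr 2) * (Lp_dist 2 (grad (\<lambda>x. h (v n x))) (\<lambda>x. h' (v n x) *\<^sub>R g x)
           + Lp_dist 2 (\<lambda>x. h' (v n x) *\<^sub>R g x) (\<lambda>x. h' (f x) *\<^sub>R g x))"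
        unfolding gw by (intro Lp_dist_triangle) auto
      moreover have "Lp_dist 2 (grad (\<lambda>x. h (v n x))) (\<lambda>x. h' (v n x) *\<^sub>R g x) \<le> Lp_dist 2 (grad (v n)) g"
        unfolding gw
      proof (rule Lp_dist_mono)
        fix x
        show "norm (h' (v n x) *\<^sub>R grad (v n) x - h' (v n x) *\<^sub>R g x) \<le> norm (grad (v n) x - g x)"
          using mult_right_mono[OF le[of "v n x"], of "norm (grad (v n) x - g x)"]
          by (simp add: scaleR_diff_right[symmetric])
      qed simp
      ultimately show ?thesis by (elim order_trans) (intro mult_left_mono add_mono; simp)
    qed
    have "(\<lambda>n. ennreal (2 powr 2) * (Lp_dist 2 (grad (v n)) g + Lp_dist 2 (\<lambda>x. h' (v n x) *\<^sub>R g x) (\<lambda>x. h' (f x) *\<^sub>R g x)))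
       \<longlonglongrightarrow> ennreal (2 powr 2) * (0 + 0)"
      using v2 D0 by (intro ennreal_tendsto_cmult tendsto_add) auto
    then have lim: "(\<lambda>n. ennreal (2 powr 2) * (Lp_dist 2 (grad (v n)) g + Lp_dist 2 (\<lambda>x. h' (v n x) *\<^sub>R g x) (\<lambda>x. h' (f x) *\<^sub>R g x)))
       \<longlonglongrightarrow> 0" by simp
    show ?thesis by (rule tendsto_sandwich[OF _ _ tendsto_const lim]) (simp, rule always_eventually, rule allI, rule bd)
  qed
  ultimately show ?thesis unfolding D12_grad_def p_def using w
    by (intro conjI exI[of _ "\<lambda>n x. h (v n x)"]) auto
qed

section \<open>Lipschitz representatives\<close>

lemma Cc_infty_increment_le:
  fixes u :: "'a::euclidean_space \<Rightarrow> real"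
  assumes u: "u \<in> Cc_infty"
  shows "ennreal \<bar>u (v + y) - u y\<bar>
    \<le> (\<integral>\<^sup>+t. ennreal (indicator {0..1} t * (norm v * norm (grad u (t *\<^sub>R v + y)))) \<partial>lborel)"
proof -
  define F where "F t = norm v * norm (grad u (t *\<^sub>R v + y))" for t
  define D where "D t = v \<bullet> grad u (t *\<^sub>R v + y)" for t
  have contF: "continuous_on S F" for S unfolding F_def
    by (intro continuous_intros continuous_on_compose2[OF Cc_infty_grad_continuous[OF u]]) auto
  have der: "((\<lambda>t. u (t *\<^sub>R v + y)) has_real_derivative D t) (at t)" for t
  proof -
    have "((\<lambda>t. t *\<^sub>R v + y) has_derivative (\<lambda>s. s *\<^sub>R v)) (at t)"
      by (auto intro!: derivative_eq_intros)
    from has_derivative_compose[OF this Cc_infty_has_derivative[OF u]] show ?thesis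
      by (simp add: has_field_derivative_def mult.commute[of _ "v \<bullet> _"] D_def)
  qed
  have DF: "norm (D t) \<le> F t" for t
    using Cauchy_Schwarz_ineq2[of v "grad u (t *\<^sub>R v + y)"] by (simp add: D_def F_def)
  have "ennreal \<bar>u (1 *\<^sub>R v + y) - u (0 *\<^sub>R v + y)\<bar> \<le> (\<integral>\<^sup>+t. ennreal (indicator {0..1} t * F t) \<partial>lborel)"
    by (rule increment_le_nn_integral[OF _ der _ contF]) (use DF in auto)
  then show ?thesis by (simp add: F_def)
qed

lemma AE_translate_lborel:
  fixes c :: "'a::euclidean_space"
  assumes "AE x in lborel. P x" shows "AE x in lborel. P (c + x)"
proof -
  have "AE x in distr lborel borel ((+) c). P x" using assms by (subst lborel_distr_plus)
  then show ?thesis by (rule AE_distrD[rotated]) simp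
qed

text \<open>The gradients of the approximants are controlled only in the mean, so increments are
  integrated over a ball. Fubini and translation invariance bound the integral of |grad u_n| over
  each translated ball by that of 1 + |grad u_n - g|, and the error vanishes in the limit.\<close>

lemma ball_increment_le:
  fixes f :: "'a::euclidean_space \<Rightarrow> real"
  assumes N: "DIM('a) \<ge> 3" and fg: "D12_grad f g" and g1: "AE x in lborel. norm (g x) \<le> 1"
  shows "(\<integral>\<^sup>+y. ennreal (indicator (cball c r) y * \<bar>f (v + y) - f y\<bar>) \<partial>lborel)
    \<le> ennreal (norm v) * emeasure lborel (cball c r)"
proof -
  define p where "p = pstar TYPE('a)"
  have p: "p > 0" using pstar_gt_2[OF N] by (simp add: p_def)
  obtain u where u: "\<And>n. u n \<in> Cc_infty" "(\<lambda>n. Lp_dist 2 (grad (u n)) g) \<longlonglongrightarrow> 0"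
    "(\<lambda>n. Lp_dist p (u n) f) \<longlonglongrightarrow> 0" using D12_gradE[OF fg] unfolding p_def by metis
  note [measurable] = Cc_infty_borel[OF u(1)] D12_gradD[OF fg]
  obtain s where s: "strict_mono s" "AE x in lborel. (\<lambda>k. u (s k) x) \<longlonglongrightarrow> f x"
    using Lp_dist_AE_subseq[OF p _ _ u(3)] by auto
  define B where "B = cball c r"
  \<comment> \<open>Enlarged by \<open>norm v\<close> to contain t v + y for all y in B and 0 <= t
    <= 1, so that one error term \<open>e n\<close> serves every t.\<close>
  define B' where "B' = cball c (r + norm v)"
  have [measurable]: "B \<in> sets borel" "B' \<in> sets borel" by (auto simp: B_def B'_def)
  define e where "e n = (\<integral>\<^sup>+x. ennreal (indicator B' x * norm (grad (u n) x - g x)) \<partial>lborel)" for n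
  have e0: "e \<longlonglongrightarrow> 0" unfolding e_def B'_def using emeasure_lborel_cball_finite
    by (intro Lp_dist_loc_L1_tendsto[OF _ _ _ _ _ u(2)]) auto
  have main: "(\<integral>\<^sup>+y. ennreal (indicator B y * \<bar>u n (v + y) - u n y\<bar>) \<partial>lborel)
    \<le> ennreal (norm v) * (emeasure lborel B + e n)" for n
  proof -
    have slice: "(\<integral>\<^sup>+y. ennreal (indicator B y * norm (grad (u n) (t *\<^sub>R v + y))) \<partial>lborel) \<le> emeasure lborel B + e n"
      if t: "0 \<le> t" "t \<le> 1" for t
    proof -
      have "(\<integral>\<^sup>+y. ennreal (indicator B y * norm (grad (u n) (t *\<^sub>R v + y))) \<partial>lborel)
        \<le> (\<integral>\<^sup>+y. indicator B y + ennreal (indicator B' (t *\<^sub>R v + y) * norm (grad (u n) (t *\<^sub>R v + y) - g (t *\<^sub>R v + y))) \<partial>lborel)"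
      proof (rule nn_integral_mono_AE)
        show "AE y in lborel. ennreal (indicator B y * norm (grad (u n) (t *\<^sub>R v + y)))
          \<le> indicator B y + ennreal (indicator B' (t *\<^sub>R v + y) * norm (grad (u n) (t *\<^sub>R v + y) - g (t *\<^sub>R v + y)))"
          using AE_translate_lborel[OF g1, of "t *\<^sub>R v"]
        proof eventually_elim
          case (elim y)
          show ?case
          proof (cases "y \<in> B")
            case True
            have "dist c (t *\<^sub>R v + y) \<le> dist c y + norm (t *\<^sub>R v)"
              using dist_triangle[of c "t *\<^sub>R v + y" y] by (simp add: dist_norm)
            also have "norm (t *\<^sub>R v) \<le> 1 * norm v" using t by (simp add: mult_left_le_one_le)
            finally have "t *\<^sub>R v + y \<in> B'" using True by (simp add: B_def B'_def)
            moreover have "norm (grad (u n) (t *\<^sub>R v + y)) \<le> 1 + norm (grad (u n) (t *\<^sub>R v + y) - g (t *\<^sub>R v + y))"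
              using elim norm_triangle_ineq2[of "grad (u n) (t *\<^sub>R v + y)" "g (t *\<^sub>R v + y)"] by linarith
            ultimately show ?thesis using True
              by (simp add: ennreal_leI flip: ennreal_1 ennreal_plus)
          qed simp
        qed
      qed
      also have "\<dots> = emeasure lborel B + (\<integral>\<^sup>+y. ennreal (indicator B' (t *\<^sub>R v + y) * norm (grad (u n) (t *\<^sub>R v + y) - g (t *\<^sub>R v + y))) \<partial>lborel)"
        by (subst nn_integral_add) auto
      also have "(\<integral>\<^sup>+y. ennreal (indicator B' (t *\<^sub>R v + y) * norm (grad (u n) (t *\<^sub>R v + y) - g (t *\<^sub>R v + y))) \<partial>lborel) = e n"
        unfolding e_def by (rule nn_integral_translate_lborel) measurable
      finally show ?thesis .
    qed
    have "(\<integral>\<^sup>+y. ennreal (indicator B y * \<bar>u n (v + y) - u n y\<bar>) \<partial>lborel)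
      \<le> (\<integral>\<^sup>+y. \<integral>\<^sup>+t. indicator B y * ennreal (indicator {0..1} t * (norm v * norm (grad (u n) (t *\<^sub>R v + y)))) \<partial>lborel \<partial>lborel)"
    proof (rule nn_integral_mono)
      fix y
      have "ennreal (indicator B y * \<bar>u n (v + y) - u n y\<bar>) = indicator B y * ennreal \<bar>u n (v + y) - u n y\<bar>"
        by (simp add: indicator_def)
      also have "\<dots> \<le> indicator B y * (\<integral>\<^sup>+t. ennreal (indicator {0..1} t * (norm v * norm (grad (u n) (t *\<^sub>R v + y)))) \<partial>lborel)"
        by (intro mult_left_mono Cc_infty_increment_le u) simp
      also have "\<dots> = (\<integral>\<^sup>+t. indicator B y * ennreal (indicator {0..1} t * (norm v * norm (grad (u n) (t *\<^sub>R v + y)))) \<partial>lborel)"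
        by (rule nn_integral_cmult[symmetric]) measurable
      finally show "ennreal (indicator B y * \<bar>u n (v + y) - u n y\<bar>) \<le> \<dots>" .
    qed
    also have "\<dots> = (\<integral>\<^sup>+t. \<integral>\<^sup>+y. indicator B y * ennreal (indicator {0..1} t * (norm v * norm (grad (u n) (t *\<^sub>R v + y)))) \<partial>lborel \<partial>lborel)"
      by (rule lborel_pair.Fubini') measurable
    also have "\<dots> \<le> (\<integral>\<^sup>+t. (ennreal (norm v) * (emeasure lborel B + e n)) * indicator {0..1::real} t \<partial>lborel)"
    proof (rule nn_integral_mono)
      fix t :: real
      show "(\<integral>\<^sup>+y. indicator B y * ennreal (indicator {0..1} t * (norm v * norm (grad (u n) (t *\<^sub>R v + y)))) \<partial>lborel)
        \<le> (ennreal (norm v) * (emeasure lborel B + e n)) * indicator {0..1} t"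
      proof (cases "t \<in> {0..1}")
        case True
        have "(\<integral>\<^sup>+y. indicator B y * ennreal (indicator {0..1} t * (norm v * norm (grad (u n) (t *\<^sub>R v + y)))) \<partial>lborel)
          = (\<integral>\<^sup>+y. ennreal (norm v) * ennreal (indicator B y * norm (grad (u n) (t *\<^sub>R v + y))) \<partial>lborel)"
          using True by (intro nn_integral_cong) (auto simp: indicator_def ennreal_mult)
        also have "\<dots> = ennreal (norm v) * (\<integral>\<^sup>+y. ennreal (indicator B y * norm (grad (u n) (t *\<^sub>R v + y))) \<partial>lborel)"
          by (rule nn_integral_cmult) measurable
        also have "\<dots> \<le> ennreal (norm v) * (emeasure lborel B + e n)"
          using True by (intro mult_left_mono slice) auto
        finally show ?thesis using True by simp
      qed simp
    qed
    also have "\<dots> = ennreal (norm v) * (emeasure lborel B + e n)"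
      by (subst nn_integral_cmult_indicator) auto
    finally show ?thesis .
  qed
  have "(\<integral>\<^sup>+y. ennreal (indicator B y * \<bar>f (v + y) - f y\<bar>) \<partial>lborel)
    = (\<integral>\<^sup>+y. liminf (\<lambda>k. ennreal (indicator B y * \<bar>u (s k) (v + y) - u (s k) y\<bar>)) \<partial>lborel)"
  proof (rule nn_integral_cong_AE)
    show "AE y in lborel. ennreal (indicator B y * \<bar>f (v + y) - f y\<bar>)
      = liminf (\<lambda>k. ennreal (indicator B y * \<bar>u (s k) (v + y) - u (s k) y\<bar>))"
      using s(2) AE_translate_lborel[OF s(2), of v]
    proof eventually_elim
      case (elim y)
      then have "(\<lambda>k. ennreal (indicator B y * \<bar>u (s k) (v + y) - u (s k) y\<bar>))
         \<longlonglongrightarrow> ennreal (indicator B y * \<bar>f (v + y) - f y\<bar>)"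
        by (intro tendsto_ennrealI tendsto_intros)
      then show ?case by (intro lim_imp_Liminf[symmetric]) auto
    qed
  qed
  also have "\<dots> \<le> liminf (\<lambda>k. \<integral>\<^sup>+y. ennreal (indicator B y * \<bar>u (s k) (v + y) - u (s k) y\<bar>) \<partial>lborel)"
    by (rule nn_integral_liminf) measurable
  also have "\<dots> \<le> liminf (\<lambda>k. ennreal (norm v) * (emeasure lborel B + e (s k)))"
    by (intro Liminf_mono always_eventually allI main)
  also have "\<dots> = ennreal (norm v) * (emeasure lborel B + 0)"
  proof (intro lim_imp_Liminf ennreal_tendsto_cmult tendsto_add tendsto_const)
    show "(\<lambda>k. e (s k)) \<longlonglongrightarrow> 0" using LIMSEQ_subseq_LIMSEQ[OF e0 s(1)] by (simp add: comp_def)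
  qed auto
  finally show ?thesis unfolding B_def by simp
qed

text \<open>By continuity a violation at x, y persists, with a margin, when both points are
  translated by a small vector; this contradicts the averaged bound on a small ball. So the
  unspecified Lipschitz constant in \<open>XX\<close> can be taken to be 1.\<close>

lemma D12_grad_lipschitz:
  fixes f :: "'a::euclidean_space \<Rightarrow> real"
  assumes N: "DIM('a) \<ge> 3" and fg: "D12_grad f g" and g1: "AE x in lborel. norm (g x) \<le> 1"
    and cont: "continuous_on UNIV f"
  shows "\<bar>f x - f y\<bar> \<le> norm (x - y)"
proof (rule ccontr)
  assume neg: "\<not> ?thesis"
  define v where "v = x - y"
  define D where "D z = \<bar>f (v + z) - f z\<bar>" for z
  have "norm v < D y" using neg by (simp add: v_def D_def)
  then obtain d where d: "norm v < d" "d < D y" using dense by blast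
  have d0: "d > 0" using d norm_ge_zero[of v] by linarith
  have "continuous_on UNIV D" unfolding D_def
    by (intro continuous_intros continuous_on_compose2[OF cont]) auto
  then have "open {z. d < D z}" by (intro open_Collect_less continuous_on_const)
  then obtain r where r: "r > 0" "cball y r \<subseteq> {z. d < D z}"
    using d(2) open_contains_cball by (metis (no_types, lifting) mem_Collect_eq)
  have fin: "emeasure lborel (cball y r) < \<infinity>" by (rule emeasure_lborel_cball_finite)
  have pos: "emeasure lborel (cball y r) > 0"
    using r(1) by (simp add: emeasure_cball zero_less_iff_neq_zero ennreal_eq_0_iff not_le)
  have "ennreal d * emeasure lborel (cball y r) = (\<integral>\<^sup>+z. ennreal d * indicator (cball y r) z \<partial>lborel)"
    by (subst nn_integral_cmult_indicator) auto
  also have "\<dots> \<le> (\<integral>\<^sup>+z. ennreal (indicator (cball y r) z * \<bar>f (v + z) - f z\<bar>) \<partial>lborel)"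
  proof (intro nn_integral_mono)
    fix z
    show "ennreal d * indicator (cball y r) z \<le> ennreal (indicator (cball y r) z * \<bar>f (v + z) - f z\<bar>)"
    proof (cases "z \<in> cball y r")
      case True
      then have "d < D z" using r(2) by blast
      then show ?thesis using True by (simp add: D_def ennreal_leI)
    qed simp
  qed
  also have "\<dots> \<le> ennreal (norm v) * emeasure lborel (cball y r)"
    by (rule ball_increment_le[OF N fg g1])
  finally have "ennreal d * emeasure lborel (cball y r) \<le> ennreal (norm v) * emeasure lborel (cball y r)" .
  moreover obtain m where m: "emeasure lborel (cball y r) = ennreal m" "m > 0"
    using fin pos by (cases "emeasure lborel (cball y r)") auto
  ultimately have "d * m \<le> norm v * m" using d0 by (simp flip: ennreal_mult)
  then show False using m(2) d(1) by simp
qed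

section \<open>The uniform norm is controlled by the Dirichlet norm\<close>

text \<open>With r = |f x|/2, E the squared Dirichlet norm, S the Sobolev constant and V the volume
  of the unit ball, the estimate below reads V r^(p+N) <= S E^(p/2). Solving it for 2r gives this
  exponent of E and the constant \<open>sup_const\<close>.\<close>

definition sup_exp :: "'a::euclidean_space itself \<Rightarrow> real" where
  "sup_exp _ = (pstar TYPE('a) / 2) / (pstar TYPE('a) + real DIM('a))"

definition sup_const :: "'a::euclidean_space itself \<Rightarrow> real" where
  "sup_const _ = 2 * (sobolev_const TYPE('a) / unit_ball_vol (real DIM('a)))
     powr (1 / (pstar TYPE('a) + real DIM('a)))"

lemma sup_exp: "DIM('a::euclidean_space) \<ge> 3 \<Longrightarrow> 0 < sup_exp TYPE('a) \<and> sup_exp TYPE('a) < 1"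
  using pstar_gt_2[where 'a='a] by (simp add: sup_exp_def field_simps)

lemma sup_const_pos: "DIM('a::euclidean_space) \<ge> 3 \<Longrightarrow> sup_const TYPE('a) > 0"
  using less_imp_neq[OF unit_ball_vol_pos[of "real DIM('a)"]]
  by (auto simp: sup_const_def sobolev_const_def gns_const_def)

text \<open>If \<open>\<bar>f x\<bar> = a\<close> then \<open>\<bar>f\<bar> \<ge> a/2\<close> on the ball of radius \<open>a/2\<close> about \<open>x\<close>, so \<open>\<integral>\<bar>f\<bar>\<^sup>p \<ge> c a\<^bsup>p+N\<^esup>\<close>.\<close>

lemma D12_grad_sup_bound:
  fixes f :: "'a::euclidean_space \<Rightarrow> real"
  assumes N: "DIM('a) \<ge> 3" and fg: "D12_grad f g" and lip: "\<And>x y. \<bar>f x - f y\<bar> \<le> norm (x - y)"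
  shows "\<bar>f x\<bar> \<le> sup_const TYPE('a) * L2sq g powr sup_exp TYPE('a)"
proof (cases "f x = 0")
  case True
  then show ?thesis using sup_const_pos[OF N] by simp
next
  case False
  define n where "n = real DIM('a)"
  define p where "p = pstar TYPE('a)"
  have p: "p > 0" using pstar_gt_2[OF N] by (simp add: p_def)
  have n: "n > 0" by (simp add: n_def)
  define S where "S = sobolev_const TYPE('a)"
  have S: "S > 0" using N by (auto simp: S_def sobolev_const_def gns_const_def)
  define V where "V = unit_ball_vol n"
  have V: "V > 0" by (simp add: V_def n_def)
  define r where "r = \<bar>f x\<bar> / 2"
  have r: "r > 0" using False by (simp add: r_def)
  define E where "E = L2sq g"
  have E: "E \<ge> 0" by (simp add: E_def L2sq_nonneg)
  have "ennreal (r powr p) * emeasure lborel (cball x r) = (\<integral>\<^sup>+y. ennreal (r powr p) * indicator (cball x r) y \<partial>lborel)"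
    by (subst nn_integral_cmult_indicator) auto
  also have "\<dots> \<le> Lp_dist p f (\<lambda>x. 0)"
    unfolding Lp_dist_def
  proof (intro nn_integral_mono)
    fix y
    have "r powr p \<le> \<bar>f y\<bar> powr p" if "dist x y \<le> r"
    proof (rule powr_mono2)
      have "\<bar>f x - f y\<bar> \<le> r" using lip[of x y] that by (simp add: dist_norm)
      then show "r \<le> \<bar>f y\<bar>" using r_def by arith
    qed (use p r in auto)
    then show "ennreal (r powr p) * indicator (cball x r) y \<le> ennreal (norm (f y - 0) powr p)"
      by (auto simp: indicator_def intro!: ennreal_leI)
  qed
  also have "\<dots> \<le> ennreal (S * E powr (p / 2))"
    using D12_grad_Sobolev[OF N fg] by (simp add: p_def S_def E_def)
  also have "emeasure lborel (cball x r) = ennreal (V * r ^ DIM('a))"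
    using r by (simp add: emeasure_cball V_def n_def)
  finally have "r powr p * (V * r ^ DIM('a)) \<le> S * E powr (p / 2)"
    using r V S E by (simp flip: ennreal_mult)
  moreover have "r ^ DIM('a) = r powr n" using r by (simp add: n_def powr_realpow)
  ultimately have "r powr (p + n) \<le> (S / V) * E powr (p / 2)"
    using V by (simp add: powr_add field_simps)
  then have "(r powr (p + n)) powr (1 / (p + n)) \<le> ((S / V) * E powr (p / 2)) powr (1 / (p + n))"
    using p n by (intro powr_mono2) auto
  moreover have "((S / V) * E powr (p / 2)) powr (1 / (p + n)) = (S / V) powr (1 / (p + n)) * E powr ((p / 2) / (p + n))"
    using S V by (subst powr_mult) (auto simp: powr_powr)
  ultimately have "r \<le> (S / V) powr (1 / (p + n)) * E powr ((p / 2) / (p + n))"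
    using p n r by (simp add: powr_powr)
  then show ?thesis unfolding sup_const_def sup_exp_def n_def[symmetric] p_def[symmetric] S_def[symmetric] V_def[symmetric] E_def[symmetric]
    by (simp add: r_def field_simps)
qed

section \<open>A smooth truncation\<close>

text \<open>In min t l = t - max (t - l) 0 the maximum is replaced by a log-sum-exp at scale e. The
  last term makes the value at 0 equal to 0, so that compact supports survive composition.\<close>

definition soft_min :: "real \<Rightarrow> real \<Rightarrow> real \<Rightarrow> real" where
  "soft_min e l t = t - e * ln (1 + exp ((t - l) / e)) + e * ln (1 + exp (- l / e))"

definition soft_min_deriv :: "real \<Rightarrow> real \<Rightarrow> real \<Rightarrow> real" where
  "soft_min_deriv e l t = 1 / (1 + exp ((t - l) / e))"

lemma soft_min_DERIV:
  assumes "e > 0"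
  shows "(soft_min e l has_real_derivative soft_min_deriv e l t) (at t)"
proof -
  have pos: "1 + exp ((t - l) / e) > 0" by (simp add: add_pos_pos)
  have "(soft_min e l has_real_derivative 1 - e * ((exp ((t - l) / e) * (1 / e)) / (1 + exp ((t - l) / e))) + 0) (at t)"
    unfolding soft_min_def using pos assms by (auto intro!: derivative_eq_intros)
  moreover have "1 - e * ((exp ((t - l) / e) * (1 / e)) / (1 + exp ((t - l) / e))) + 0 = soft_min_deriv e l t"
  proof -
    have "1 - e * ((X * (1 / e)) / (1 + X)) + 0 = 1 / (1 + X)" if "X > 0" for X
      using that assms by (simp add: divide_simps)
    then show ?thesis unfolding soft_min_deriv_def by (metis exp_gt_zero)
  qed
  ultimately show ?thesis by simp
qed

lemma soft_min_deriv_DERIV: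
  assumes "e > 0"
  shows "(soft_min_deriv e l has_real_derivative ((soft_min_deriv e l t)\<^sup>2 - soft_min_deriv e l t) / e) (at t)"
proof -
  have pos: "1 + exp ((t - l) / e) > 0" by (simp add: add_pos_pos)
  have "(soft_min_deriv e l has_real_derivative - (exp ((t - l) / e) * (1 / e)) / (1 + exp ((t - l) / e))\<^sup>2) (at t)"
    unfolding soft_min_deriv_def using pos assms
    by (auto intro!: derivative_eq_intros simp: power2_eq_square)
  moreover have "- (exp ((t - l) / e) * (1 / e)) / (1 + exp ((t - l) / e))\<^sup>2
      = ((soft_min_deriv e l t)\<^sup>2 - soft_min_deriv e l t) / e"
    using pos assms by (simp add: soft_min_deriv_def divide_simps power2_eq_square)
  ultimately show ?thesis by simp
qed

text \<open>The derivative s is a logistic function with s' = (s^2 - s)/e, so the polynomials in s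
  are closed under differentiation; \<open>[:0, -1, 1:]\<close> is X^2 - X.\<close>

lemma real_smooth_soft_min:
  assumes e: "e > 0" shows "real_smooth (soft_min e l)"
  unfolding real_smooth_def
proof (intro exI conjI)
  let ?S = "insert (soft_min e l) (range (\<lambda>p t. poly p (soft_min_deriv e l t)))"
  show "soft_min e l \<in> ?S" by simp
  show "\<forall>g\<in>?S. \<exists>g'\<in>?S. \<forall>t. (g has_real_derivative g' t) (at t)"
  proof
    fix g assume "g \<in> ?S"
    then consider "g = soft_min e l" | p where "g = (\<lambda>t. poly p (soft_min_deriv e l t))" by auto
    then show "\<exists>g'\<in>?S. \<forall>t. (g has_real_derivative g' t) (at t)"
    proof cases
      case 1
      have "(g has_real_derivative poly [:0, 1:] (soft_min_deriv e l t)) (at t)" for t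
        using soft_min_DERIV[OF e] 1 by simp
      then show ?thesis by (intro bexI[of _ "\<lambda>t. poly [:0, 1:] (soft_min_deriv e l t)"] insertI2 rangeI) auto
    next
      case (2 p)
      have "(g has_real_derivative poly (pderiv p * smult (1 / e) [:0, -1, 1:]) (soft_min_deriv e l t)) (at t)" for t
        using DERIV_chain2[OF poly_DERIV soft_min_deriv_DERIV[OF e], of p l t] e unfolding 2
        by (simp add: power2_eq_square algebra_simps divide_inverse)
      then show ?thesis
        by (intro bexI[of _ "\<lambda>t. poly (pderiv p * smult (1 / e) [:0, -1, 1:]) (soft_min_deriv e l t)"] insertI2 rangeI) auto
    qed
  qed
qed

lemma soft_min_deriv_bounds: "\<bar>soft_min_deriv e l t\<bar> \<le> 1"
proof -
  have "exp ((t - l) / e) > 0" by simp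
  then show ?thesis unfolding soft_min_deriv_def by (auto simp: divide_simps not_less add_pos_pos)
qed

lemma soft_min_0: "soft_min e l 0 = 0"
  by (simp add: soft_min_def)

lemma log_exp_approx:
  assumes e: "e > (0::real)"
  shows "max s 0 \<le> e * ln (1 + exp (s / e))" "e * ln (1 + exp (s / e)) \<le> max s 0 + e * ln 2"
proof -
  have pos: "1 + exp (s / e) > 0" by (simp add: add_pos_pos)
  have "s / e \<le> ln (1 + exp (s / e))" using pos by (simp add: ln_ge_iff)
  moreover have "0 \<le> ln (1 + exp (s / e))" by (simp add: ln_ge_zero)
  ultimately show "max s 0 \<le> e * ln (1 + exp (s / e))" using e by (simp add: field_simps)
  have "1 + exp (s / e) \<le> 2 * exp (max (s / e) 0)" by (simp add: max_def)
  then have "ln (1 + exp (s / e)) \<le> ln (2 * exp (max (s / e) 0))" using pos by (subst ln_le_cancel_iff) auto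
  also have "\<dots> = ln 2 + max (s / e) 0" by (simp add: ln_mult)
  finally have "e * ln (1 + exp (s / e)) \<le> e * (ln 2 + max (s / e) 0)" using e by (intro mult_left_mono) auto
  also have "\<dots> = max s 0 + e * ln 2" using e by (simp add: max_def field_simps)
  finally show "e * ln (1 + exp (s / e)) \<le> max s 0 + e * ln 2" .
qed

text \<open>Two errors of opposite sign, each between 0 and e ln 2: that of the smoothed maximum at
  t - l, and the normalizing term, which is small because l >= 0.\<close>

lemma soft_min_approx:
  assumes e: "e > 0" and l: "l \<ge> 0"
  shows "\<bar>soft_min e l t - min t l\<bar> \<le> e * ln 2"
proof -
  have "t - max (t - l) 0 = min t l" by (simp add: max_def min_def)
  moreover have "max (- l) 0 = 0" using l by simp
  ultimately show ?thesis
    using log_exp_approx[OF e, of "t - l"] log_exp_approx[OF e, of "- l"] unfolding soft_min_def by linarith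
qed

section \<open>The Born--Infeld energy\<close>

definition bi_density :: "'a::euclidean_space \<Rightarrow> real" where
  "bi_density v = 1 - sqrt (1 - (norm v)\<^sup>2)"

definition bi_energy :: "('a::euclidean_space \<Rightarrow> real) \<Rightarrow> real" where
  "bi_energy \<phi> = (\<integral>x. bi_density (weak_grad \<phi> x) \<partial>lborel)"

lemma BI_functional_eq: "BI_functional \<Omega> \<rho> \<phi> = bi_energy \<phi> - pairing \<Omega> \<rho> \<phi>"
  by (simp add: BI_functional_def bi_energy_def bi_density_def)

text \<open>From E/2 <= C E^b with b = \<open>sup_exp\<close> < 1 one gets E^(1-b) <= 2 C. That
  inequality holds wherever the functional is nonpositive, in particular at a minimizer;
  \<open>height_bound\<close> is the resulting bound on the uniform norm.\<close>

definition energy_bound :: "'a::euclidean_space itself \<Rightarrow> real" where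
  "energy_bound _ = (2 * sup_const TYPE('a)) powr (1 / (1 - sup_exp TYPE('a)))"

definition height_bound :: "'a::euclidean_space itself \<Rightarrow> real" where
  "height_bound _ = sup_const TYPE('a) * energy_bound TYPE('a) powr sup_exp TYPE('a)"

text \<open>Bounds the uniform distance of two admissible functions by the squared L2 distance E of
  their gradients. The sup bound is applied to half the difference, whence the factor 2 and the
  quarter.\<close>

definition modulus :: "'a::euclidean_space itself \<Rightarrow> real \<Rightarrow> real" where
  "modulus _ E = 2 * sup_const TYPE('a) * (E / 4) powr sup_exp TYPE('a)"

lemma modulus_0 [simp]: "modulus TYPE('a::euclidean_space) 0 = 0"
  by (simp add: modulus_def)

lemma bi_density_measurable [measurable]: "bi_density \<in> borel_measurable borel"
  unfolding bi_density_def[abs_def] by measurable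

lemma bi_density_0 [simp]: "bi_density 0 = 0"
  by (simp add: bi_density_def)

text \<open>With s = sqrt (1 - |v|^2) the two bounds are (1 - s)^2 >= 0 and s^2 <= s. The lower one
  gives coercivity, the upper one integrability.\<close>

lemma bi_density_bounds:
  assumes "norm v \<le> 1"
  shows "(norm v)\<^sup>2 / 2 \<le> bi_density v" "bi_density v \<le> (norm v)\<^sup>2" "0 \<le> bi_density v"
proof -
  define s where "s = sqrt (1 - (norm v)\<^sup>2)"
  have v1: "(norm v)\<^sup>2 \<le> 1" using assms by (simp add: power_le_one)
  then have s2: "s\<^sup>2 = 1 - (norm v)\<^sup>2" and s: "0 \<le> s" by (auto simp: s_def)
  have s1: "s \<le> 1" by (simp add: s_def)
  have "0 \<le> (1 - s)\<^sup>2" by simp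
  then show "(norm v)\<^sup>2 / 2 \<le> bi_density v"
    unfolding bi_density_def s_def[symmetric] using s2 unfolding power2_diff by simp
  have "s\<^sup>2 \<le> s" using s s1 by (simp add: power2_eq_square mult_left_le)
  then show "bi_density v \<le> (norm v)\<^sup>2" using s2 by (simp add: bi_density_def s_def[symmetric])
  show "0 \<le> bi_density v" using s1 by (simp add: bi_density_def s_def[symmetric])
qed

lemma bi_density_mono: "norm v \<le> norm w \<Longrightarrow> bi_density v \<le> bi_density w"
  by (simp add: bi_density_def power_mono)

text \<open>\<open>W v - \<bar>v\<bar>\<^sup>2/2\<close> is convex on the unit ball; the parallelogram identity gives the gain.\<close>

lemma bi_density_midpoint:
  fixes v w :: "'a::euclidean_space"
  assumes v: "norm v \<le> 1" and w: "norm w \<le> 1"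
  shows "bi_density ((1/2) *\<^sub>R v + (1/2) *\<^sub>R w) \<le> (bi_density v + bi_density w) / 2 - (norm (v - w))\<^sup>2 / 8"
proof -
  define a b d where "a = sqrt (1 - (norm v)\<^sup>2)" and "b = sqrt (1 - (norm w)\<^sup>2)" and "d = (norm (v - w))\<^sup>2 / 4"
  have v1: "(norm v)\<^sup>2 \<le> 1" and w1: "(norm w)\<^sup>2 \<le> 1" using v w by (simp_all add: power_le_one)
  then have a2: "a\<^sup>2 = 1 - (norm v)\<^sup>2" and b2: "b\<^sup>2 = 1 - (norm w)\<^sup>2" and ab: "0 \<le> a" "0 \<le> b"
    by (auto simp: a_def b_def)
  have d0: "d \<ge> 0" by (simp add: d_def)
  have m: "(norm ((1/2) *\<^sub>R v + (1/2) *\<^sub>R w))\<^sup>2 = ((norm v)\<^sup>2 + (norm w)\<^sup>2) / 2 - d"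
    unfolding d_def power2_norm_eq_inner by (simp add: inner_add inner_diff inner_commute field_simps)
  define c where "c = 1 - (norm ((1/2) *\<^sub>R v + (1/2) *\<^sub>R w))\<^sup>2"
  have c: "c = (a\<^sup>2 + b\<^sup>2) / 2 + d" unfolding c_def m a2 b2 by (simp add: field_simps)
  define s where "s = (a + b) / 2"
  have s0: "s \<ge> 0" using ab by (simp add: s_def)
  have ssq: "s\<^sup>2 = (a\<^sup>2 + b\<^sup>2) / 2 - ((a - b) / 2)\<^sup>2"
    by (simp add: s_def power2_eq_square field_simps)
  \<comment> \<open>From s^2 + d <= c <= 1 follows s <= 1 - d/2, hence s + d/4 <= 1. This keeps (s +
    d/2)^2 = s^2 + d (s + d/4) below c, so the gain d/2 comes out of the square root.\<close>
  have c1: "c \<le> 1" unfolding c_def by simp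
  have "s\<^sup>2 \<le> 1 - d" using c c1 ssq zero_le_power2[of "(a - b) / 2"] by linarith
  also have "\<dots> \<le> (1 - d / 2)\<^sup>2" by (simp add: power2_eq_square algebra_simps)
  finally have "s\<^sup>2 \<le> (1 - d / 2)\<^sup>2" .
  moreover have "1 - d / 2 \<ge> 0"
    using \<open>s\<^sup>2 \<le> 1 - d\<close> zero_le_power2[of s] by linarith
  ultimately have sd: "s \<le> 1 - d / 2" using power2_le_imp_le by blast
  have "(s + d / 2)\<^sup>2 \<le> c"
  proof -
    have "d * (s + d / 4) \<le> d * 1" using sd d0 by (intro mult_left_mono) auto
    then have "(s + d / 2)\<^sup>2 \<le> s\<^sup>2 + d" by (simp add: power2_eq_square algebra_simps)
    then show ?thesis using c ssq zero_le_power2[of "(a - b) / 2"] by linarith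
  qed
  then have "s + d / 2 \<le> sqrt c" by (rule real_le_rsqrt)
  then show ?thesis
    unfolding bi_density_def c_def[symmetric] a_def[symmetric] b_def[symmetric] by (simp add: s_def d_def field_simps)
qed

section \<open>Admissible functions: convexity of the energy and uniform bounds\<close>

context
  assumes N: "DIM('a::euclidean_space) \<ge> 3"
begin

lemma XX_D:
  fixes \<phi> :: "'a \<Rightarrow> real"
  assumes "\<phi> \<in> XX"
  shows "D12_grad \<phi> (weak_grad \<phi>)" "AE x in lborel. norm (weak_grad \<phi> x) \<le> 1"
    "continuous_on S \<phi>" "\<bar>\<phi> x - \<phi> y\<bar> \<le> norm (x - y)"
proof -
  show 1: "D12_grad \<phi> (weak_grad \<phi>)" using assms by (intro D12_grad_weak_grad[OF N]) (auto simp: XX_def)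
  show 2: "AE x in lborel. norm (weak_grad \<phi> x) \<le> 1" using assms by (auto simp: XX_def)
  have c: "continuous_on UNIV \<phi>" using assms by (auto simp: XX_def intro: lipschitz_on_continuous_on)
  then show "continuous_on S \<phi>" by (rule continuous_on_subset) simp
  show "\<bar>\<phi> x - \<phi> y\<bar> \<le> norm (x - y)" by (rule D12_grad_lipschitz[OF N 1 2 c])
qed

text \<open>Competitors arrive with a gradient of their own; its bound and continuity already give
  the Lipschitz constant 1.\<close>

lemma XX_I:
  fixes \<phi> :: "'a \<Rightarrow> real"
  assumes g: "D12_grad \<phi> g" "AE x in lborel. norm (g x) \<le> 1" and c: "continuous_on UNIV \<phi>"
  shows "\<phi> \<in> XX"
proof -
  have "1-lipschitz_on UNIV \<phi>"
    using D12_grad_lipschitz[OF N g c] by (intro lipschitz_onI) (auto simp: dist_norm)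
  moreover have "AE x in lborel. norm (weak_grad \<phi> x) \<le> 1"
    using D12_grad_AE_weak_grad[OF N g(1)] g(2) by eventually_elim simp
  ultimately show ?thesis using D12_grad_imp_D12[OF g(1)] by (auto simp: XX_def)
qed

lemma bi_energy_eq:
  fixes \<phi> :: "'a \<Rightarrow> real"
  assumes "D12_grad \<phi> g"
  shows "bi_energy \<phi> = (\<integral>x. bi_density (g x) \<partial>lborel)"
proof -
  note [measurable] = D12_gradD(2)[OF assms] D12_gradD(2)[OF D12_grad_weak_grad[OF N D12_grad_imp_D12[OF assms]]]
  show ?thesis unfolding bi_energy_def
    using D12_grad_AE_weak_grad[OF N assms] by (intro integral_cong_AE) (auto elim: eventually_mono)
qed

lemma integrable_bi_density:
  fixes \<phi> :: "'a \<Rightarrow> real"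
  assumes g: "D12_grad \<phi> g" "AE x in lborel. norm (g x) \<le> 1"
  shows "integrable lborel (\<lambda>x. bi_density (g x))"
proof (rule Bochner_Integration.integrable_bound[OF D12_grad_L2(1)[OF N g(1)]])
  note [measurable] = D12_gradD(2)[OF g(1)]
  show "(\<lambda>x. bi_density (g x)) \<in> borel_measurable lborel" by measurable
  show "AE x in lborel. norm (bi_density (g x)) \<le> norm ((norm (g x))\<^sup>2)"
    using g(2) by eventually_elim (simp add: abs_of_nonneg bi_density_bounds)
qed

lemma bi_energy_ge:
  fixes \<phi> :: "'a \<Rightarrow> real"
  assumes "\<phi> \<in> XX"
  shows "L2sq (weak_grad \<phi>) / 2 \<le> bi_energy \<phi>"
proof -
  have "L2sq (weak_grad \<phi>) / 2 = (\<integral>x. (norm (weak_grad \<phi> x))\<^sup>2 / 2 \<partial>lborel)" by (simp add: L2sq_def)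
  also have "\<dots> \<le> bi_energy \<phi>" unfolding bi_energy_def
  proof (rule integral_mono_AE)
    show "integrable lborel (\<lambda>x. (norm (weak_grad \<phi> x))\<^sup>2 / 2)"
      using D12_grad_L2(1)[OF N XX_D(1)[OF assms]] by simp
    show "integrable lborel (\<lambda>x. bi_density (weak_grad \<phi> x))"
      by (rule integrable_bi_density[OF XX_D(1,2)[OF assms]])
    show "AE x in lborel. (norm (weak_grad \<phi> x))\<^sup>2 / 2 \<le> bi_density (weak_grad \<phi> x)"
      using XX_D(2)[OF assms] by eventually_elim (rule bi_density_bounds)
  qed
  finally show ?thesis .
qed

lemma bi_energy_nonneg: "(\<phi> :: 'a \<Rightarrow> real) \<in> XX \<Longrightarrow> 0 \<le> bi_energy \<phi>"
  using bi_energy_ge[of \<phi>] L2sq_nonneg[of "weak_grad \<phi>"] by linarith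

lemma D12_grad_zero: "D12_grad (\<lambda>x::'a. 0) (\<lambda>x. 0)"
proof -
  have "grad (\<lambda>x::'a. 0::real) = (\<lambda>x. 0)"
    by (rule ext, rule grad_eqI) (rule GDERIV_const)
  then show ?thesis unfolding D12_grad_def
    by (intro conjI exI[of _ "\<lambda>n x. 0"]) (auto simp: Cc_infty_zero)
qed

lemma XX_zero: "(\<lambda>x::'a. 0) \<in> XX" and bi_energy_zero: "bi_energy (\<lambda>x::'a. 0) = 0"
  using XX_I[OF D12_grad_zero] bi_energy_eq[OF D12_grad_zero] by auto

text \<open>The pointwise midpoint inequality, integrated; this is the uniform convexity behind
  existence, uniqueness and stability.\<close>

lemma XX_midpoint:
  fixes \<phi> \<psi> :: "'a \<Rightarrow> real"
  assumes p: "\<phi> \<in> XX" and q: "\<psi> \<in> XX"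
  shows "(\<lambda>x. (1/2) * \<phi> x + (1/2) * \<psi> x) \<in> XX"
    "bi_energy (\<lambda>x. (1/2) * \<phi> x + (1/2) * \<psi> x)
      \<le> (bi_energy \<phi> + bi_energy \<psi>) / 2 - L2sq (\<lambda>x. weak_grad \<phi> x - weak_grad \<psi> x) / 8"
proof -
  let ?g = "\<lambda>x. (1/2) *\<^sub>R weak_grad \<phi> x + (1/2) *\<^sub>R weak_grad \<psi> x"
  let ?d = "\<lambda>x. weak_grad \<phi> x - weak_grad \<psi> x"
  note P = XX_D[OF p] and Q = XX_D[OF q]
  have g: "D12_grad (\<lambda>x. (1/2) * \<phi> x + (1/2) * \<psi> x) ?g"
    by (rule D12_grad_linear[OF N P(1) Q(1)])
  have g1: "AE x in lborel. norm (?g x) \<le> 1"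
    using P(2) Q(2)
  proof eventually_elim
    case (elim x)
    then show ?case using norm_triangle_ineq[of "(1/2) *\<^sub>R weak_grad \<phi> x" "(1/2) *\<^sub>R weak_grad \<psi> x"] by simp
  qed
  show "(\<lambda>x. (1/2) * \<phi> x + (1/2) * \<psi> x) \<in> XX"
    by (rule XX_I[OF g g1]) (intro continuous_intros P(3) Q(3))
  have iP: "integrable lborel (\<lambda>x. bi_density (weak_grad \<phi> x))" by (rule integrable_bi_density[OF P(1,2)])
  have iQ: "integrable lborel (\<lambda>x. bi_density (weak_grad \<psi> x))" by (rule integrable_bi_density[OF Q(1,2)])
  have id: "integrable lborel (\<lambda>x. (norm (?d x))\<^sup>2)" by (rule D12_grad_L2(1)[OF N D12_grad_diff[OF N P(1) Q(1)]])
  have "(\<integral>x. bi_density (?g x) \<partial>lborel)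
    \<le> (\<integral>x. (bi_density (weak_grad \<phi> x) + bi_density (weak_grad \<psi> x)) / 2 - (norm (?d x))\<^sup>2 / 8 \<partial>lborel)"
  proof (rule integral_mono_AE)
    show "AE x in lborel. bi_density (?g x) \<le> (bi_density (weak_grad \<phi> x) + bi_density (weak_grad \<psi> x)) / 2 - (norm (?d x))\<^sup>2 / 8"
      using P(2) Q(2) by eventually_elim (rule bi_density_midpoint)
  qed (use iP iQ id integrable_bi_density[OF g g1] in auto)
  also have "\<dots> = (bi_energy \<phi> + bi_energy \<psi>) / 2 - L2sq ?d / 8"
    unfolding bi_energy_def L2sq_def using iP iQ id by simp
  finally show "bi_energy (\<lambda>x. (1/2) * \<phi> x + (1/2) * \<psi> x) \<le> (bi_energy \<phi> + bi_energy \<psi>) / 2 - L2sq ?d / 8"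
    unfolding bi_energy_eq[OF g] .
qed

lemma XX_sup_bound:
  fixes \<phi> :: "'a \<Rightarrow> real"
  assumes "\<phi> \<in> XX"
  shows "\<bar>\<phi> x\<bar> \<le> sup_const TYPE('a) * L2sq (weak_grad \<phi>) powr sup_exp TYPE('a)"
  by (rule D12_grad_sup_bound[OF N XX_D(1)[OF assms] XX_D(4)[OF assms]])

lemma modulus_mono: "0 \<le> E \<Longrightarrow> E \<le> E' \<Longrightarrow> modulus TYPE('a) E \<le> modulus TYPE('a) E'"
  unfolding modulus_def using sup_exp[OF N] sup_const_pos[OF N]
  by (intro mult_left_mono powr_mono2) auto

lemma modulus_tendsto_0:
  assumes "(e \<longlongrightarrow> 0) F" "\<forall>\<^sub>F x in F. 0 \<le> e x"
  shows "((\<lambda>x. modulus TYPE('a) (e x)) \<longlongrightarrow> 0) F"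
proof -
  have "((\<lambda>x. modulus TYPE('a) (e x)) \<longlongrightarrow> 2 * sup_const TYPE('a) * (0 / 4) powr sup_exp TYPE('a)) F"
    unfolding modulus_def using sup_exp[OF N] assms
    by (intro tendsto_intros tendsto_powr') (auto elim: eventually_mono)
  then show ?thesis by simp
qed

text \<open>Half of the difference of two elements of \<open>XX\<close> is again 1-Lipschitz.\<close>

lemma XX_diff_sup_bound:
  fixes \<phi> \<psi> :: "'a \<Rightarrow> real"
  assumes p: "\<phi> \<in> XX" and q: "\<psi> \<in> XX" and E: "L2sq (\<lambda>x. weak_grad \<phi> x - weak_grad \<psi> x) \<le> E"
  shows "\<bar>\<phi> x - \<psi> x\<bar> \<le> modulus TYPE('a) E"
proof -
  let ?g = "\<lambda>x. (1/2) *\<^sub>R weak_grad \<phi> x + (- 1/2) *\<^sub>R weak_grad \<psi> x"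
  note P = XX_D[OF p] and Q = XX_D[OF q]
  have g: "D12_grad (\<lambda>x. (1/2) * \<phi> x + (- 1/2) * \<psi> x) ?g"
    by (rule D12_grad_linear[OF N P(1) Q(1)])
  have "\<bar>((1/2) * \<phi> x + (- 1/2) * \<psi> x) - ((1/2) * \<phi> y + (- 1/2) * \<psi> y)\<bar> \<le> norm (x - y)" for x y
    using P(4)[of x y] Q(4)[of x y] by linarith
  from D12_grad_sup_bound[OF N g this, of x]
  have bd: "\<bar>(\<phi> x - \<psi> x) / 2\<bar> \<le> sup_const TYPE('a) * L2sq ?g powr sup_exp TYPE('a)"
    by (simp add: diff_divide_distrib)
  have eqg: "L2sq ?g = L2sq (\<lambda>x. weak_grad \<phi> x - weak_grad \<psi> x) / 4"
  proof -
    have e: "(norm (?g x))\<^sup>2 = (norm (weak_grad \<phi> x - weak_grad \<psi> x))\<^sup>2 / 4" for x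
    proof -
      have "?g x = (1/2) *\<^sub>R (weak_grad \<phi> x - weak_grad \<psi> x)" by (simp add: scaleR_diff_right)
      then have "norm (?g x) = norm (weak_grad \<phi> x - weak_grad \<psi> x) / 2" by (simp only: norm_scaleR)
      then show ?thesis by (simp only: power_divide) simp
    qed
    show ?thesis unfolding L2sq_def e by simp
  qed
  have "\<bar>\<phi> x - \<psi> x\<bar> \<le> modulus TYPE('a) (L2sq (\<lambda>x. weak_grad \<phi> x - weak_grad \<psi> x))"
    using bd unfolding eqg modulus_def by (simp add: mult_ac)
  also have "\<dots> \<le> modulus TYPE('a) E" by (intro modulus_mono L2sq_nonneg E)
  finally show ?thesis .
qed

lemma XX_bounded_cont:
  fixes \<phi> :: "'a \<Rightarrow> real"
  assumes "\<phi> \<in> XX"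
  shows "\<phi> \<in> borel_measurable borel" "\<exists>B. \<forall>x. \<bar>\<phi> x\<bar> \<le> B"
  using XX_sup_bound[OF assms] XX_D(3)[OF assms] by (auto intro: borel_measurable_continuous_onI)

end

section \<open>Probability measures on the boundary\<close>

lemma prob_boundaryD:
  assumes "\<rho> \<in> prob_boundary \<Omega>"
  shows "sets \<rho> = sets borel" "space \<rho> = UNIV" "finite_measure \<rho>" "measure \<rho> (frontier \<Omega>) = 1"
    "frontier \<Omega> \<in> sets \<rho>"
proof -
  show s: "sets \<rho> = sets borel" using assms by (simp add: prob_boundary_def)
  then show sp: "space \<rho> = UNIV" by (metis sets_eq_imp_space_eq space_borel)
  show m: "frontier \<Omega> \<in> sets \<rho>" by (simp add: s frontier_closed borel_closed)
  have "emeasure \<rho> (space \<rho>) = emeasure \<rho> (frontier \<Omega> \<union> - frontier \<Omega>)" by (simp add: sp Un_absorb2 Compl_partition)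
  also have "\<dots> \<le> emeasure \<rho> (frontier \<Omega>) + emeasure \<rho> (- frontier \<Omega>)"
    using m s by (intro emeasure_subadditive) (auto simp: borel_comp)
  also have "\<dots> = 1" using assms by (simp add: prob_boundary_def)
  finally have "emeasure \<rho> (space \<rho>) \<le> 1" .
  then show "finite_measure \<rho>" by (intro finite_measureI) (auto simp: top_unique)
  show "measure \<rho> (frontier \<Omega>) = 1" using assms by (simp add: prob_boundary_def measure_def)
qed

lemma pairing_integrable:
  fixes \<phi> :: "'a::euclidean_space \<Rightarrow> real"
  assumes r: "\<rho> \<in> prob_boundary \<Omega>" and "\<phi> \<in> borel_measurable borel" "\<exists>B. \<forall>x. \<bar>\<phi> x\<bar> \<le> B"
  shows "set_integrable \<rho> (frontier \<Omega>) \<phi>"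
proof -
  note R = prob_boundaryD[OF r]
  interpret finite_measure \<rho> by (rule R(3))
  obtain B where B: "\<And>x. \<bar>\<phi> x\<bar> \<le> B" using assms(3) by blast
  have "integrable \<rho> \<phi>"
    using B assms(2) measurable_cong_sets[OF R(1) refl, of borel]
    by (intro integrable_const_bound[of _ B]) auto
  then show ?thesis unfolding set_integrable_def by (intro integrable_mult_indicator R(5))
qed

lemma pairing_const [simp]:
  assumes "\<rho> \<in> prob_boundary \<Omega>" shows "pairing \<Omega> \<rho> (\<lambda>x. c) = c"
  using prob_boundaryD[OF assms] by (simp add: pairing_def set_lebesgue_integral_def)

lemma pairing_linear:
  fixes \<phi> \<psi> :: "'a::euclidean_space \<Rightarrow> real"
  assumes r: "\<rho> \<in> prob_boundary \<Omega>" and "\<phi> \<in> borel_measurable borel" "\<exists>B. \<forall>x. \<bar>\<phi> x\<bar> \<le> B"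
    "\<psi> \<in> borel_measurable borel" "\<exists>B. \<forall>x. \<bar>\<psi> x\<bar> \<le> B"
  shows "pairing \<Omega> \<rho> (\<lambda>x. a * \<phi> x + b * \<psi> x) = a * pairing \<Omega> \<rho> \<phi> + b * pairing \<Omega> \<rho> \<psi>"
  using pairing_integrable[OF r assms(2,3)] pairing_integrable[OF r assms(4,5)]
  unfolding pairing_def by (subst set_integral_add) auto

lemma pairing_le:
  fixes \<phi> \<psi> :: "'a::euclidean_space \<Rightarrow> real"
  assumes r: "\<rho> \<in> prob_boundary \<Omega>" and p: "\<phi> \<in> borel_measurable borel" "\<exists>B. \<forall>x. \<bar>\<phi> x\<bar> \<le> B"
    and q: "\<psi> \<in> borel_measurable borel" "\<exists>B. \<forall>x. \<bar>\<psi> x\<bar> \<le> B"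
    and le: "\<And>x. x \<in> frontier \<Omega> \<Longrightarrow> \<phi> x \<le> \<psi> x + c"
  shows "pairing \<Omega> \<rho> \<phi> \<le> pairing \<Omega> \<rho> \<psi> + c"
proof -
  have "pairing \<Omega> \<rho> \<phi> \<le> pairing \<Omega> \<rho> (\<lambda>x. 1 * \<psi> x + 1 * c)"
    unfolding pairing_def
  proof (rule set_integral_mono)
    show "set_integrable \<rho> (frontier \<Omega>) \<phi>" by (rule pairing_integrable[OF r p])
    have "set_integrable \<rho> (frontier \<Omega>) \<psi>" by (rule pairing_integrable[OF r q])
    moreover have "set_integrable \<rho> (frontier \<Omega>) (\<lambda>x. c)" by (rule pairing_integrable[OF r]) auto
    ultimately show "set_integrable \<rho> (frontier \<Omega>) (\<lambda>x. 1 * \<psi> x + 1 * c)" by simp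
  qed (use le in simp)
  also have "\<dots> = 1 * pairing \<Omega> \<rho> \<psi> + 1 * pairing \<Omega> \<rho> (\<lambda>x. c)"
    by (rule pairing_linear[OF r q]) auto
  finally show ?thesis using r by simp
qed

lemma pairing_diff_le:
  fixes \<phi> \<psi> :: "'a::euclidean_space \<Rightarrow> real"
  assumes "\<rho> \<in> prob_boundary \<Omega>" "\<phi> \<in> borel_measurable borel" "\<exists>B. \<forall>x. \<bar>\<phi> x\<bar> \<le> B"
    "\<psi> \<in> borel_measurable borel" "\<exists>B. \<forall>x. \<bar>\<psi> x\<bar> \<le> B"
    and le: "\<And>x. \<bar>\<phi> x - \<psi> x\<bar> \<le> c"
  shows "\<bar>pairing \<Omega> \<rho> \<phi> - pairing \<Omega> \<rho> \<psi>\<bar> \<le> c"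
proof -
  have "\<phi> x \<le> \<psi> x + c" "\<psi> x \<le> \<phi> x + c" for x using le[of x] by linarith+
  then have "pairing \<Omega> \<rho> \<phi> \<le> pairing \<Omega> \<rho> \<psi> + c" "pairing \<Omega> \<rho> \<psi> \<le> pairing \<Omega> \<rho> \<phi> + c"
    using assms by (auto intro!: pairing_le)
  then show ?thesis by linarith
qed

section \<open>The minimizer\<close>

context
  fixes \<Omega> :: "'a::euclidean_space set" and \<rho> :: "'a measure"
  assumes N: "DIM('a) \<ge> 3" and r: "\<rho> \<in> prob_boundary \<Omega>"
begin

lemma BI_midpoint:
  assumes p: "\<phi> \<in> XX" and q: "\<psi> \<in> XX"
  shows "BI_functional \<Omega> \<rho> (\<lambda>x. (1/2) * \<phi> x + (1/2) * \<psi> x)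
    \<le> (BI_functional \<Omega> \<rho> \<phi> + BI_functional \<Omega> \<rho> \<psi>) / 2 - L2sq (\<lambda>x. weak_grad \<phi> x - weak_grad \<psi> x) / 8"
  using XX_midpoint(2)[OF N p q] pairing_linear[OF r XX_bounded_cont[OF N p] XX_bounded_cont[OF N q], of "1/2" "1/2"]
  unfolding BI_functional_eq by argo

text \<open>The midpoint is a competitor too, so J(phi) <= (J(psi) + J(phi))/2 - L/8, with L the
  left-hand side; solve for L.\<close>

lemma BI_minimizer_stability:
  assumes p: "is_minimizer \<Omega> \<rho> \<phi>" and q: "\<psi> \<in> XX"
  shows "L2sq (\<lambda>x. weak_grad \<psi> x - weak_grad \<phi> x) \<le> 4 * (BI_functional \<Omega> \<rho> \<psi> - BI_functional \<Omega> \<rho> \<phi>)"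
proof -
  have pX: "\<phi> \<in> XX" using p by (simp add: is_minimizer_def)
  have "BI_functional \<Omega> \<rho> \<phi> \<le> BI_functional \<Omega> \<rho> (\<lambda>x. (1/2) * \<psi> x + (1/2) * \<phi> x)"
    using p XX_midpoint(1)[OF N q pX] by (simp add: is_minimizer_def)
  then show ?thesis using BI_midpoint[OF q pX] by argo
qed

lemma BI_minimizer_unique:
  assumes p: "is_minimizer \<Omega> \<rho> \<phi>" and q: "is_minimizer \<Omega> \<rho> \<psi>"
  shows "\<psi> = \<phi>"
proof
  fix x
  have X: "\<phi> \<in> XX" "\<psi> \<in> XX" using p q by (auto simp: is_minimizer_def)
  have "BI_functional \<Omega> \<rho> \<psi> \<le> BI_functional \<Omega> \<rho> \<phi>" using q X by (simp add: is_minimizer_def)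
  then have "L2sq (\<lambda>x. weak_grad \<psi> x - weak_grad \<phi> x) \<le> 0" using BI_minimizer_stability[OF p X(2)] by argo
  from XX_diff_sup_bound[OF N X(2,1) this, of x] show "\<psi> x = \<phi> x" by (simp add: modulus_0)
qed

lemma small_energy:
  assumes E: "E \<ge> 0" and le: "E / 2 \<le> sup_const TYPE('a) * E powr sup_exp TYPE('a)"
  shows "E \<le> energy_bound TYPE('a)"
proof (cases "E = 0")
  case False
  define b where "b = sup_exp TYPE('a)"
  have b: "0 < b" "b < 1" using sup_exp[OF N] by (auto simp: b_def)
  have Ep: "E > 0" using E False by simp
  have "E powr (1 - b) * E powr b = E" using Ep by (simp flip: powr_add)
  also have "E \<le> (2 * sup_const TYPE('a)) * E powr b" using le by (simp add: b_def)
  finally have "E powr (1 - b) \<le> 2 * sup_const TYPE('a)" using Ep by simp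
  then have "(E powr (1 - b)) powr (1 / (1 - b)) \<le> (2 * sup_const TYPE('a)) powr (1 / (1 - b))"
    using b by (intro powr_mono2) auto
  then show ?thesis using b Ep by (simp add: powr_powr energy_bound_def b_def)
qed (simp add: energy_bound_def)

lemma pairing_sup_bound:
  assumes "\<phi> \<in> XX"
  shows "\<bar>pairing \<Omega> \<rho> \<phi>\<bar> \<le> sup_const TYPE('a) * L2sq (weak_grad \<phi>) powr sup_exp TYPE('a)"
  using pairing_diff_le[OF r XX_bounded_cont[OF N assms], of "\<lambda>x. 0"] XX_sup_bound[OF N assms] r by auto

text \<open>Either E/2 <= C E^b, and then E is bounded by \<open>small_energy\<close>, or the lower
  bound E/2 - C E^b of the functional is positive.\<close>

lemma BI_bounded_below:
  assumes "\<phi> \<in> XX"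
  shows "- height_bound TYPE('a) \<le> BI_functional \<Omega> \<rho> \<phi>"
proof -
  let ?E = "L2sq (weak_grad \<phi>)" and ?C = "sup_const TYPE('a)" and ?b = "sup_exp TYPE('a)"
  have C: "?C > 0" by (rule sup_const_pos[OF N])
  have b: "0 < ?b" using sup_exp[OF N] by auto
  have "?E / 2 - ?C * ?E powr ?b \<le> BI_functional \<Omega> \<rho> \<phi>"
    using bi_energy_ge[OF N assms] pairing_sup_bound[OF assms] unfolding BI_functional_eq by linarith
  moreover have "- height_bound TYPE('a) \<le> ?E / 2 - ?C * ?E powr ?b"
  proof (cases "?E / 2 \<le> ?C * ?E powr ?b")
    case True
    then have "?E \<le> energy_bound TYPE('a)" by (intro small_energy L2sq_nonneg)
    then have "?C * ?E powr ?b \<le> height_bound TYPE('a)" unfolding height_bound_def using C b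
      by (intro mult_left_mono powr_mono2) (auto simp: L2sq_nonneg)
    then show ?thesis using L2sq_nonneg[of "weak_grad \<phi>"] by linarith
  next
    case False
    moreover have "height_bound TYPE('a) \<ge> 0" unfolding height_bound_def using C by simp
    ultimately show ?thesis by linarith
  qed
  ultimately show ?thesis by linarith
qed

text \<open>Comparison with the zero function. The bound does not depend on the measure, so it holds
  uniformly for the potentials of all mixtures.\<close>

lemma minimizer_height:
  assumes "is_minimizer \<Omega> \<rho> \<phi>"
  shows "\<bar>\<phi> x\<bar> \<le> height_bound TYPE('a)"
proof -
  let ?E = "L2sq (weak_grad \<phi>)" and ?C = "sup_const TYPE('a)" and ?b = "sup_exp TYPE('a)"
  have X: "\<phi> \<in> XX" using assms by (simp add: is_minimizer_def)
  have "BI_functional \<Omega> \<rho> \<phi> \<le> BI_functional \<Omega> \<rho> (\<lambda>x. 0)"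
    using assms XX_zero[OF N] by (simp add: is_minimizer_def)
  also have "\<dots> = 0" using r by (simp add: BI_functional_eq bi_energy_zero[OF N])
  finally have "?E / 2 \<le> ?C * ?E powr ?b"
    using bi_energy_ge[OF N X] pairing_sup_bound[OF X] unfolding BI_functional_eq by linarith
  then have "?E \<le> energy_bound TYPE('a)" by (intro small_energy L2sq_nonneg)
  then have "?C * ?E powr ?b \<le> height_bound TYPE('a)" unfolding height_bound_def
    using sup_const_pos[OF N] sup_exp[OF N] by (intro mult_left_mono powr_mono2) (auto simp: L2sq_nonneg)
  with XX_sup_bound[OF N X, of x] show ?thesis by linarith
qed

text \<open>The gradients of a minimizing sequence are Cauchy. Uniform convergence handles the
  pairing, and Fatou's lemma the energy.\<close>

lemma minimizer_exists: "\<exists>\<phi>. is_minimizer \<Omega> \<rho> \<phi>"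
proof -
  let ?J = "BI_functional \<Omega> \<rho>"
  define m where "m = Inf (?J ` XX)"
  have bdd: "bdd_below (?J ` XX)" by (rule bdd_belowI2[of _ "- height_bound TYPE('a)"]) (rule BI_bounded_below)
  have ne: "?J ` XX \<noteq> {}" using XX_zero[OF N] by blast
  have mle: "m \<le> ?J \<psi>" if "\<psi> \<in> XX" for \<psi> unfolding m_def using that bdd by (intro cInf_lower) auto
  have "\<exists>\<phi>\<in>XX. ?J \<phi> < m + 1 / real (Suc n)" for n
  proof -
    have "Inf (?J ` XX) < m + 1 / real (Suc n)" by (simp add: m_def)
    then show ?thesis using cInf_less_iff[OF ne bdd] by auto
  qed
  then obtain f where f: "\<And>n. f n \<in> XX" "\<And>n. ?J (f n) < m + 1 / real (Suc n)" by metis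
  define g where "g n = weak_grad (f n)" for n
  have fg: "D12_grad (f n) (g n)" for n unfolding g_def by (rule XX_D(1)[OF N f(1)])
  \<comment> \<open>The midpoint has value at least m, so the gain L/8 is at most the mean of the
    excesses of \<open>f k\<close> and \<open>f n\<close> over m.\<close>
  have diff: "L2sq (\<lambda>x. g k x - g n x) \<le> 4 * (1 / real (Suc k) + 1 / real (Suc n))" for k n
  proof -
    have "m \<le> ?J (\<lambda>x. (1/2) * f k x + (1/2) * f n x)" by (intro mle XX_midpoint N f)
    then show ?thesis using BI_midpoint[OF f(1) f(1), of k n] f(2)[of k] f(2)[of n] unfolding g_def by argo
  qed
  have diffM: "L2sq (\<lambda>x. g k x - g n x) \<le> 8 / real (Suc M)" if "k \<ge> M" "n \<ge> M" for k n M
  proof -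
    have "1 / real (Suc k) \<le> 1 / real (Suc M)" "1 / real (Suc n) \<le> 1 / real (Suc M)"
      using that by (auto intro!: divide_left_mono)
    then show ?thesis using diff[of k n] by simp
  qed
  have lim8: "(\<lambda>M. 8 / real (Suc M)) \<longlonglongrightarrow> 0" by (intro LIMSEQ_Suc lim_const_over_n)
  have cauchy: "\<exists>M. \<forall>k\<ge>M. \<forall>n\<ge>M. L2sq (\<lambda>x. g k x - g n x) < e" if e: "e > 0" for e
  proof -
    obtain M where "8 / real (Suc M) < e"
      using order_tendstoD(2)[OF lim8 e] eventually_happens trivial_limit_sequentially by blast
    then show ?thesis using diffM by (meson le_less_trans)
  qed
  define md where "md M = modulus TYPE('a) (8 / real (Suc M))" for M
  have md0: "md \<longlonglongrightarrow> 0" unfolding md_def by (rule modulus_tendsto_0[OF N lim8]) simp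
  have unif: "\<bar>f k x - f n x\<bar> \<le> md M" if "k \<ge> M" "n \<ge> M" for k n M x
    unfolding md_def using XX_diff_sup_bound[OF N f(1) f(1)] diffM[OF that] unfolding g_def by blast
  have "Cauchy (\<lambda>n. f n x)" for x
  proof (rule metric_CauchyI)
    fix e :: real assume e: "0 < e"
    obtain M where "md M < e"
      using order_tendstoD(2)[OF md0 e] eventually_happens trivial_limit_sequentially by blast
    then show "\<exists>M. \<forall>k\<ge>M. \<forall>n\<ge>M. dist (f k x) (f n x) < e"
      using unif by (metis dist_real_def le_less_trans)
  qed
  then have "\<exists>l. (\<lambda>n. f n x) \<longlonglongrightarrow> l" for x using Cauchy_convergent convergent_def by blast
  then obtain F where F: "\<And>x. (\<lambda>n. f n x) \<longlonglongrightarrow> F x" by metis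
  obtain G where G: "D12_grad F G" "(\<lambda>n. Lp_dist 2 (g n) G) \<longlonglongrightarrow> 0"
    using D12_grad_closed[OF N fg cauchy F] by metis
  note [measurable] = D12_gradD[OF fg] D12_gradD[OF G(1)]
  obtain s where s: "strict_mono s" "AE x in lborel. (\<lambda>k. g (s k) x) \<longlonglongrightarrow> G x"
    using Lp_dist_AE_subseq[OF _ _ _ G(2)] by auto
  have "AE x in lborel. \<forall>n. norm (g n x) \<le> 1"
    unfolding AE_all_countable g_def using XX_D(2)[OF N f(1)] by blast
  then have lims: "AE x in lborel. norm (G x) \<le> 1 \<and> (\<lambda>k. ennreal (bi_density (g (s k) x))) \<longlonglongrightarrow> ennreal (bi_density (G x))"
    using s(2)
  proof eventually_elim
    case (elim x)
    have "norm (G x) \<le> 1" using elim by (intro LIMSEQ_le_const2[OF tendsto_norm]) auto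
    moreover have "(\<lambda>k. ennreal (bi_density (g (s k) x))) \<longlonglongrightarrow> ennreal (bi_density (G x))"
      unfolding bi_density_def by (intro tendsto_ennrealI tendsto_intros elim)
    ultimately show ?case by blast
  qed
  then have G1: "AE x in lborel. norm (G x) \<le> 1" by (auto elim: eventually_mono)
  have Flip: "\<bar>F x - F y\<bar> \<le> norm (x - y)" for x y
  proof (rule LIMSEQ_le_const2)
    show "(\<lambda>n. \<bar>f n x - f n y\<bar>) \<longlonglongrightarrow> \<bar>F x - F y\<bar>" by (intro tendsto_intros F)
    show "\<exists>N. \<forall>n\<ge>N. \<bar>f n x - f n y\<bar> \<le> norm (x - y)" using XX_D(4)[OF N f(1)] by blast
  qed
  have Fc: "continuous_on UNIV F"
    using Flip by (intro lipschitz_on_continuous_on[of 1] lipschitz_onI) (auto simp: dist_norm)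
  have FX: "F \<in> XX" by (rule XX_I[OF N G(1) G1 Fc])
  have "\<bar>f n x - F x\<bar> \<le> md n" for n x
  proof (rule LIMSEQ_le_const2)
    show "(\<lambda>k. \<bar>f n x - f k x\<bar>) \<longlonglongrightarrow> \<bar>f n x - F x\<bar>" by (intro tendsto_intros F)
    show "\<exists>N. \<forall>k\<ge>N. \<bar>f n x - f k x\<bar> \<le> md n" using unif[of n n] by blast
  qed
  then have pdiff: "\<bar>pairing \<Omega> \<rho> (f n) - pairing \<Omega> \<rho> F\<bar> \<le> md n" for n
    by (intro pairing_diff_le[OF r XX_bounded_cont[OF N f(1)] XX_bounded_cont[OF N FX]])
  have plim: "(\<lambda>n. pairing \<Omega> \<rho> (f n)) \<longlonglongrightarrow> pairing \<Omega> \<rho> F"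
  proof -
    have "(\<lambda>n. pairing \<Omega> \<rho> (f n) - pairing \<Omega> \<rho> F) \<longlonglongrightarrow> 0"
      by (rule Lim_null_comparison[OF _ md0]) (simp add: pdiff)
    then show ?thesis by (simp add: LIM_zero_iff)
  qed
  \<comment> \<open>An upper bound for \<open>bi_energy (f n)\<close> that converges, because the
    pairings do.\<close>
  define R where "R n = m + 1 / real (Suc n) + pairing \<Omega> \<rho> (f n)" for n
  have Rlim: "R \<longlonglongrightarrow> m + 0 + pairing \<Omega> \<rho> F" unfolding R_def
    by (intro tendsto_intros plim LIMSEQ_Suc[OF lim_1_over_n])
  have iG: "integrable lborel (\<lambda>x. bi_density (G x))" by (rule integrable_bi_density[OF N G(1) G1])
  have "ennreal (bi_energy F) = (\<integral>\<^sup>+x. ennreal (bi_density (G x)) \<partial>lborel)"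
    unfolding bi_energy_eq[OF N G(1)] using G1
    by (intro nn_integral_eq_integral[symmetric] iG) (auto elim!: eventually_mono intro: bi_density_bounds)
  also have "\<dots> = (\<integral>\<^sup>+x. liminf (\<lambda>k. ennreal (bi_density (g (s k) x))) \<partial>lborel)"
  proof (rule nn_integral_cong_AE)
    show "AE x in lborel. ennreal (bi_density (G x)) = liminf (\<lambda>k. ennreal (bi_density (g (s k) x)))"
      using lims by eventually_elim (rule lim_imp_Liminf[symmetric], auto)
  qed
  also have "\<dots> \<le> liminf (\<lambda>k. \<integral>\<^sup>+x. ennreal (bi_density (g (s k) x)) \<partial>lborel)"
    by (rule nn_integral_liminf) measurable
  also have "\<dots> \<le> liminf (\<lambda>k. ennreal (R (s k)))"
  proof (intro Liminf_mono always_eventually allI)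
    fix k
    have "(\<integral>\<^sup>+x. ennreal (bi_density (g (s k) x)) \<partial>lborel) = ennreal (bi_energy (f (s k)))"
      unfolding bi_energy_def g_def
    proof (intro nn_integral_eq_integral integrable_bi_density[OF N XX_D(1)[OF N f(1)] XX_D(2)[OF N f(1)]])
      show "AE x in lborel. 0 \<le> bi_density (weak_grad (f (s k)) x)"
        using XX_D(2)[OF N f(1)[of "s k"]] by eventually_elim (rule bi_density_bounds)
    qed
    also have "\<dots> \<le> ennreal (R (s k))"
      using f(2)[of "s k"] unfolding R_def BI_functional_eq by (intro ennreal_leI) linarith
    finally show "(\<integral>\<^sup>+x. ennreal (bi_density (g (s k) x)) \<partial>lborel) \<le> ennreal (R (s k))" .
  qed
  also have "\<dots> = ennreal (m + 0 + pairing \<Omega> \<rho> F)"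
    using LIMSEQ_subseq_LIMSEQ[OF Rlim s(1)] by (intro lim_imp_Liminf tendsto_ennrealI) (auto simp: comp_def)
  finally have *: "ennreal (bi_energy F) \<le> ennreal (m + pairing \<Omega> \<rho> F)" by simp
  \<comment> \<open>\<open>ennreal\<close> sends negative reals to 0, so \<open>*\<close> yields the
    real inequality only for a nonnegative right-hand side. That sign follows from 0 <=
    \<open>bi_energy (f n)\<close> <= \<open>R n\<close> in the limit.\<close>
  have "bi_energy F \<le> m + pairing \<Omega> \<rho> F"
  proof (cases "m + pairing \<Omega> \<rho> F \<ge> 0")
    case True
    then show ?thesis using * by simp
  next
    case False
    have "0 \<le> R n" for n
      using f(2)[of n] bi_energy_nonneg[OF N f(1)[of n]] unfolding R_def BI_functional_eq by linarith
    then have "0 \<le> m + 0 + pairing \<Omega> \<rho> F" by (intro LIMSEQ_le_const[OF Rlim]) auto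
    with False show ?thesis by simp
  qed
  then have "?J F \<le> m" by (simp add: BI_functional_eq)
  then show ?thesis using FX mle unfolding is_minimizer_def by (meson order_trans)
qed

lemma potential_is_minimizer: "is_minimizer \<Omega> \<rho> (potential \<Omega> \<rho>)"
  unfolding potential_def using minimizer_exists BI_minimizer_unique by (metis (mono_tags, lifting) theI)

end

section \<open>Mixtures and point masses\<close>

definition mix_measure :: "real \<Rightarrow> 'a::topological_space measure \<Rightarrow> 'a measure \<Rightarrow> 'a measure" where
  "mix_measure t \<rho> \<mu> = measure_of UNIV (sets borel) (\<lambda>A. ennreal (1 - t) * emeasure \<rho> A + ennreal t * emeasure \<mu> A)"

lemma sets_mix_measure [simp]: "sets (mix_measure t \<rho> (\<mu> :: 'a::topological_space measure)) = sets borel"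
proof -
  have "sigma_sets UNIV (sets (borel :: 'a measure)) = sets borel"
    using sets.sigma_sets_eq[of "borel :: 'a measure"] by simp
  then show ?thesis unfolding mix_measure_def by (simp add: sets_measure_of)
qed

lemma space_mix_measure [simp]: "space (mix_measure t \<rho> \<mu>) = UNIV"
  by (simp add: mix_measure_def space_measure_of_conv)

lemma emeasure_mix_measure:
  fixes \<rho> \<mu> :: "'a::topological_space measure"
  assumes s: "sets \<rho> = sets borel" "sets \<mu> = sets borel" and A: "A \<in> sets borel"
  shows "emeasure (mix_measure t \<rho> \<mu>) A = ennreal (1 - t) * emeasure \<rho> A + ennreal t * emeasure \<mu> A"
proof (rule emeasure_measure_of[OF mix_measure_def])
  show "positive (sets (mix_measure t \<rho> \<mu>)) (\<lambda>A. ennreal (1 - t) * emeasure \<rho> A + ennreal t * emeasure \<mu> A)"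
    by (simp add: positive_def)
  show "countably_additive (sets (mix_measure t \<rho> \<mu>)) (\<lambda>A. ennreal (1 - t) * emeasure \<rho> A + ennreal t * emeasure \<mu> A)"
  proof (rule countably_additiveI)
    fix B :: "nat \<Rightarrow> 'a set"
    assume B: "range B \<subseteq> sets (mix_measure t \<rho> \<mu>)" "disjoint_family B"
    have "(\<Sum>i. emeasure \<rho> (B i)) = emeasure \<rho> (\<Union>i. B i)" "(\<Sum>i. emeasure \<mu> (B i)) = emeasure \<mu> (\<Union>i. B i)"
      using B s by (auto intro!: suminf_emeasure)
    then show "(\<Sum>i. ennreal (1 - t) * emeasure \<rho> (B i) + ennreal t * emeasure \<mu> (B i))
      = ennreal (1 - t) * emeasure \<rho> (\<Union>i. B i) + ennreal t * emeasure \<mu> (\<Union>i. B i)"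
      by (simp add: suminf_add[symmetric])
  qed
qed (use A in auto)

lemma nn_integral_mix_measure:
  fixes \<rho> \<mu> :: "'a::topological_space measure"
  assumes s: "sets \<rho> = sets borel" "sets \<mu> = sets borel" and f: "f \<in> borel_measurable borel"
  shows "(\<integral>\<^sup>+x. f x \<partial>mix_measure t \<rho> \<mu>) = ennreal (1 - t) * (\<integral>\<^sup>+x. f x \<partial>\<rho>) + ennreal t * (\<integral>\<^sup>+x. f x \<partial>\<mu>)"
proof -
  let ?M = "mix_measure t \<rho> \<mu>"
  have M: "borel_measurable \<rho> = (borel_measurable borel :: ('a \<Rightarrow> ennreal) set)"
    "borel_measurable \<mu> = (borel_measurable borel :: ('a \<Rightarrow> ennreal) set)"
    "borel_measurable ?M = (borel_measurable borel :: ('a \<Rightarrow> ennreal) set)"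
    using s by (auto intro!: measurable_cong_sets)
  show ?thesis using f
  proof (induction rule: borel_measurable_induct)
    case (cong f g)
    then have "f = g" by (simp add: fun_eq_iff)
    with cong show ?case by simp
  next
    case (set A)
    then show ?case using s by (simp add: emeasure_mix_measure)
  next
    case (mult u c)
    then show ?case by (simp add: M nn_integral_cmult distrib_left mult.left_commute)
  next
    case (add u v)
    then show ?case by (simp add: M nn_integral_add distrib_left ac_simps)
  next
    case (seq U)
    have inc: "incseq (\<lambda>i. integral\<^sup>N \<rho> (U i))" "incseq (\<lambda>i. integral\<^sup>N \<mu> (U i))"
      using seq(3) by (auto simp: incseq_def le_fun_def intro!: nn_integral_mono)
    have sup: "integral\<^sup>N L (Sup (range U)) = (SUP i. integral\<^sup>N L (U i))"
      if "borel_measurable L = (borel_measurable borel :: ('a \<Rightarrow> ennreal) set)" for L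
    proof -
      have "integral\<^sup>N L (Sup (range U)) = (\<integral>\<^sup>+x. (SUP i. U i x) \<partial>L)"
        by (intro nn_integral_cong) (simp add: image_comp)
      also have "\<dots> = (SUP i. integral\<^sup>N L (U i))"
        by (rule nn_integral_monotone_convergence_SUP) (use seq that in auto)
      finally show ?thesis .
    qed
    have "(SUP i. integral\<^sup>N ?M (U i)) = (SUP i. ennreal (1 - t) * integral\<^sup>N \<rho> (U i) + ennreal t * integral\<^sup>N \<mu> (U i))"
      using seq.IH by simp
    also have "\<dots> = (SUP i. ennreal (1 - t) * integral\<^sup>N \<rho> (U i)) + (SUP i. ennreal t * integral\<^sup>N \<mu> (U i))"
      using inc by (intro ennreal_SUP_add) (auto simp: incseq_def intro!: mult_left_mono)
    finally show ?case
      unfolding sup[OF M(1)] sup[OF M(2)] sup[OF M(3)] by (simp add: SUP_mult_left_ennreal)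
  qed
qed

lemma prob_boundary_mix:
  assumes "\<rho> \<in> prob_boundary \<Omega>" "\<mu> \<in> prob_boundary \<Omega>" "0 \<le> t" "t \<le> 1"
  shows "mix_measure t \<rho> \<mu> \<in> prob_boundary \<Omega>"
proof -
  have s: "sets \<rho> = sets borel" "sets \<mu> = sets borel" using assms by (auto simp: prob_boundary_def)
  have m: "frontier \<Omega> \<in> sets borel" "- frontier \<Omega> \<in> sets borel"
    by (simp_all add: borel_closed borel_comp)
  show ?thesis using assms emeasure_mix_measure[OF s m(1)] emeasure_mix_measure[OF s m(2)]
    by (simp add: prob_boundary_def flip: ennreal_plus)
qed

lemma pairing_mix_nonneg:
  fixes \<phi> :: "'a::euclidean_space \<Rightarrow> real"
  assumes r: "\<rho> \<in> prob_boundary \<Omega>" and m: "\<mu> \<in> prob_boundary \<Omega>" and t: "0 \<le> t" "t \<le> 1"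
    and p: "\<phi> \<in> borel_measurable borel" "\<exists>B. \<forall>x. \<bar>\<phi> x\<bar> \<le> B" "\<And>x. \<phi> x \<ge> 0"
  shows "pairing \<Omega> (mix_measure t \<rho> \<mu>) \<phi> = (1 - t) * pairing \<Omega> \<rho> \<phi> + t * pairing \<Omega> \<mu> \<phi>"
proof -
  have [measurable]: "frontier \<Omega> \<in> sets borel" by (simp add: borel_closed)
  note p(1) [measurable]
  have nn: "(\<integral>\<^sup>+x. ennreal (indicator (frontier \<Omega>) x * \<phi> x) \<partial>\<nu>) = ennreal (pairing \<Omega> \<nu> \<phi>)"
    and pos: "0 \<le> pairing \<Omega> \<nu> \<phi>" if "\<nu> \<in> prob_boundary \<Omega>" for \<nu>
    using pairing_integrable[OF that p(1,2)] p(3) unfolding pairing_def set_lebesgue_integral_def set_integrable_def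
    by (auto intro!: nn_integral_eq_integral integral_nonneg_AE)
  have s: "sets \<rho> = sets borel" "sets \<mu> = sets borel" using r m by (auto simp: prob_boundary_def)
  have "ennreal (pairing \<Omega> (mix_measure t \<rho> \<mu>) \<phi>)
    = ennreal (1 - t) * ennreal (pairing \<Omega> \<rho> \<phi>) + ennreal t * ennreal (pairing \<Omega> \<mu> \<phi>)"
    unfolding nn[OF prob_boundary_mix[OF r m t], symmetric] nn[OF r, symmetric] nn[OF m, symmetric]
    by (rule nn_integral_mix_measure[OF s]) measurable
  also have "\<dots> = ennreal ((1 - t) * pairing \<Omega> \<rho> \<phi> + t * pairing \<Omega> \<mu> \<phi>)"
    using t pos[OF r] pos[OF m] by (simp add: ennreal_mult)
  finally show ?thesis
    using t pos[OF r] pos[OF m] pos[OF prob_boundary_mix[OF r m t]] by (subst (asm) ennreal_inj) auto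
qed

text \<open>Adding a bound B makes the integrand nonnegative. All three measures have mass 1 on the
  frontier, so every pairing shifts by the same B.\<close>

lemma pairing_mix:
  fixes \<phi> :: "'a::euclidean_space \<Rightarrow> real"
  assumes r: "\<rho> \<in> prob_boundary \<Omega>" and m: "\<mu> \<in> prob_boundary \<Omega>" and t: "0 \<le> t" "t \<le> 1"
    and p: "\<phi> \<in> borel_measurable borel" "\<exists>B. \<forall>x. \<bar>\<phi> x\<bar> \<le> B"
  shows "pairing \<Omega> (mix_measure t \<rho> \<mu>) \<phi> = (1 - t) * pairing \<Omega> \<rho> \<phi> + t * pairing \<Omega> \<mu> \<phi>"
proof -
  obtain B where B: "\<And>x. \<bar>\<phi> x\<bar> \<le> B" using p(2) by blast
  have q: "(\<lambda>x. 1 * \<phi> x + 1 * B) \<in> borel_measurable borel" "\<exists>C. \<forall>x. \<bar>1 * \<phi> x + 1 * B\<bar> \<le> C"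
    "\<And>x. 0 \<le> 1 * \<phi> x + 1 * B"
  proof -
    show "\<exists>C. \<forall>x. \<bar>1 * \<phi> x + 1 * B\<bar> \<le> C"
    proof (intro exI[of _ "2 * B"] allI)
      show "\<bar>1 * \<phi> x + 1 * B\<bar> \<le> 2 * B" for x using B[of x] by linarith
    qed
    show "0 \<le> 1 * \<phi> x + 1 * B" for x using B[of x] by simp
  qed (use p(1) in simp)
  have lin: "pairing \<Omega> \<nu> (\<lambda>x. 1 * \<phi> x + 1 * B) = pairing \<Omega> \<nu> \<phi> + B" if "\<nu> \<in> prob_boundary \<Omega>" for \<nu>
    using pairing_linear[OF that p, of "\<lambda>x. B" 1 1] that by auto
  have "pairing \<Omega> (mix_measure t \<rho> \<mu>) \<phi> + B = (1 - t) * (pairing \<Omega> \<rho> \<phi> + B) + t * (pairing \<Omega> \<mu> \<phi> + B)"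
    using pairing_mix_nonneg[OF r m t q] unfolding lin[OF r] lin[OF m] lin[OF prob_boundary_mix[OF r m t]] .
  then show ?thesis by (simp add: algebra_simps)
qed

text \<open>The Dirac measure, as an image of the counting measure on one point; in this form it
  carries the Borel sigma-algebra.\<close>

definition point_mass :: "'a::topological_space \<Rightarrow> 'a measure" where
  "point_mass x = distr (count_space {()}) borel (\<lambda>_. x)"

lemma point_mass_prob_boundary:
  assumes "x \<in> frontier \<Omega>" shows "point_mass x \<in> prob_boundary \<Omega>"
  using assms unfolding prob_boundary_def point_mass_def
  by (auto simp: emeasure_distr borel_closed borel_comp vimage_def)

lemma pairing_point_mass:
  fixes \<phi> :: "'a::euclidean_space \<Rightarrow> real"
  assumes "x \<in> frontier \<Omega>" "\<phi> \<in> borel_measurable borel"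
  shows "pairing \<Omega> (point_mass x) \<phi> = \<phi> x"
proof -
  have [measurable]: "frontier \<Omega> \<in> sets borel" by (simp add: borel_closed)
  show ?thesis using assms
    unfolding pairing_def point_mass_def set_lebesgue_integral_def
    by (subst integral_distr) (auto simp: lebesgue_integral_count_space_finite)
qed

section \<open>Equilibrium measures\<close>

context
  fixes \<Omega> :: "'a::euclidean_space set"
  assumes N: "DIM('a) \<ge> 3"
begin

lemma potential_XX: "\<rho> \<in> prob_boundary \<Omega> \<Longrightarrow> potential \<Omega> \<rho> \<in> XX"
  using potential_is_minimizer[OF N] by (auto simp: is_minimizer_def)

lemma energy_eq: "energy \<Omega> \<rho> = pairing \<Omega> \<rho> (potential \<Omega> \<rho>) - bi_energy (potential \<Omega> \<rho>)"
  by (simp add: energy_def BI_functional_eq)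

lemma energy_ge:
  assumes "\<rho> \<in> prob_boundary \<Omega>" "\<psi> \<in> XX"
  shows "pairing \<Omega> \<rho> \<psi> - bi_energy \<psi> \<le> energy \<Omega> \<rho>"
  using potential_is_minimizer[OF N assms(1)] assms(2)
  unfolding energy_def is_minimizer_def BI_functional_eq by force

lemma energy_nonneg: "\<rho> \<in> prob_boundary \<Omega> \<Longrightarrow> 0 \<le> energy \<Omega> \<rho>"
  using energy_ge[OF _ XX_zero[OF N]] by (simp add: bi_energy_zero[OF N])

lemma equilibrium_energy_le:
  assumes "equilibrium_measure \<Omega> \<rho>" "\<mu> \<in> prob_boundary \<Omega>"
  shows "energy \<Omega> \<rho> \<le> energy \<Omega> \<mu>"
proof -
  have "bdd_below (energy \<Omega> ` prob_boundary \<Omega>)"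
    by (rule bdd_belowI2[of _ 0]) (rule energy_nonneg)
  then show ?thesis using assms by (auto simp: equilibrium_measure_def intro: cINF_lower)
qed

text \<open>Compare \<open>\<rho>\<close> with the mixtures \<open>(1-t)\<rho> + t\<mu>\<close>, whose potentials converge uniformly to that of \<open>\<rho>\<close> as \<open>t \<rightarrow> 0\<close>.\<close>

lemma equilibrium_pairing_le:
  assumes eq: "equilibrium_measure \<Omega> \<rho>" and m: "\<mu> \<in> prob_boundary \<Omega>"
  shows "pairing \<Omega> \<rho> (potential \<Omega> \<rho>) \<le> pairing \<Omega> \<mu> (potential \<Omega> \<rho>)"
proof -
  have r: "\<rho> \<in> prob_boundary \<Omega>" using eq by (simp add: equilibrium_measure_def)
  define H where "H = height_bound TYPE('a)"
  define \<phi> where "\<phi> = potential \<Omega> \<rho>"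
  define t where "t n = 1 / real (Suc n)" for n
  have t: "0 < t n" "t n \<le> 1" for n by (auto simp: t_def)
  have t0: "t \<longlonglongrightarrow> 0" unfolding t_def by (intro LIMSEQ_Suc[OF lim_1_over_n])
  define \<rho>' where "\<rho>' n = mix_measure (t n) \<rho> \<mu>" for n
  have r': "\<rho>' n \<in> prob_boundary \<Omega>" for n
    unfolding \<rho>'_def using t[of n] by (intro prob_boundary_mix r m) auto
  define \<phi>' where "\<phi>' n = potential \<Omega> (\<rho>' n)" for n
  have X: "\<phi> \<in> XX" "\<phi>' n \<in> XX" for n unfolding \<phi>_def \<phi>'_def by (auto intro: potential_XX r r')
  have pm: "pairing \<Omega> (\<rho>' n) \<psi> = (1 - t n) * pairing \<Omega> \<rho> \<psi> + t n * pairing \<Omega> \<mu> \<psi>" if "\<psi> \<in> XX" for n \<psi>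
    unfolding \<rho>'_def using t[of n] by (intro pairing_mix r m XX_bounded_cont[OF N that]) auto
  \<comment> \<open>The energy of \<rho> is tested with the potential of the mixture: the gradient
    terms cancel, and then the factor t.\<close>
  have step: "pairing \<Omega> \<rho> (\<phi>' n) \<le> pairing \<Omega> \<mu> (\<phi>' n)" for n
  proof -
    have "pairing \<Omega> \<rho> (\<phi>' n) - bi_energy (\<phi>' n) \<le> energy \<Omega> \<rho>" by (rule energy_ge[OF r X(2)])
    also have "\<dots> \<le> energy \<Omega> (\<rho>' n)" by (rule equilibrium_energy_le[OF eq r'])
    also have "\<dots> = (1 - t n) * pairing \<Omega> \<rho> (\<phi>' n) + t n * pairing \<Omega> \<mu> (\<phi>' n) - bi_energy (\<phi>' n)"
      unfolding energy_eq \<phi>'_def[symmetric] pm[OF X(2)] ..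
    finally have "t n * pairing \<Omega> \<rho> (\<phi>' n) \<le> t n * pairing \<Omega> \<mu> (\<phi>' n)" by (simp add: algebra_simps)
    then show ?thesis using t(1)[of n] by simp
  qed
  have height: "\<bar>pairing \<Omega> \<nu> \<psi>\<bar> \<le> H" if "\<nu> \<in> prob_boundary \<Omega>" "\<psi> \<in> XX" "\<And>x. \<bar>\<psi> x\<bar> \<le> H" for \<nu> \<psi>
    using pairing_diff_le[OF that(1) XX_bounded_cont[OF N that(2)], of "\<lambda>x. 0" H] that(1,3) by auto
  have hb: "\<bar>\<phi> x\<bar> \<le> H" "\<bar>\<phi>' n x\<bar> \<le> H" for n x
    unfolding H_def \<phi>_def \<phi>'_def by (auto intro: minimizer_height[OF N] potential_is_minimizer[OF N] r r')
  \<comment> \<open>The functional of the mixture, minimized by \<open>\<phi>' n\<close>, differs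
    from that of \<rho> by t times a difference of pairings with \<rho> and \<mu>. The four pairings
    are at most H each, and stability contributes another factor 4.\<close>
  have close: "L2sq (\<lambda>x. weak_grad (\<phi>' n) x - weak_grad \<phi> x) \<le> 16 * H * t n" for n
  proof -
    have "L2sq (\<lambda>x. weak_grad (\<phi>' n) x - weak_grad \<phi> x) \<le> 4 * (BI_functional \<Omega> \<rho> (\<phi>' n) - BI_functional \<Omega> \<rho> \<phi>)"
      unfolding \<phi>_def by (rule BI_minimizer_stability[OF N r potential_is_minimizer[OF N r] X(2)])
    also have "BI_functional \<Omega> \<rho> (\<phi>' n) - BI_functional \<Omega> \<rho> \<phi>
      \<le> t n * (pairing \<Omega> \<rho> \<phi> - pairing \<Omega> \<rho> (\<phi>' n) + pairing \<Omega> \<mu> (\<phi>' n) - pairing \<Omega> \<mu> \<phi>)"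
      using energy_ge[OF r' X(1), of n]
      unfolding energy_eq \<phi>'_def[symmetric] pm[OF X(2)] pm[OF X(1)] BI_functional_eq by (simp add: algebra_simps)
    also have "\<dots> \<le> t n * (4 * H)"
      using height[OF r X(1) hb(1)] height[OF r X(2) hb(2)] height[OF m X(1) hb(1)] height[OF m X(2) hb(2)] t(1)[of n]
      by (intro mult_left_mono) (auto simp: abs_le_iff, smt (verit))
    finally show ?thesis by (simp add: mult_ac)
  qed
  define md where "md n = modulus TYPE('a) (16 * H * t n)" for n
  have "(\<lambda>n. 16 * H * t n) \<longlonglongrightarrow> 16 * H * 0" by (intro tendsto_intros t0)
  then have "md \<longlonglongrightarrow> 0" unfolding md_def
    using order_trans[OF L2sq_nonneg close] by (intro modulus_tendsto_0[OF N]) simp_all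
  then have lim: "(\<lambda>n. 2 * md n) \<longlonglongrightarrow> 2 * 0" by (intro tendsto_intros)
  have pd: "\<bar>pairing \<Omega> \<nu> (\<phi>' n) - pairing \<Omega> \<nu> \<phi>\<bar> \<le> md n" if "\<nu> \<in> prob_boundary \<Omega>" for \<nu> n
    unfolding md_def
    by (rule pairing_diff_le[OF that XX_bounded_cont[OF N X(2)] XX_bounded_cont[OF N X(1)] XX_diff_sup_bound[OF N X(2,1) close]])
  have "pairing \<Omega> \<rho> \<phi> - pairing \<Omega> \<mu> \<phi> \<le> 2 * md n" for n
    using pd[OF r, of n] pd[OF m, of n] step[of n] by linarith
  then have "pairing \<Omega> \<rho> \<phi> - pairing \<Omega> \<mu> \<phi> \<le> 2 * 0" by (intro LIMSEQ_le_const[OF lim]) auto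
  then show ?thesis by (simp add: \<phi>_def)
qed

text \<open>Truncating the potential at the height \<open>\<lambda>\<close> leaves the pairing with \<open>\<rho>\<close> unchanged and does not increase the
  gradient, so by uniqueness of the minimizer the truncation changes nothing.\<close>

lemma equilibrium_potential_constant:
  assumes eq: "equilibrium_measure \<Omega> \<rho>" and x: "x \<in> frontier \<Omega>"
  shows "potential \<Omega> \<rho> x = pairing \<Omega> \<rho> (potential \<Omega> \<rho>)"
proof -
  have r: "\<rho> \<in> prob_boundary \<Omega>" using eq by (simp add: equilibrium_measure_def)
  note R = prob_boundaryD[OF r]
  define \<phi> where "\<phi> = potential \<Omega> \<rho>"
  define l where "l = pairing \<Omega> \<rho> \<phi>"
  have min: "is_minimizer \<Omega> \<rho> \<phi>" unfolding \<phi>_def by (rule potential_is_minimizer[OF N r])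
  have X: "\<phi> \<in> XX" unfolding \<phi>_def by (rule potential_XX[OF r])
  note B = XX_bounded_cont[OF N X]
  \<comment> \<open>\<lambda> is the sum of the energy and the gradient integral, both nonnegative;
    \<open>soft_min_approx\<close> asks for this sign.\<close>
  have l0: "l \<ge> 0"
    using energy_nonneg[OF r] bi_energy_nonneg[OF N X] unfolding energy_eq \<phi>_def[symmetric] l_def by linarith
  have ge: "l \<le> \<phi> y" if "y \<in> frontier \<Omega>" for y
    using equilibrium_pairing_le[OF eq point_mass_prob_boundary[OF that]] pairing_point_mass[OF that B(1)]
    unfolding l_def \<phi>_def by simp
  \<comment> \<open>\<phi> - \<lambda> is nonnegative on the frontier and has zero
    \<rho>-integral.\<close>
  have ae: "AE y in \<rho>. y \<in> frontier \<Omega> \<longrightarrow> \<phi> y = l"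
  proof -
    have int: "set_integrable \<rho> (frontier \<Omega>) (\<lambda>y. 1 * \<phi> y + (-1) * l)"
      using pairing_integrable[OF r B] pairing_integrable[OF r, of "\<lambda>_. l"] by (simp, intro set_integral_diff) auto
    have "pairing \<Omega> \<rho> (\<lambda>y. 1 * \<phi> y + (-1) * l) = 0"
      using pairing_linear[OF r B, of "\<lambda>_. l" 1 "-1"] r by (auto simp: l_def)
    then have "AE y in \<rho>. indicator (frontier \<Omega>) y *\<^sub>R (1 * \<phi> y + (-1) * l) = 0"
      using int ge unfolding pairing_def set_lebesgue_integral_def set_integrable_def
      by (subst (asm) integral_nonneg_eq_0_iff_AE) (auto simp: indicator_def)
    then show ?thesis by eventually_elim (auto simp: indicator_def)
  qed
  \<comment> \<open>The truncation lowers the pairing with \<rho> by at most e ln 2 and does not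
    raise the gradient integral. Stability therefore places it uniformly within
    \<open>modulus\<close> of \<phi>, while it never exceeds \<lambda> + e ln 2.\<close>
  have bound: "\<phi> x \<le> l + e * ln 2 + modulus TYPE('a) (4 * (e * ln 2))" if e: "e > 0" for e
  proof -
    define h where "h = soft_min e l"
    define \<psi> where "\<psi> y = h (\<phi> y)" for y
    define g where "g y = soft_min_deriv e l (\<phi> y) *\<^sub>R weak_grad \<phi> y" for y
    have D: "D12_grad \<psi> g" unfolding \<psi>_def g_def h_def
      by (rule D12_grad_chain[OF N XX_D(1)[OF N X] real_smooth_soft_min[OF e] soft_min_0 soft_min_DERIV[OF e] soft_min_deriv_bounds])
    have gle: "norm (g y) \<le> norm (weak_grad \<phi> y)" for y
      unfolding g_def using soft_min_deriv_bounds[of e l "\<phi> y"] by (simp add: mult_left_le_one_le)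
    have g1: "AE y in lborel. norm (g y) \<le> 1"
      using XX_D(2)[OF N X] by eventually_elim (rule order_trans[OF gle])
    have hc: "continuous_on UNIV h" unfolding h_def by (rule real_smooth_continuous[OF real_smooth_soft_min[OF e]])
    have "continuous_on UNIV \<psi>" unfolding \<psi>_def
      by (rule continuous_on_compose2[OF hc XX_D(3)[OF N X]]) simp
    then have XP: "\<psi> \<in> XX" by (rule XX_I[OF N D g1])
    have "bi_energy \<psi> \<le> bi_energy \<phi>"
      unfolding bi_energy_eq[OF N D] bi_energy_def[of \<phi>]
      by (intro integral_mono integrable_bi_density[OF N D g1] integrable_bi_density[OF N XX_D(1)[OF N X] XX_D(2)[OF N X]]
          bi_density_mono gle)
    moreover have "pairing \<Omega> \<rho> \<psi> = h l"
    proof -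
      have "pairing \<Omega> \<rho> \<psi> = pairing \<Omega> \<rho> (\<lambda>y. h l)"
        unfolding pairing_def set_lebesgue_integral_def
      proof (rule integral_cong_AE)
        show "AE y in \<rho>. indicator (frontier \<Omega>) y *\<^sub>R \<psi> y = indicator (frontier \<Omega>) y *\<^sub>R h l"
          using ae by eventually_elim (auto simp: \<psi>_def indicator_def)
        show "(\<lambda>y. indicator (frontier \<Omega>) y *\<^sub>R \<psi> y) \<in> borel_measurable \<rho>"
          using pairing_integrable[OF r XX_bounded_cont[OF N XP]] unfolding set_integrable_def by (rule borel_measurable_integrable)
        show "(\<lambda>y. indicator (frontier \<Omega>) y *\<^sub>R h l) \<in> borel_measurable \<rho>"
          using R(5) by simp
      qed
      then show ?thesis using r by simp
    qed
    moreover have "h l \<ge> l - e * ln 2" using soft_min_approx[OF e l0, of l] unfolding h_def by simp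
    ultimately have "BI_functional \<Omega> \<rho> \<psi> - BI_functional \<Omega> \<rho> \<phi> \<le> e * ln 2"
      unfolding BI_functional_eq l_def[symmetric] by linarith
    then have "L2sq (\<lambda>y. weak_grad \<psi> y - weak_grad \<phi> y) \<le> 4 * (e * ln 2)"
      using BI_minimizer_stability[OF N r min XP] by argo
    from XX_diff_sup_bound[OF N XP X this, of x]
    have "\<phi> x \<le> \<psi> x + modulus TYPE('a) (4 * (e * ln 2))" by linarith
    moreover have "\<psi> x \<le> l + e * ln 2"
      using soft_min_approx[OF e l0, of "\<phi> x"] unfolding \<psi>_def h_def by linarith
    ultimately show ?thesis by linarith
  qed
  define e where "e n = 1 / real (Suc n)" for n
  have e0: "e \<longlonglongrightarrow> 0" unfolding e_def by (intro LIMSEQ_Suc[OF lim_1_over_n])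
  have e: "e n > 0" for n by (simp add: e_def)
  have "(\<lambda>n. 4 * (e n * ln 2)) \<longlonglongrightarrow> 4 * (0 * ln 2)" by (intro tendsto_intros e0)
  then have "(\<lambda>n. modulus TYPE('a) (4 * (e n * ln 2))) \<longlonglongrightarrow> 0"
    using e by (intro modulus_tendsto_0[OF N]) (auto simp: less_imp_le)
  then have "(\<lambda>n. l + e n * ln 2 + modulus TYPE('a) (4 * (e n * ln 2))) \<longlonglongrightarrow> l + 0 * ln 2 + 0"
    by (intro tendsto_intros e0)
  then have "\<phi> x \<le> l + 0 * ln 2 + 0" by (rule LIMSEQ_le_const) (use bound e in auto)
  with ge[OF x] show ?thesis by (simp add: \<phi>_def l_def)
qed

text \<open>The potential is constant on the frontier, where \<mu> has mass 1.\<close>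

lemma equilibrium_pairing_eq:
  assumes eq: "equilibrium_measure \<Omega> \<rho>" and m: "\<mu> \<in> prob_boundary \<Omega>"
  shows "pairing \<Omega> \<mu> (potential \<Omega> \<rho>) = pairing \<Omega> \<rho> (potential \<Omega> \<rho>)"
proof -
  have "pairing \<Omega> \<mu> (potential \<Omega> \<rho>) = pairing \<Omega> \<mu> (\<lambda>x. pairing \<Omega> \<rho> (potential \<Omega> \<rho>))"
    unfolding pairing_def[of \<Omega> \<mu>]
    by (rule set_lebesgue_integral_cong) (use prob_boundaryD[OF m] equilibrium_potential_constant[OF eq] in auto)
  then show ?thesis using m by simp
qed

text \<open>The energy is a supremum of functionals that are affine in the measure, hence convex; so the potential of the midpoint of two
  equilibrium measures is optimal for both.\<close>

lemma equilibrium_potential_unique: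
  assumes eq1: "equilibrium_measure \<Omega> \<rho>" and eq2: "equilibrium_measure \<Omega> \<sigma>"
  shows "potential \<Omega> \<rho> = potential \<Omega> \<sigma>"
proof -
  have r: "\<rho> \<in> prob_boundary \<Omega>" and s: "\<sigma> \<in> prob_boundary \<Omega>"
    using eq1 eq2 by (auto simp: equilibrium_measure_def)
  define \<tau> where "\<tau> = mix_measure (1/2) \<rho> \<sigma>"
  have t: "\<tau> \<in> prob_boundary \<Omega>" unfolding \<tau>_def by (intro prob_boundary_mix r s) auto
  define \<phi> where "\<phi> = potential \<Omega> \<tau>"
  have X: "\<phi> \<in> XX" unfolding \<phi>_def by (rule potential_XX[OF t])
  have "pairing \<Omega> \<tau> \<phi> = (1 - 1/2) * pairing \<Omega> \<rho> \<phi> + 1/2 * pairing \<Omega> \<sigma> \<phi>"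
    unfolding \<tau>_def by (intro pairing_mix r s XX_bounded_cont[OF N X]) auto
  moreover have "energy \<Omega> \<tau> = pairing \<Omega> \<tau> \<phi> - bi_energy \<phi>" by (simp add: energy_eq \<phi>_def)
  moreover have "energy \<Omega> \<rho> \<le> energy \<Omega> \<tau>" by (rule equilibrium_energy_le[OF eq1 t])
  moreover have "energy \<Omega> \<rho> = energy \<Omega> \<sigma>"
    using equilibrium_energy_le[OF eq1 s] equilibrium_energy_le[OF eq2 r] by simp
  moreover note energy_ge[OF r X] energy_ge[OF s X]
  \<comment> \<open>The energy of \<tau> is the mean of two values, neither above the common
    minimum, and is itself at least that minimum; so both values equal it.\<close>
  ultimately have *: "energy \<Omega> \<rho> \<le> pairing \<Omega> \<rho> \<phi> - bi_energy \<phi>" "energy \<Omega> \<sigma> \<le> pairing \<Omega> \<sigma> \<phi> - bi_energy \<phi>"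
    by argo+
  have min: "is_minimizer \<Omega> \<nu> \<phi>" if n: "\<nu> \<in> prob_boundary \<Omega>" and le: "energy \<Omega> \<nu> \<le> pairing \<Omega> \<nu> \<phi> - bi_energy \<phi>" for \<nu>
    unfolding is_minimizer_def BI_functional_eq
  proof (intro conjI X ballI)
    fix \<psi> :: "'a \<Rightarrow> real" assume "\<psi> \<in> XX"
    from energy_ge[OF n this] le show "bi_energy \<phi> - pairing \<Omega> \<nu> \<phi> \<le> bi_energy \<psi> - pairing \<Omega> \<nu> \<psi>" by argo
  qed
  have "potential \<Omega> \<rho> = \<phi>" by (rule BI_minimizer_unique[OF N r min[OF r *(1)] potential_is_minimizer[OF N r]])
  moreover have "potential \<Omega> \<sigma> = \<phi>" by (rule BI_minimizer_unique[OF N s min[OF s *(2)] potential_is_minimizer[OF N s]])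
  ultimately show ?thesis by simp
qed

end

theorem corollary4p5:
  fixes \<Omega> :: "'a::euclidean_space set"
    and \<rho>s :: "'a measure"
    and lams :: real
  assumes "DIM('a) \<ge> 3"
    and "open \<Omega>" and "connected \<Omega>" and "\<Omega> \<noteq> {}" and "bounded \<Omega>"
    and "equilibrium_measure \<Omega> \<rho>s"
    and "lams = pairing \<Omega> \<rho>s (potential \<Omega> \<rho>s)"
  shows "(\<forall>\<mu>\<in>prob_boundary \<Omega>.
            lams = pairing \<Omega> \<rho>s (potential \<Omega> \<rho>s) \<and>
            pairing \<Omega> \<rho>s (potential \<Omega> \<rho>s) = pairing \<Omega> \<mu> (potential \<Omega> \<rho>s)) \<and>
         (\<forall>\<rho>ss lamss. equilibrium_measure \<Omega> \<rho>ss \<longrightarrow>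
            lamss = pairing \<Omega> \<rho>ss (potential \<Omega> \<rho>ss) \<longrightarrow>
            potential \<Omega> \<rho>s = potential \<Omega> \<rho>ss \<and> lams = lamss)"
proof (intro conjI ballI allI impI)
  note N = assms(1) and eq = assms(6) and lam = assms(7)
  show "lams = pairing \<Omega> \<rho>s (potential \<Omega> \<rho>s)" by (rule lam)
  show "pairing \<Omega> \<rho>s (potential \<Omega> \<rho>s) = pairing \<Omega> \<mu> (potential \<Omega> \<rho>s)" if "\<mu> \<in> prob_boundary \<Omega>" for \<mu>
    by (rule equilibrium_pairing_eq[OF N eq that, symmetric])
  fix \<rho>ss lamss
  assume eq': "equilibrium_measure \<Omega> \<rho>ss" and lam': "lamss = pairing \<Omega> \<rho>ss (potential \<Omega> \<rho>ss)"
  show pot: "potential \<Omega> \<rho>s = potential \<Omega> \<rho>ss" by (rule equilibrium_potential_unique[OF N eq eq'])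
  \<comment> \<open>The second equilibrium measure is itself an admissible test measure for the
    potential of the first, and the two potentials agree.\<close>
  have "\<rho>ss \<in> prob_boundary \<Omega>" using eq' by (simp add: equilibrium_measure_def)
  from equilibrium_pairing_eq[OF N eq this] show "lams = lamss" using lam lam' pot by simp
qed

end
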